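(* Let $X$ be a symplectic orbispace with symplectic form $\omega$, let $R$ be the curvature form of a symplectic connection $\nabla$ on $X$, and let $r_0=\delta^-R$. Let $r\in\Gamma^\infty_{\mathrm{str}}(\Lambda^1\widehat{\mathbb W}X)$ be the (unique) solution, with $\deg_{\mathrm F}(r)\ge\deg_{\mathrm F}(r_0)$, of the equation $r=r_0+\delta^-\big(\nabla r+\frac i\lambda r^2\big)$. Then the curvature form $$\Omega=-\omega+R-\delta r+\nabla r+\tfrac i\lambda r^2$$ of the connection $D=\nabla+\delta+\frac i\lambda[r,\cdot]$ on $\Lambda^\bullet\widehat{\mathbb W}X$ is a central element with respect to $\circ$ and satisfies $\Omega=-\omega$. In particular, $D$ then is a flat connection.
   Context: Orbispaces. $\mathfrak{Man}^{\mathrm{sym}}$ has as objects pairs $(M,G)$ of a finite dimensional smooth manifold $M$ and a compact Lie group $G$ acting smoothly on $M$; a morphism $(\varphi,\iota):(N,H)\to(M,G)$ is a smooth map $\varphi$ together with a continuous homomorphism $\iota:H\to G$ with $\varphi(hy)=\iota(h)\varphi(y)$; it induces $\overline\varphi:N/H\to M/G$. It is an open embedding if $\varphi$ is an open smooth embedding and $\overline\varphi$ is a homeomorphism onto an open subset. An orbispace chart of a Hausdorff space $X$ is a triple $(\tilde U,G,\varrho)$ with $(\tilde U,G)\in\mathfrak{Man}^{\mathrm{sym}}$ and $\varrho:\tilde U\to X$ continuous, $G$-invariant, inducing a homeomorphism $\tilde U/G\to U$ onto an open set $U\subset X$ (the image). Morphisms of charts $(\tilde V,H,\upsilon)\to(\tilde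 U,G,\varrho)$ are morphisms $(\varphi,\iota)$ with $\varrho\circ\varphi=\upsilon$. For an open covering $\mathcal U$ of $X$, $\overline{\mathcal U}$ is the category whose objects are the connected components of finite intersections of elements of $\mathcal U$ and whose morphisms are the inclusions. An orbispace is a second countable, locally connected, paracompact Hausdorff space $X$ with a functor $\mathsf X$ from $\overline{\mathcal U}$ to orbispace charts of $X$ such that $\mathsf X(U)$ has image $U$ and connected domain $\tilde U$, and each $\mathsf X_{VU}=\mathsf X(V\to U)$ is an open embedding. A symplectic form on $X$ is a family $\omega=(\omega_{\tilde U})$ of $G$-invariant symplectic forms on the domains $\tilde U$ of the charts of $\mathsf X$ with $\varphi^*\omega_{\tilde U}=\omega_{\tilde V}$ for every morphism $(\varphi,\iota)=\mathsf X_{VU}$. A symplectic orbispace is an orbispace with a symplectic form. A connection on $X$ is a family $\nabla=(\nabla_{\tilde U})$ of $G$-invariant affine connections on the $\tilde U$ such that $\varphi^*(\nabla_{\tilde U}\xi_{\tilde U})=\nabla_{\tilde V}\xi_{\tilde V}$ for every vector field $(\xi_{\tilde U})$ on $X$ and every morphism $(\varphi,\iota)=\mathsf X_{VU}$; it is called symplectic if $\nabla_{\tilde U}\omega_{\tilde U}=0$ for all $\tilde U$. It is assumed (without loss of generality) that every $\tilde U$ is an open $G$-invariant subset of $\mathbb R^{2n}$ on which $G$ acts by linear symplectic maps, with $\omega_{\tilde U}=\sum_{j=1}^nd\tilde x_j\wedge d\tilde x_{n+j}$ in the natural coordinates $\tilde x_1,\dots,\tilde x_{2n}$. Weyl algebra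 orbibundle. For a finite dimensional Poisson vector space $V$ with Poisson bivector $\Pi=\sum_i\Pi_{1i}\otimes\Pi_{2i}$, $\Pi_{1i},\Pi_{2i}\in V$, the completed formal Weyl algebra is $\widehat{\mathbb W}V=\big(\prod_{s\ge0}\mathrm{Sym}^s(V^* )\big)[[\lambda]]$ (complexified symmetric powers). Elements of $V$ act on it as derivations; with $\hat\Pi(a\otimes b)=\sum_i\Pi_{1i}a\otimes\Pi_{2i}b$ and $\mu$ the commutative multiplication, the Moyal--Weyl product is $a\circ b=\sum_{k\ge0}\frac{(-i\lambda)^k}{k!}\mu\big(\hat\Pi^k(a\otimes b)\big)$. On alternating forms with values in $\widehat{\mathbb W}V$, i.e. on $\Lambda^\bullet\widehat{\mathbb W}V=\Lambda^\bullet V^*\otimes\widehat{\mathbb W}V$, $\circ$ denotes the product induced by $\circ$ and the exterior product. Applying this fiberwise to $T\tilde U$, with the Poisson bivector corresponding to $\omega_{\tilde U}$, gives the bundles $\widehat{\mathbb W}\tilde U$ and $\Lambda^\bullet\widehat{\mathbb W}\tilde U$. Let $\tilde y_j$ be the copy of $d\tilde x_j$ in $\mathrm{Sym}^1(T^*\tilde U)$; sections are formal series $b_{\tilde U}=\sum b_{\tilde U,k\alpha j_1\cdots j_l}\,\tilde y^\alpha\,d\tilde x_{j_1}\wedge\cdots\wedge d\tilde x_{j_l}\,\lambda^k$ with smooth coefficient functions. The bundles $\Lambda^\bullet\widehat{\mathbb W}\tilde U$ form a vector orbibundle $\Lambda^\bullet\widehat{\mathbb W}X$ over $X$, and its space $\Gamma^\infty_{\mathrm{str}}(\Lambda^\bullet\widehat{\mathbb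 W}X)$ of smooth stratified sections is identified with the space of families $b=(b_{\tilde U})$ of $G$-equivariant smooth sections of $\Lambda^\bullet\widehat{\mathbb W}\tilde U$ that are compatible with all morphisms $\mathsf X_{VU}$ ($\varphi^*b_{\tilde U}=b_{\tilde V}$). All operations, in particular $\circ$, are performed chart by chart; $[\cdot,\cdot]$ is the graded commutator with respect to $\circ$, and $r^2=r\circ r$. The Fedosov degree $\deg_{\mathrm F}(b)$ is the minimum of $s+2k$ over all nonvanishing components of $b$ of degree $s$ in $\tilde y$ and degree $k$ in $\lambda$. Operators. $\nabla$ is extended to $\Lambda^\bullet\widehat{\mathbb W}X$ by $(\nabla b)_{\tilde U}=\sum_j\sum\nabla_{\tilde U,\partial/\partial\tilde x_j}\big(b_{\tilde U,k\alpha j_1\cdots j_l}\tilde y^\alpha\big)\,d\tilde x_j\wedge d\tilde x_{j_1}\wedge\cdots\wedge d\tilde x_{j_l}\,\lambda^k$, and $(\nabla b)_{\tilde U}=db_{\tilde U}+\frac i\lambda[\Gamma_{\tilde U},b_{\tilde U}]$, where $\Gamma_{\tilde U}=\frac12\sum_{i,j,k}\Gamma_{\tilde U,ijk}\,\tilde y_i\tilde y_j\,d\tilde x_k$ and the $\Gamma_{\tilde U,ijk}$ are the Christoffel symbols, $\nabla_{\tilde U,\partial/\partial\tilde x_i}\frac{\partial}{\partial\tilde x_j}=\sum_{k,l}\Gamma_{\tilde U,ijk}\,\omega_{kl}\frac{\partial}{\partial\tilde x_l}$, with $\omega_{kl}$ the components of $\omega_{\tilde U}$. The curvature form of $\nabla$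 is $R=(R_{\tilde U})$, $R_{\tilde U}=d\Gamma_{\tilde U}+\frac12[\Gamma_{\tilde U},\Gamma_{\tilde U}]$; it satisfies $\nabla^2b=\frac i\lambda[R,b]$. Locally, $\delta b=\sum_kd\tilde x_k\wedge\frac{\partial b}{\partial\tilde y_k}$, $\delta^*b=\sum_k\tilde y_k\cdot\big(\frac{\partial}{\partial\tilde x_k}\llcorner b\big)$, and $\delta^-b=\sum_{q+l>0}\frac1{q+l}\delta^*(b_{ql})$, where $b_{ql}$ is the part of $b$ of degree $q$ in $\tilde y$ and form degree $l$. That $\Omega$ is the curvature form of $D$ means $D^2b=\frac i\lambda[\Omega,b]$ for all $b\in\Gamma^\infty_{\mathrm{str}}(\Lambda^\bullet\widehat{\mathbb W}X)$; $D$ is flat if $D^2=0$.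
   Formalization: Sign corrected: D=∇−δ+(i/λ)[r,·] (with +δ, D²=(i/λ)[2δr,·]≠0 if R≠0, e.g. on R² with Γ₁₁₁=x₂). R is dΓ+½(i/λ)[Γ,Γ], as ∇²b=(i/λ)[R,b] requires. Symplectic connections are torsion-free, as ∇b=db+(i/λ)[Γ,b] forces. *)

theory Defs
  imports
    "HOL-Analysis.Analysis"
    "HOL-Algebra.Group"
    "HOL-Library.Multiset"
    "HOL-Library.Function_Algebras"
begin

section \<open>Smooth calculus in coordinates\<close>

text \<open>
  The space $\mathbb R^d$ is the library topology \<open>Euclidean_space d\<close>: functions \<open>nat \<Rightarrow> real\<close>
  vanishing from index \<open>d\<close> on.  Coordinates are numbered from \<open>0\<close>, so the coordinates
  $x_j, x_{n+j}$ with $1\<le>j\<le>n$ are \<open>x j\<close>, \<open>x (n + j)\<close> with \<open>j < n\<close>.  This carrier (rather than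
  a finite index type) allows Lie groups of every dimension, in particular finite groups.
\<close>

type_synonym coords = "nat \<Rightarrow> real"

definition pd :: "nat \<Rightarrow> (coords \<Rightarrow> 'b::real_normed_vector) \<Rightarrow> coords \<Rightarrow> 'b" where
  "pd i f x = vector_derivative (\<lambda>t. f (x(i := t))) (at (x i))"

text \<open>Meant for \<open>W\<close> open in $\mathbb R^d$: partial derivatives of all orders exist and are continuous.\<close>

definition smooth_on :: "nat \<Rightarrow> coords set \<Rightarrow> (coords \<Rightarrow> 'b::real_normed_vector) \<Rightarrow> bool" where
  "smooth_on d W f \<longleftrightarrow>
     (\<forall>is. set is \<subseteq> {..<d} \<longrightarrow>
        continuous_map (subtopology (Euclidean_space d) W) euclidean (foldr pd is f) \<and>
        (\<forall>x\<in>W. \<forall>i<d. (\<lambda>t. foldr pd is f (x(i := t))) differentiable (at (x i))))"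

definition smooth_map :: "nat \<Rightarrow> nat \<Rightarrow> coords set \<Rightarrow> (coords \<Rightarrow> coords) \<Rightarrow> bool" where
  "smooth_map d e W F \<longleftrightarrow> (\<forall>j<e. smooth_on d W (\<lambda>x. F x j))"

definition jacobian :: "(coords \<Rightarrow> coords) \<Rightarrow> coords \<Rightarrow> nat \<Rightarrow> nat \<Rightarrow> real" where
  "jacobian F x j i = pd i (\<lambda>z. F z j) x"

definition tangent_map :: "nat \<Rightarrow> (coords \<Rightarrow> coords) \<Rightarrow> coords \<Rightarrow> coords \<Rightarrow> coords" where
  "tangent_map d F x v = (\<lambda>j. if j < d then \<Sum>i<d. jacobian F x j i * v i else 0)"


section \<open>Compact Lie groups and their actions\<close>

record 'g lie_group = "'g monoid" +
  lie_top :: "'g topology"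
  lie_dim :: nat
  lie_atlas :: "('g set \<times> ('g \<Rightarrow> coords)) set"

definition smooth_atlas :: "'a topology \<Rightarrow> nat \<Rightarrow> ('a set \<times> ('a \<Rightarrow> coords)) set \<Rightarrow> bool" where
  "smooth_atlas T d A \<longleftrightarrow>
     (\<forall>(W, c)\<in>A. openin T W \<and> openin (Euclidean_space d) (c ` W) \<and>
        homeomorphic_map (subtopology T W) (subtopology (Euclidean_space d) (c ` W)) c) \<and>
     (\<Union>(W, c)\<in>A. W) = topspace T \<and>
     (\<forall>(W, c)\<in>A. \<forall>(W', c')\<in>A. smooth_map d d (c ` (W \<inter> W')) (\<lambda>z. c' (inv_into W c z)))"

text \<open>The identification $\mathbb R^d\times\mathbb R^e=\mathbb R^{d+e}$.\<close>

definition pair_coords :: "nat \<Rightarrow> coords \<Rightarrow> coords \<Rightarrow> coords" where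
  "pair_coords d a b = (\<lambda>i. if i < d then a i else b (i - d))"

definition fst_coords :: "nat \<Rightarrow> coords \<Rightarrow> coords" where
  "fst_coords d z = (\<lambda>i. if i < d then z i else 0)"

definition snd_coords :: "nat \<Rightarrow> coords \<Rightarrow> coords" where
  "snd_coords d z = (\<lambda>i. z (i + d))"

definition compact_lie_group :: "'g lie_group \<Rightarrow> bool" where
  "compact_lie_group G \<longleftrightarrow>
     group G \<and> topspace (lie_top G) = carrier G \<and>
     Hausdorff_space (lie_top G) \<and> second_countable (lie_top G) \<and> compact_space (lie_top G) \<and>
     smooth_atlas (lie_top G) (lie_dim G) (lie_atlas G) \<and>
     continuous_map (prod_topology (lie_top G) (lie_top G)) (lie_top G) (\<lambda>(g, h). g \<otimes>\<^bsub>G\<^esub> h) \<and>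
     continuous_map (lie_top G) (lie_top G) (\<lambda>g. inv\<^bsub>G\<^esub> g) \<and>
     (\<forall>(W1, c1)\<in>lie_atlas G. \<forall>(W2, c2)\<in>lie_atlas G. \<forall>(W3, c3)\<in>lie_atlas G.
        smooth_map (lie_dim G + lie_dim G) (lie_dim G)
          {pair_coords (lie_dim G) (c1 g) (c2 h) | g h. g \<in> W1 \<and> h \<in> W2 \<and> g \<otimes>\<^bsub>G\<^esub> h \<in> W3}
          (\<lambda>z. c3 (inv_into W1 c1 (fst_coords (lie_dim G) z) \<otimes>\<^bsub>G\<^esub>
                   inv_into W2 c2 (snd_coords (lie_dim G) z)))) \<and>
     (\<forall>(W1, c1)\<in>lie_atlas G. \<forall>(W2, c2)\<in>lie_atlas G.
        smooth_map (lie_dim G) (lie_dim G)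
          {c1 g | g. g \<in> W1 \<and> inv\<^bsub>G\<^esub> g \<in> W2}
          (\<lambda>z. c2 (inv\<^bsub>G\<^esub> (inv_into W1 c1 z))))"

definition smooth_action :: "nat \<Rightarrow> coords set \<Rightarrow> 'g lie_group \<Rightarrow> ('g \<Rightarrow> coords \<Rightarrow> coords) \<Rightarrow> bool" where
  "smooth_action d M G \<theta> \<longleftrightarrow>
     (\<forall>g\<in>carrier G. \<theta> g ` M \<subseteq> M) \<and>
     (\<forall>x\<in>M. \<theta> \<one>\<^bsub>G\<^esub> x = x) \<and>
     (\<forall>g\<in>carrier G. \<forall>h\<in>carrier G. \<forall>x\<in>M. \<theta> (g \<otimes>\<^bsub>G\<^esub> h) x = \<theta> g (\<theta> h x)) \<and>
     (\<forall>(W, c)\<in>lie_atlas G.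
        smooth_map (lie_dim G + d) d
          {pair_coords (lie_dim G) (c g) x | g x. g \<in> W \<and> x \<in> M}
          (\<lambda>z. \<theta> (inv_into W c (fst_coords (lie_dim G) z)) (snd_coords (lie_dim G) z)))"


section \<open>Orbispaces\<close>

text \<open>
  Objects of the category of manifolds with symmetry whose manifold is an open subset of
  $\mathbb R^d$, together with the projection of an orbispace chart.
\<close>

record ('x, 'g) orb_chart =
  dom :: "coords set"
  grp :: "'g lie_group"
  act :: "'g \<Rightarrow> coords \<Rightarrow> coords"
  proj :: "coords \<Rightarrow> 'x"

definition quotient_topology :: "'a topology \<Rightarrow> ('a \<Rightarrow> 'b) \<Rightarrow> 'b topology" where
  "quotient_topology T q =
     topology (\<lambda>S. S \<subseteq> q ` topspace T \<and> openin T {x \<in> topspace T. q x \<in> S})"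

lemma openin_quotient_topology:
  "openin (quotient_topology T q) S \<longleftrightarrow> S \<subseteq> q ` topspace T \<and> openin T {x \<in> topspace T. q x \<in> S}"
proof -
  have "istopology (\<lambda>S. S \<subseteq> q ` topspace T \<and> openin T {x \<in> topspace T. q x \<in> S})"
    unfolding istopology_def
  proof (intro conjI allI impI, goal_cases)
    case (1 S S')
    then show ?case by blast
  next
    case (2 S S')
    have "{x \<in> topspace T. q x \<in> S \<inter> S'} =
        {x \<in> topspace T. q x \<in> S} \<inter> {x \<in> topspace T. q x \<in> S'}" by blast
    with 2 show ?case by auto
  next
    case (3 K)
    then show ?case by blast
  next
    case (4 K)
    have "{x \<in> topspace T. q x \<in> \<Union>K} = (\<Union>S\<in>K. {x \<in> topspace T. q x \<in> S})" by blast
    with 4 show ?case by auto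
  qed
  then show ?thesis
    by (simp add: quotient_topology_def topology_inverse')
qed

definition orbit_of :: "('x, 'g) orb_chart \<Rightarrow> coords \<Rightarrow> coords set" where
  "orbit_of C x = (\<lambda>g. act C g x) ` carrier (grp C)"

definition orbit_space :: "nat \<Rightarrow> ('x, 'g) orb_chart \<Rightarrow> coords set topology" where
  "orbit_space d C = quotient_topology (subtopology (Euclidean_space d) (dom C)) (orbit_of C)"

definition man_sym :: "nat \<Rightarrow> ('x, 'g) orb_chart \<Rightarrow> bool" where
  "man_sym d C \<longleftrightarrow> openin (Euclidean_space d) (dom C) \<and> compact_lie_group (grp C) \<and>
     smooth_action d (dom C) (grp C) (act C)"

definition orbispace_chart :: "nat \<Rightarrow> 'x topology \<Rightarrow> 'x set \<Rightarrow> ('x, 'g) orb_chart \<Rightarrow> bool" where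
  "orbispace_chart d X U C \<longleftrightarrow>
     man_sym d C \<and> openin X U \<and>
     continuous_map (subtopology (Euclidean_space d) (dom C)) X (proj C) \<and>
     (\<forall>g\<in>carrier (grp C). \<forall>x\<in>dom C. proj C (act C g x) = proj C x) \<and>
     homeomorphic_map (orbit_space d C) (subtopology X U) (\<lambda>B. the_elem (proj C ` B))"

definition chart_morphism ::
  "nat \<Rightarrow> ('x, 'g) orb_chart \<Rightarrow> ('x, 'g) orb_chart \<Rightarrow> (coords \<Rightarrow> coords) \<Rightarrow> ('g \<Rightarrow> 'g) \<Rightarrow> bool" where
  "chart_morphism d C' C \<phi> \<iota> \<longleftrightarrow>
     \<phi> ` dom C' \<subseteq> dom C \<and> smooth_map d d (dom C') \<phi> \<and>
     \<iota> \<in> hom (grp C') (grp C) \<and> continuous_map (lie_top (grp C')) (lie_top (grp C)) \<iota> \<and>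
     (\<forall>h\<in>carrier (grp C'). \<forall>y\<in>dom C'. \<phi> (act C' h y) = act C (\<iota> h) (\<phi> y)) \<and>
     (\<forall>y\<in>dom C'. proj C (\<phi> y) = proj C' y)"

text \<open>A diffeomorphism onto an open subset for which the induced map of orbit spaces is a
  homeomorphism onto an open subset; the union below is a single orbit.\<close>

definition open_embedding ::
  "nat \<Rightarrow> ('x, 'g) orb_chart \<Rightarrow> ('x, 'g) orb_chart \<Rightarrow> (coords \<Rightarrow> coords) \<Rightarrow> bool" where
  "open_embedding d C' C \<phi> \<longleftrightarrow>
     inj_on \<phi> (dom C') \<and>
     openin (Euclidean_space d) (\<phi> ` dom C') \<and> smooth_map d d (\<phi> ` dom C') (inv_into (dom C') \<phi>) \<and>
     (\<exists>S. openin (orbit_space d C) S \<and>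
        homeomorphic_map (orbit_space d C') (subtopology (orbit_space d C) S)
          (\<lambda>B. \<Union>y\<in>B. orbit_of C (\<phi> y)))"

definition paracompact_space :: "'x topology \<Rightarrow> bool" where
  "paracompact_space X \<longleftrightarrow>
     (\<forall>\<U>. (\<forall>U\<in>\<U>. openin X U) \<and> \<Union>\<U> = topspace X \<longrightarrow>
        (\<exists>\<V>. (\<forall>V\<in>\<V>. openin X V \<and> (\<exists>U\<in>\<U>. V \<subseteq> U)) \<and> \<Union>\<V> = topspace X \<and> locally_finite_in X \<V>))"

text \<open>\<open>emb X V U\<close> and \<open>ghom X V U\<close> are the two components of the morphism assigned to $V\subseteq U$.\<close>

record ('x, 'g) orbispace =
  base :: "'x topology"
  cover :: "'x set set"
  chart :: "'x set \<Rightarrow> ('x, 'g) orb_chart"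
  emb :: "'x set \<Rightarrow> 'x set \<Rightarrow> coords \<Rightarrow> coords"
  ghom :: "'x set \<Rightarrow> 'x set \<Rightarrow> 'g \<Rightarrow> 'g"

abbreviation odom :: "('x, 'g) orbispace \<Rightarrow> 'x set \<Rightarrow> coords set" where
  "odom X U \<equiv> dom (chart X U)"

abbreviation ogrp :: "('x, 'g) orbispace \<Rightarrow> 'x set \<Rightarrow> 'g lie_group" where
  "ogrp X U \<equiv> grp (chart X U)"

abbreviation oact :: "('x, 'g) orbispace \<Rightarrow> 'x set \<Rightarrow> 'g \<Rightarrow> coords \<Rightarrow> coords" where
  "oact X U \<equiv> act (chart X U)"

definition objs :: "('x, 'g) orbispace \<Rightarrow> 'x set set" where
  "objs X = {U. \<exists>\<F>. finite \<F> \<and> \<F> \<noteq> {} \<and> \<F> \<subseteq> cover X \<and>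
                  U \<in> connected_components_of (subtopology (base X) (\<Inter>\<F>))}"

definition is_orbispace :: "nat \<Rightarrow> ('x, 'g) orbispace \<Rightarrow> bool" where
  "is_orbispace d X \<longleftrightarrow>
     second_countable (base X) \<and> locally_connected_space (base X) \<and>
     paracompact_space (base X) \<and> Hausdorff_space (base X) \<and>
     (\<forall>U\<in>cover X. openin (base X) U) \<and> \<Union>(cover X) = topspace (base X) \<and>
     (\<forall>U\<in>objs X. orbispace_chart d (base X) U (chart X U) \<and>
        connectedin (Euclidean_space d) (odom X U)) \<and>
     (\<forall>U\<in>objs X. \<forall>V\<in>objs X. V \<subseteq> U \<longrightarrow>
        chart_morphism d (chart X V) (chart X U) (emb X V U) (ghom X V U) \<and>
        open_embedding d (chart X V) (chart X U) (emb X V U)) \<and>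
     (\<forall>U\<in>objs X. (\<forall>x\<in>odom X U. emb X U U x = x) \<and>
        (\<forall>g\<in>carrier (ogrp X U). ghom X U U g = g)) \<and>
     (\<forall>U\<in>objs X. \<forall>V\<in>objs X. \<forall>W\<in>objs X. W \<subseteq> V \<and> V \<subseteq> U \<longrightarrow>
        (\<forall>x\<in>odom X W. emb X W U x = emb X V U (emb X W V x)) \<and>
        (\<forall>g\<in>carrier (ogrp X W). ghom X W U g = ghom X V U (ghom X W V g)))"


section \<open>Forms with values in the completed formal Weyl algebra\<close>

text \<open>
  \<open>b k \<alpha> J\<close> is the coefficient of $\tilde y^\alpha\,d\tilde x_{j_1}\wedge\cdots\wedge d\tilde x_{j_l}\,\lambda^k$,
  where $J=\{j_1<\dots<j_l\}$ and the multiset \<open>\<alpha>\<close> contains \<open>j\<close> as often as $\tilde y_j$ occurs.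
\<close>

type_synonym wform = "nat \<Rightarrow> nat multiset \<Rightarrow> nat set \<Rightarrow> complex"

definition wone :: wform where
  "wone = (\<lambda>k \<alpha> J. if k = 0 \<and> \<alpha> = {#} \<and> J = {} then 1 else 0)"

definition scl :: "complex \<Rightarrow> wform \<Rightarrow> wform" where
  "scl c b = (\<lambda>k \<alpha> J. c * b k \<alpha> J)"

definition ymul :: "nat \<Rightarrow> wform \<Rightarrow> wform" where
  "ymul j b = (\<lambda>k \<alpha> J. if j \<in># \<alpha> then b k (\<alpha> - {#j#}) J else 0)"

definition yder :: "nat \<Rightarrow> wform \<Rightarrow> wform" where
  "yder j b = (\<lambda>k \<alpha> J. of_nat (count \<alpha> j + 1) * b k (add_mset j \<alpha>) J)"

definition dxw :: "nat \<Rightarrow> wform \<Rightarrow> wform" where \<comment> \<open>left exterior multiplication by $d\tilde x_j$\<close>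
  "dxw j b = (\<lambda>k \<alpha> J. if j \<in> J then (-1) ^ card {i\<in>J. i < j} * b k \<alpha> (J - {j}) else 0)"

definition contr :: "nat \<Rightarrow> wform \<Rightarrow> wform" where \<comment> \<open>contraction with $\partial/\partial\tilde x_j$\<close>
  "contr j b = (\<lambda>k \<alpha> J. if j \<in> J then 0 else (-1) ^ card {i\<in>J. i < j} * b k \<alpha> (insert j J))"

definition fpart :: "nat \<Rightarrow> wform \<Rightarrow> wform" where \<comment> \<open>part of form degree \<open>l\<close>\<close>
  "fpart l b = (\<lambda>k \<alpha> J. if card J = l then b k \<alpha> J else 0)"

text \<open>The matrix of components $\omega_{kl}$ of $\sum_{j} d\tilde x_j\wedge d\tilde x_{n+j}$, and this form itself.\<close>

definition omega_comp :: "nat \<Rightarrow> nat \<Rightarrow> nat \<Rightarrow> real" where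
  "omega_comp n k l = (if k < n \<and> l = n + k then 1 else if l < n \<and> k = n + l then -1 else 0)"

definition omega_form :: "nat \<Rightarrow> wform" where
  "omega_form n = (\<Sum>j<n. dxw j (dxw (n + j) wone))"

text \<open>
  Components of the Poisson bivector as an element $\sum\Pi_{pq}\,\partial_p\otimes\partial_q$ of
  $V\otimes V$.  The inverse of the matrix of $\omega$ is its negative, and the bivector
  $\frac12\sum\omega^{pq}\,\partial_p\wedge\partial_q$ is embedded in $V\otimes V$ by
  $v\wedge w=\frac12(v\otimes w-w\otimes v)$.  This normalization, i.e.
  $[\tilde y_p,\tilde y_q]=i\lambda\,\omega_{pq}$, is the one for which the covariant derivative below
  equals $d+\frac i\lambda[\Gamma,\cdot]$.
\<close>

definition Pi_comp :: "nat \<Rightarrow> nat \<Rightarrow> nat \<Rightarrow> real" where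
  "Pi_comp n p q = - omega_comp n p q / 2"

definition Pi_hat ::
  "nat \<Rightarrow> (nat multiset \<Rightarrow> nat multiset \<Rightarrow> complex) \<Rightarrow> (nat multiset \<Rightarrow> nat multiset \<Rightarrow> complex)" where
  "Pi_hat n t = (\<lambda>\<alpha> \<beta>. \<Sum>p<2*n. \<Sum>q<2*n. of_real (Pi_comp n p q) *
      of_nat (count \<alpha> p + 1) * of_nat (count \<beta> q + 1) * t (add_mset p \<alpha>) (add_mset q \<beta>))"

definition mu :: "(nat multiset \<Rightarrow> nat multiset \<Rightarrow> complex) \<Rightarrow> nat multiset \<Rightarrow> complex" where
  "mu t \<gamma> = (\<Sum>\<alpha> | \<alpha> \<subseteq># \<gamma>. t \<alpha> (\<gamma> - \<alpha>))"

text \<open>$dx_I\wedge dx_L=\pm dx_{I\cup L}$ for disjoint \<open>I\<close>, \<open>L\<close>.\<close>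

definition wedge_sign :: "nat set \<Rightarrow> nat set \<Rightarrow> complex" where
  "wedge_sign I L = (-1) ^ card {(i, l). i \<in> I \<and> l \<in> L \<and> l < i}"

definition moyal :: "nat \<Rightarrow> wform \<Rightarrow> wform \<Rightarrow> wform" where
  "moyal n a b = (\<lambda>k \<gamma> J.
     \<Sum>m\<le>k. (- \<i>) ^ m / fact m *
       (\<Sum>s\<le>k - m. \<Sum>I\<in>Pow J. wedge_sign I (J - I) *
          mu ((Pi_hat n ^^ m) (\<lambda>\<alpha> \<beta>. a s \<alpha> I * b (k - m - s) \<beta> (J - I))) \<gamma>))"

definition gcomm :: "nat \<Rightarrow> wform \<Rightarrow> wform \<Rightarrow> wform" where
  "gcomm n a b = (\<Sum>p\<le>2*n. \<Sum>q\<le>2*n.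
     moyal n (fpart p a) (fpart q b) - scl ((-1) ^ (p * q)) (moyal n (fpart q b) (fpart p a)))"

text \<open>$\frac i\lambda b$ for \<open>b\<close> divisible by $\lambda$; it is applied only to graded commutators and to
  squares of forms of degree 1, whose coefficients at $\lambda^0$ vanish.\<close>

definition i_over_lambda :: "wform \<Rightarrow> wform" where
  "i_over_lambda b = (\<lambda>k \<alpha> J. \<i> * b (Suc k) \<alpha> J)"

definition delta :: "nat \<Rightarrow> wform \<Rightarrow> wform" where
  "delta n b = (\<Sum>k<2*n. dxw k (yder k b))"

definition delta_star :: "nat \<Rightarrow> wform \<Rightarrow> wform" where
  "delta_star n b = (\<Sum>k<2*n. ymul k (contr k b))"

definition delta_minus :: "nat \<Rightarrow> wform \<Rightarrow> wform" where
  "delta_minus n b = delta_star n (\<lambda>k \<alpha> J.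
     if size \<alpha> + card J > 0 then b k \<alpha> J / of_nat (size \<alpha> + card J) else 0)"

text \<open>
  Pullback along \<open>\<phi>\<close>, a map between open subsets of $\mathbb R^d$:
  $\tilde y_j\mapsto\sum_i\frac{\partial\phi_j}{\partial x_i}\tilde y_i$ and
  $d\tilde x_j\mapsto\sum_i\frac{\partial\phi_j}{\partial x_i}d\tilde x_i$.
\<close>

definition pull_monomial :: "nat \<Rightarrow> (nat \<Rightarrow> nat \<Rightarrow> real) \<Rightarrow> nat multiset \<Rightarrow> nat set \<Rightarrow> wform" where
  "pull_monomial d M \<alpha> J =
     foldr (\<lambda>j c. \<Sum>i<d. scl (of_real (M j i)) (ymul i c)) (sorted_list_of_multiset \<alpha>)
       (foldr (\<lambda>j c. \<Sum>i<d. scl (of_real (M j i)) (dxw i c)) (sorted_list_of_set J) wone)"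

definition pullback :: "nat \<Rightarrow> (coords \<Rightarrow> coords) \<Rightarrow> (coords \<Rightarrow> wform) \<Rightarrow> coords \<Rightarrow> wform" where
  "pullback d \<phi> b x = (\<lambda>k \<beta> I.
     \<Sum>\<alpha> | set_mset \<alpha> \<subseteq> {..<d} \<and> size \<alpha> = size \<beta>. \<Sum>J\<in>Pow {..<d}.
       b (\<phi> x) k \<alpha> J * pull_monomial d (jacobian \<phi> x) \<alpha> J 0 \<beta> I)"


section \<open>Symplectic orbispaces and stratified sections\<close>

text \<open>Symplectic form in Darboux normal form, with linear group actions on the chart domains.\<close>

definition symplectic_orbispace :: "nat \<Rightarrow> ('x, 'g) orbispace \<Rightarrow> bool" where
  "symplectic_orbispace n X \<longleftrightarrow>
     is_orbispace (2*n) X \<and>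
     (\<forall>U\<in>objs X. \<forall>g\<in>carrier (ogrp X U).
        (\<exists>A :: nat \<Rightarrow> nat \<Rightarrow> real. \<forall>x\<in>odom X U. \<forall>j<2*n. oact X U g x j = (\<Sum>i<2*n. A j i * x i)) \<and>
        (\<forall>x\<in>odom X U. pullback (2*n) (oact X U g) (\<lambda>_. omega_form n) x = omega_form n)) \<and>
     (\<forall>U\<in>objs X. \<forall>V\<in>objs X. V \<subseteq> U \<longrightarrow>
        (\<forall>y\<in>odom X V. pullback (2*n) (emb X V U) (\<lambda>_. omega_form n) y = omega_form n))"

type_synonym 'x wsec = "'x set \<Rightarrow> coords \<Rightarrow> wform"

definition omega_sec :: "nat \<Rightarrow> 'x wsec" where
  "omega_sec n = (\<lambda>U x. omega_form n)"

text \<open>A section is determined by its values on the domains of the charts.\<close>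

definition sec_eq :: "('x, 'g) orbispace \<Rightarrow> 'x wsec \<Rightarrow> 'x wsec \<Rightarrow> bool" where
  "sec_eq X a b \<longleftrightarrow> (\<forall>U\<in>objs X. \<forall>x\<in>odom X U. a U x = b U x)"

definition strat_sections :: "nat \<Rightarrow> ('x, 'g) orbispace \<Rightarrow> 'x wsec set" where
  "strat_sections n X = {b.
     (\<forall>U\<in>objs X. \<forall>k \<alpha> J.
        smooth_on (2*n) (odom X U) (\<lambda>x. b U x k \<alpha> J) \<and>
        (\<forall>x\<in>odom X U. b U x k \<alpha> J \<noteq> 0 \<longrightarrow> set_mset \<alpha> \<subseteq> {..<2*n} \<and> J \<subseteq> {..<2*n})) \<and>
     (\<forall>U\<in>objs X. \<forall>g\<in>carrier (ogrp X U). \<forall>x\<in>odom X U.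
        pullback (2*n) (oact X U g) (b U) x = b U x) \<and>
     (\<forall>U\<in>objs X. \<forall>V\<in>objs X. V \<subseteq> U \<longrightarrow>
        (\<forall>y\<in>odom X V. pullback (2*n) (emb X V U) (b U) y = b V y))}"

definition strat_sections_deg :: "nat \<Rightarrow> ('x, 'g) orbispace \<Rightarrow> nat \<Rightarrow> 'x wsec set" where
  "strat_sections_deg n X l = {b \<in> strat_sections n X.
     \<forall>U\<in>objs X. \<forall>x\<in>odom X U. \<forall>k \<alpha> J. b U x k \<alpha> J \<noteq> 0 \<longrightarrow> card J = l}"

definition deg_F :: "('x, 'g) orbispace \<Rightarrow> 'x wsec \<Rightarrow> enat" where
  "deg_F X b = Inf {enat (size \<alpha> + 2 * k) | U x k \<alpha> J.
     U \<in> objs X \<and> x \<in> odom X U \<and> b U x k \<alpha> J \<noteq> 0}"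

definition central :: "nat \<Rightarrow> ('x, 'g) orbispace \<Rightarrow> 'x wsec \<Rightarrow> bool" where
  "central n X c \<longleftrightarrow> c \<in> strat_sections n X \<and>
     (\<forall>b\<in>strat_sections n X. sec_eq X (\<lambda>U x. moyal n (c U x) (b U x)) (\<lambda>U x. moyal n (b U x) (c U x)))"


section \<open>Symplectic connections\<close>

type_synonym vfield = "coords \<Rightarrow> coords"

type_synonym connection = "vfield \<Rightarrow> vfield \<Rightarrow> vfield"

definition vfields :: "nat \<Rightarrow> coords set \<Rightarrow> vfield set" where
  "vfields d M = {\<xi>. smooth_map d d M \<xi> \<and> (\<forall>x\<in>M. \<forall>i\<ge>d. \<xi> x i = 0)}"

definition coord_field :: "nat \<Rightarrow> vfield" where
  "coord_field i = (\<lambda>x j. if j = i then 1 else 0)"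

definition dderiv :: "nat \<Rightarrow> vfield \<Rightarrow> (coords \<Rightarrow> real) \<Rightarrow> coords \<Rightarrow> real" where
  "dderiv d \<xi> f x = (\<Sum>i<d. \<xi> x i * pd i f x)"

definition affine_connection :: "nat \<Rightarrow> coords set \<Rightarrow> connection \<Rightarrow> bool" where
  "affine_connection d M D \<longleftrightarrow>
     (\<forall>\<xi>\<in>vfields d M. \<forall>\<eta>\<in>vfields d M. D \<xi> \<eta> \<in> vfields d M) \<and>
     (\<forall>\<xi>\<in>vfields d M. \<forall>\<xi>'\<in>vfields d M. \<forall>\<eta>\<in>vfields d M. \<forall>x\<in>M.
        D (\<xi> + \<xi>') \<eta> x = D \<xi> \<eta> x + D \<xi>' \<eta> x \<and> D \<eta> (\<xi> + \<xi>') x = D \<eta> \<xi> x + D \<eta> \<xi>' x) \<and>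
     (\<forall>\<xi>\<in>vfields d M. \<forall>\<eta>\<in>vfields d M. \<forall>f. smooth_on d M f \<longrightarrow> (\<forall>x\<in>M. \<forall>i.
        D (\<lambda>z j. f z * \<xi> z j) \<eta> x i = f x * D \<xi> \<eta> x i \<and>
        D \<xi> (\<lambda>z j. f z * \<eta> z j) x i = dderiv d \<xi> f x * \<eta> x i + f x * D \<xi> \<eta> x i))"

definition torsion_free :: "nat \<Rightarrow> coords set \<Rightarrow> connection \<Rightarrow> bool" where
  "torsion_free d M D \<longleftrightarrow>
     (\<forall>\<xi>\<in>vfields d M. \<forall>\<eta>\<in>vfields d M. \<forall>x\<in>M. \<forall>i<d.
        D \<xi> \<eta> x i - D \<eta> \<xi> x i = dderiv d \<xi> (\<lambda>z. \<eta> z i) x - dderiv d \<eta> (\<lambda>z. \<xi> z i) x)"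

definition omega_pair :: "nat \<Rightarrow> coords \<Rightarrow> coords \<Rightarrow> real" where
  "omega_pair n u v = (\<Sum>k<2*n. \<Sum>l<2*n. omega_comp n k l * u k * v l)"

definition parallel_omega :: "nat \<Rightarrow> coords set \<Rightarrow> connection \<Rightarrow> bool" where
  "parallel_omega n M D \<longleftrightarrow>
     (\<forall>\<xi>\<in>vfields (2*n) M. \<forall>\<eta>\<in>vfields (2*n) M. \<forall>\<zeta>\<in>vfields (2*n) M. \<forall>x\<in>M.
        dderiv (2*n) \<xi> (\<lambda>z. omega_pair n (\<eta> z) (\<zeta> z)) x =
          omega_pair n (D \<xi> \<eta> x) (\<zeta> x) + omega_pair n (\<eta> x) (D \<xi> \<zeta> x))"

definition orb_vfields :: "nat \<Rightarrow> ('x, 'g) orbispace \<Rightarrow> ('x set \<Rightarrow> vfield) set" where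
  "orb_vfields d X = {\<xi>.
     (\<forall>U\<in>objs X. \<xi> U \<in> vfields d (odom X U)) \<and>
     (\<forall>U\<in>objs X. \<forall>g\<in>carrier (ogrp X U). \<forall>x\<in>odom X U.
        \<xi> U (oact X U g x) = tangent_map d (oact X U g) x (\<xi> U x)) \<and>
     (\<forall>U\<in>objs X. \<forall>V\<in>objs X. V \<subseteq> U \<longrightarrow> (\<forall>y\<in>odom X V.
        \<xi> U (emb X V U y) = tangent_map d (emb X V U) y (\<xi> V y)))}"

definition push_field ::
  "nat \<Rightarrow> ('x, 'g) orbispace \<Rightarrow> 'x set \<Rightarrow> 'g \<Rightarrow> vfield \<Rightarrow> vfield" where
  "push_field d X U g \<xi> = (\<lambda>x. let z = oact X U (inv\<^bsub>ogrp X U\<^esub> g) x in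
     tangent_map d (oact X U g) z (\<xi> z))"

text \<open>
  The last condition is $\varphi^*(\nabla_{\tilde U}\xi_{\tilde U})=\nabla_{\tilde V}\xi_{\tilde V}$ for the
  endomorphism-valued fields $\nabla\xi$, evaluated at a tangent vector \<open>u\<close> at \<open>y\<close>, which is extended
  to a constant field.
\<close>

definition orb_connection :: "nat \<Rightarrow> ('x, 'g) orbispace \<Rightarrow> ('x set \<Rightarrow> connection) \<Rightarrow> bool" where
  "orb_connection d X D \<longleftrightarrow>
     (\<forall>U\<in>objs X. affine_connection d (odom X U) (D U)) \<and>
     (\<forall>U\<in>objs X. \<forall>g\<in>carrier (ogrp X U).
        \<forall>\<xi>\<in>vfields d (odom X U). \<forall>\<eta>\<in>vfields d (odom X U). \<forall>x\<in>odom X U.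
          D U (push_field d X U g \<xi>) (push_field d X U g \<eta>) x = push_field d X U g (D U \<xi> \<eta>) x) \<and>
     (\<forall>\<xi>\<in>orb_vfields d X. \<forall>U\<in>objs X. \<forall>V\<in>objs X. V \<subseteq> U \<longrightarrow>
        (\<forall>y\<in>odom X V. \<forall>u\<in>topspace (Euclidean_space d).
          tangent_map d (emb X V U) y (D V (\<lambda>_. u) (\<xi> V) y) =
          D U (\<lambda>_. tangent_map d (emb X V U) y u) (\<xi> U) (emb X V U y)))"

text \<open>As usual, symplectic connections are torsion-free; together with $\nabla\omega=0$ this is the
  total symmetry of the Christoffel symbols $\Gamma_{ijk}$ with lowered indices, without which
  the covariant derivative is not of the form $d+\frac i\lambda[\Gamma,\cdot]$.\<close>

definition symplectic_connection :: "nat \<Rightarrow> ('x, 'g) orbispace \<Rightarrow> ('x set \<Rightarrow> connection) \<Rightarrow> bool" where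
  "symplectic_connection n X D \<longleftrightarrow>
     orb_connection (2*n) X D \<and>
     (\<forall>U\<in>objs X. torsion_free (2*n) (odom X U) (D U) \<and> parallel_omega n (odom X U) (D U))"

text \<open>The Christoffel symbols are defined by the relation in the lemma \<open>christoffel\<close>.\<close>

definition chris :: "nat \<Rightarrow> connection \<Rightarrow> coords \<Rightarrow> nat \<Rightarrow> nat \<Rightarrow> nat \<Rightarrow> real" where
  "chris n D x i j k = (\<Sum>m<2*n. D (coord_field i) (coord_field j) x m * omega_comp n k m)"

lemma omega_comp_orthogonal:
  assumes "m < 2*n" "l < 2*n"
  shows "(\<Sum>k<2*n. omega_comp n k m * omega_comp n k l) = (if m = l then 1 else 0)"
proof -
  define k0 where "k0 = (if m < n then n + m else m - n)"
  have k0: "k0 < 2*n" using assms by (auto simp: k0_def)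
  have "omega_comp n k m * omega_comp n k l = (if k = k0 then (if m = l then 1 else 0) else 0)"
    if "k < 2*n" for k
    using assms that by (auto simp: omega_comp_def k0_def)
  then have "(\<Sum>k<2*n. omega_comp n k m * omega_comp n k l) =
      (\<Sum>k<2*n. if k = k0 then (if m = l then 1 else 0) else 0)"
    by (intro sum.cong) auto
  with k0 show ?thesis by simp
qed

lemma christoffel:
  assumes "l < 2*n"
  shows "D (coord_field i) (coord_field j) x l = (\<Sum>k<2*n. chris n D x i j k * omega_comp n k l)"
proof -
  have "(\<Sum>k<2*n. chris n D x i j k * omega_comp n k l) =
      (\<Sum>k<2*n. \<Sum>m<2*n. D (coord_field i) (coord_field j) x m * (omega_comp n k m * omega_comp n k l))"
    by (simp add: chris_def sum_distrib_right mult.assoc)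
  also have "\<dots> = (\<Sum>m<2*n. D (coord_field i) (coord_field j) x m *
      (\<Sum>k<2*n. omega_comp n k m * omega_comp n k l))"
    by (subst sum.swap) (simp add: sum_distrib_left)
  also have "\<dots> = (\<Sum>m<2*n. if m = l then D (coord_field i) (coord_field j) x m else 0)"
    using assms by (intro sum.cong) (auto simp: omega_comp_orthogonal)
  also have "\<dots> = D (coord_field i) (coord_field j) x l" using assms by simp
  finally show ?thesis by simp
qed

definition ext_d :: "nat \<Rightarrow> (coords \<Rightarrow> wform) \<Rightarrow> coords \<Rightarrow> wform" where
  "ext_d n b x = (\<Sum>j<2*n. dxw j (\<lambda>k \<alpha> J. pd j (\<lambda>z. b z k \<alpha> J) x))"

text \<open>$\nabla_{\partial/\partial\tilde x_j}$ on symmetric powers of the cotangent bundle, applied to the factors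
  $\tilde y^\alpha$ with their coefficients; it acts as a derivation, with
  $\nabla_{\partial/\partial\tilde x_j}\tilde y_m=-\sum_i\Gamma^m_{ji}\,\tilde y_i$.\<close>

definition cov_deriv :: "nat \<Rightarrow> connection \<Rightarrow> nat \<Rightarrow> (coords \<Rightarrow> wform) \<Rightarrow> coords \<Rightarrow> wform" where
  "cov_deriv n D j b x = (\<lambda>k \<alpha> J. pd j (\<lambda>z. b z k \<alpha> J) x) -
     (\<Sum>m<2*n. \<Sum>i<2*n.
        scl (of_real (D (coord_field j) (coord_field i) x m)) (ymul i (yder m (b x))))"

definition nabla_W :: "nat \<Rightarrow> ('x set \<Rightarrow> connection) \<Rightarrow> 'x wsec \<Rightarrow> 'x wsec" where
  "nabla_W n D b = (\<lambda>U x. \<Sum>j<2*n. dxw j (cov_deriv n (D U) j (b U) x))"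

definition Gamma_form :: "nat \<Rightarrow> connection \<Rightarrow> coords \<Rightarrow> wform" where
  "Gamma_form n D x = (\<Sum>i<2*n. \<Sum>j<2*n. \<Sum>k<2*n.
     scl (of_real (chris n D x i j k) / 2) (ymul i (ymul j (dxw k wone))))"

text \<open>The bracket of the $\mathfrak{sp}(2n)$-valued forms $\Gamma$ is $\frac i\lambda[\cdot,\cdot]$ in terms of
  the commutator of the Moyal--Weyl product; thus $\nabla^2b=\frac i\lambda[R,b]$.\<close>

definition curvature :: "nat \<Rightarrow> ('x set \<Rightarrow> connection) \<Rightarrow> 'x wsec" where
  "curvature n D = (\<lambda>U x. ext_d n (Gamma_form n (D U)) x +
     scl (1/2) (i_over_lambda (gcomm n (Gamma_form n (D U) x) (Gamma_form n (D U) x))))"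


section \<open>Chartwise operations on families\<close>

text \<open>Sign convention: since $\delta\delta^-+\delta^-\delta$ is the identity in positive total degree,
  a solution of $r=\delta^-(R+\nabla r+\frac i\lambda r^2)$ has
  $\delta r=R+\nabla r+\frac i\lambda r^2$, and $\delta$ enters the connection whose curvature form
  is $-\omega+R-\delta r+\nabla r+\frac i\lambda r^2$ with a minus sign:
  $\nabla-\delta+\frac i\lambda[r,\cdot]$.\<close>

definition delta_X :: "nat \<Rightarrow> 'x wsec \<Rightarrow> 'x wsec" where
  "delta_X n b = (\<lambda>U x. delta n (b U x))"

definition delta_minus_X :: "nat \<Rightarrow> 'x wsec \<Rightarrow> 'x wsec" where
  "delta_minus_X n b = (\<lambda>U x. delta_minus n (b U x))"

definition bracket_X :: "nat \<Rightarrow> 'x wsec \<Rightarrow> 'x wsec \<Rightarrow> 'x wsec" where \<comment> \<open>$\frac i\lambda[a,b]$\<close>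
  "bracket_X n a b = (\<lambda>U x. i_over_lambda (gcomm n (a U x) (b U x)))"

definition square_X :: "nat \<Rightarrow> 'x wsec \<Rightarrow> 'x wsec" where \<comment> \<open>$\frac i\lambda a^2$\<close>
  "square_X n a = (\<lambda>U x. i_over_lambda (moyal n (a U x) (a U x)))"

definition is_curvature_of ::
  "nat \<Rightarrow> ('x, 'g) orbispace \<Rightarrow> 'x wsec \<Rightarrow> ('x wsec \<Rightarrow> 'x wsec) \<Rightarrow> bool" where
  "is_curvature_of n X \<Omega> D \<longleftrightarrow>
     (\<forall>b\<in>strat_sections n X. sec_eq X (D (D b)) (bracket_X n \<Omega> b))"

definition flat_connection :: "nat \<Rightarrow> ('x, 'g) orbispace \<Rightarrow> ('x wsec \<Rightarrow> 'x wsec) \<Rightarrow> bool" where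
  "flat_connection n X D \<longleftrightarrow> (\<forall>b\<in>strat_sections n X. sec_eq X (D (D b)) 0)"

end

theory Submission
  imports Defs
begin

text \<open>
  In a chart, $\nabla=d+\frac i\lambda[\Gamma,\cdot]$ and $\delta\Gamma=0$ by the total symmetry of the
  Christoffel symbols.  Put $s=\Gamma+r$ and $d'=d-\delta$; since $d'$ is a derivation of square zero,
  $D=d'+\frac i\lambda[s,\cdot]$ has the curvature $A=d's+\frac i\lambda s^2=\Omega+\omega$, which satisfies the
  Bianchi identity $DA=0$.  The fixed point equation gives $\delta^-r=0$ and $\delta^-A=0$, whence
  $A=\delta^-\delta A=\delta^-(\nabla A+\frac i\lambda[r,A])$.  The right-hand side has larger Fedosov degree than
  $A$, so $A=0$.
\<close>

section \<open>The supercommutative product of forms\<close>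

text \<open>With the Christoffel form absorbed in \<open>s\<close>, curvature and Bianchi identity
  become formal consequences of three facts: \<open>moyal\<close> is associative,
  \<open>d_minus_delta\<close> is a graded derivation, and its square is zero. The form
  \<open>s\<close> need not be tensorial, but every argument stays inside one chart. The degree
  count rests on a balance: i/lambda costs 2 and \<open>s\<close> has degree at least 2, so the
  bracket with \<open>s\<close> never lowers the degree, while \<open>delta_minus\<close> gains 1.
  The bound for the summand r of \<open>s\<close> comes from R: R has degree at least 2, hence r_0
  at least 3, and r inherits this bound. Two obstacles come from the encoding. First, i/lambda is a
  shift that discards the coefficient at order 0 of lambda; it passes through products only where
  that coefficient vanishes, which graded commutativity of \<open>wmul\<close> ensures for brackets
  and squares of odd forms. Secondly, a form is a function on all index sets, including infinite
  ones, where \<open>card\<close> is 0; sign and degree rules can fail there, so supports are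
  carried along.\<close>

lemma finite_submultisets: "finite {\<alpha>. \<alpha> \<subseteq># \<gamma>}"
proof (induction \<gamma>)
  case (add x \<gamma>)
  have "{\<alpha>. \<alpha> \<subseteq># add_mset x \<gamma>} \<subseteq> {\<alpha>. \<alpha> \<subseteq># \<gamma>} \<union> add_mset x ` {\<alpha>. \<alpha> \<subseteq># \<gamma>}"
  proof
    fix \<alpha> assume "\<alpha> \<in> {\<alpha>. \<alpha> \<subseteq># add_mset x \<gamma>}"
    then have *: "\<alpha> \<subseteq># add_mset x \<gamma>" by simp
    show "\<alpha> \<in> {\<alpha>. \<alpha> \<subseteq># \<gamma>} \<union> add_mset x ` {\<alpha>. \<alpha> \<subseteq># \<gamma>}"
    proof (cases "x \<in># \<alpha>")
      case True
      then obtain \<beta> where "\<alpha> = add_mset x \<beta>" by (metis insert_DiffM)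
      with * show ?thesis by auto
    next
      case False
      have "count \<alpha> v \<le> count \<gamma> v" for v
        using * False by (cases "v = x") (auto simp: subseteq_mset_def not_in_iff dest: spec[of _ v])
      then show ?thesis by (simp add: subseteq_mset_def)
    qed
  qed
  with add show ?case by (meson finite_UnI finite_imageI finite_subset)
qed simp

type_synonym windex = "nat \<times> nat multiset \<times> nat set"

text \<open>An index \<open>z = (k, \<alpha>, J)\<close> stands for the monomial $\tilde y^\alpha\,d\tilde x_J\,\lambda^k$;
  \<open>wdec z\<close> consists of its factors \<open>x\<close>, with complementary factor \<open>wminus z x\<close>.  There are only
  finitely many of them iff \<open>J\<close> is finite; products vanish at infinite \<open>J\<close>, where forms may have junk values.\<close>

definition wdec :: "windex \<Rightarrow> windex set" where
  "wdec z = {..fst z} \<times> {\<alpha>. \<alpha> \<subseteq># fst (snd z)} \<times> Pow (snd (snd z))"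

definition wminus :: "windex \<Rightarrow> windex \<Rightarrow> windex" where
  "wminus z x = (fst z - fst x, fst (snd z) - fst (snd x), snd (snd z) - snd (snd x))"

definition wplus :: "windex \<Rightarrow> windex \<Rightarrow> windex" where
  "wplus z x = (fst z + fst x, fst (snd z) + fst (snd x), snd (snd z) \<union> snd (snd x))"

definition wcoeff :: "wform \<Rightarrow> windex \<Rightarrow> complex" where
  "wcoeff a z = a (fst z) (fst (snd z)) (snd (snd z))"

definition wsgn :: "windex \<Rightarrow> windex \<Rightarrow> complex" where
  "wsgn x y = wedge_sign (snd (snd x)) (snd (snd y))"

definition wmul :: "wform \<Rightarrow> wform \<Rightarrow> wform" where
  "wmul a b = (\<lambda>k \<gamma> J. \<Sum>x\<in>wdec (k, \<gamma>, J). wsgn x (wminus (k, \<gamma>, J) x) *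
      (wcoeff a x * wcoeff b (wminus (k, \<gamma>, J) x)))"

lemma finite_wdec: "finite (wdec z) \<longleftrightarrow> finite (snd (snd z))"
proof
  assume "finite (wdec z)"
  moreover have "(\<lambda>K. (0, {#}, K)) ` Pow (snd (snd z)) \<subseteq> wdec z" by (auto simp: wdec_def)
  ultimately have "finite ((\<lambda>K. (0::nat, {#}::nat multiset, K)) ` Pow (snd (snd z)))"
    by (rule rev_finite_subset)
  moreover have "inj_on (\<lambda>K. (0::nat, {#}::nat multiset, K)) (Pow (snd (snd z)))" by (auto simp: inj_on_def)
  ultimately show "finite (snd (snd z))" by (simp add: finite_image_iff)
next
  assume "finite (snd (snd z))"
  then show "finite (wdec z)" by (simp add: wdec_def finite_submultisets)
qed

lemma wmul_infinite: "infinite J \<Longrightarrow> wmul a b k \<gamma> J = 0"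
  by (simp add: wmul_def finite_wdec)

text \<open>These facts and those of \<open>wdec_assoc'\<close> are the two directions of a
  bijection: a chain y | x | z of factors corresponds to y together with the factor x/y of
  z/y.\<close>

lemma wdec_assoc:
  assumes "x \<in> wdec z" "y \<in> wdec x"
  shows "y \<in> wdec z" "wminus x y \<in> wdec (wminus z y)" "wplus y (wminus x y) = x"
    "wminus (wminus z y) (wminus x y) = wminus z x"
  using assms
  by (fastforce simp: wdec_def wminus_def wplus_def multiset_eq_iff subseteq_mset_def
      intro: diff_le_mono le_trans)+

lemma wdec_assoc':
  assumes "x \<in> wdec z" "y \<in> wdec (wminus z x)"
  shows "wplus x y \<in> wdec z" "x \<in> wdec (wplus x y)" "wminus (wplus x y) x = y"
    "wminus z (wplus x y) = wminus (wminus z x) y"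
proof -
  have "count (fst (snd y)) v + count (fst (snd x)) v \<le> count (fst (snd z)) v" for v
    using assms by (auto simp: wdec_def wminus_def subseteq_mset_def)
      (metis add.commute le_diff_conv2)
  with assms show "wplus x y \<in> wdec z"
    by (auto simp: wdec_def wminus_def wplus_def subseteq_mset_def add.commute)
qed (use assms in \<open>auto simp: wdec_def wminus_def wplus_def prod_eq_iff\<close>)

text \<open>Both sides run over the ordered factorizations of z into three factors, grouped in the
  two possible ways. At an infinite form index both sums are 0 by default.\<close>

lemma wdec_sum_assoc:
  "(\<Sum>x\<in>wdec z. \<Sum>y\<in>wdec x. f y (wminus x y) (wminus z x)) =
   (\<Sum>x\<in>wdec z. \<Sum>y\<in>wdec (wminus z x). f x y (wminus (wminus z x) y))"
proof (cases "finite (snd (snd z))")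
  case True
  have fin: "finite (wdec z)" "\<forall>x\<in>wdec z. finite (wdec x)" "\<forall>x\<in>wdec z. finite (wdec (wminus z x))"
    using True by (auto simp: finite_wdec) (auto simp: wdec_def wminus_def intro: finite_subset[OF _ True])
  show ?thesis
    unfolding sum.Sigma[OF fin(1) fin(2)] sum.Sigma[OF fin(1) fin(3)]
    by (rule sum.reindex_bij_witness[where j = "\<lambda>(x, y). (y, wminus x y)" and i = "\<lambda>(x, y). (wplus x y, x)"])
      (auto simp: wdec_assoc wdec_assoc')
qed (simp add: finite_wdec)

text \<open>The exponent counts pairs that are out of order, and this count is additive over
  disjoint unions in either argument.\<close>

lemma wedge_sign_union:
  assumes "finite P" "finite Q" "finite R" "P \<inter> Q = {}"
  shows "wedge_sign (P \<union> Q) R = wedge_sign P R * wedge_sign Q R"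
    and "wedge_sign R (P \<union> Q) = wedge_sign R P * wedge_sign R Q"
proof -
  have fin: "finite {(i, l). i \<in> A \<and> l \<in> B \<and> l < i}" if "finite A" "finite B" for A B :: "nat set"
    by (rule finite_subset[of _ "A \<times> B"]) (use that in auto)
  have "{(i, l). i \<in> P \<union> Q \<and> l \<in> R \<and> l < i} =
      {(i, l). i \<in> P \<and> l \<in> R \<and> l < i} \<union> {(i, l). i \<in> Q \<and> l \<in> R \<and> l < i}" by auto
  then have "card {(i, l). i \<in> P \<union> Q \<and> l \<in> R \<and> l < i} =
      card {(i, l). i \<in> P \<and> l \<in> R \<and> l < i} + card {(i, l). i \<in> Q \<and> l \<in> R \<and> l < i}"
    using assms by (simp only:) (rule card_Un_disjoint, auto intro!: fin)
  then show "wedge_sign (P \<union> Q) R = wedge_sign P R * wedge_sign Q R"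
    by (simp add: wedge_sign_def power_add)
  have "{(i, l). i \<in> R \<and> l \<in> P \<union> Q \<and> l < i} =
      {(i, l). i \<in> R \<and> l \<in> P \<and> l < i} \<union> {(i, l). i \<in> R \<and> l \<in> Q \<and> l < i}" by auto
  then have "card {(i, l). i \<in> R \<and> l \<in> P \<union> Q \<and> l < i} =
      card {(i, l). i \<in> R \<and> l \<in> P \<and> l < i} + card {(i, l). i \<in> R \<and> l \<in> Q \<and> l < i}"
    using assms by (simp only:) (rule card_Un_disjoint, auto intro!: fin)
  then show "wedge_sign R (P \<union> Q) = wedge_sign R P * wedge_sign R Q"
    by (simp add: wedge_sign_def power_add)
qed

text \<open>Both bracketings of a threefold product carry one sign for each of the three pairs of
  pieces: here for the left bracketing, in \<open>wsgn_assoc'\<close> for the right one.\<close>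

lemma wsgn_assoc:
  assumes "finite (snd (snd z))" "x \<in> wdec z" "y \<in> wdec x"
  shows "wsgn x (wminus z x) * wsgn y (wminus x y) =
    wsgn y (wminus x y) * wsgn y (wminus z x) * wsgn (wminus x y) (wminus z x)"
proof -
  obtain P Q R where *: "snd (snd y) = P" "snd (snd (wminus x y)) = Q" "snd (snd (wminus z x)) = R" by blast
  have "snd (snd x) = P \<union> Q" "P \<inter> Q = {}" using assms * by (auto simp: wdec_def wminus_def)
  moreover have "finite P" "finite Q" "finite R" using assms(2,3) *
    by (auto simp: wdec_def wminus_def intro!: finite_subset[OF _ assms(1)] dest!: subsetD)
  ultimately show ?thesis unfolding wsgn_def * by (simp add: wedge_sign_union)
qed

lemma wsgn_assoc':
  assumes "finite (snd (snd z))" "x \<in> wdec z" "y \<in> wdec (wminus z x)"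
  shows "wsgn x (wminus z x) * wsgn y (wminus (wminus z x) y) =
    wsgn x y * wsgn x (wminus (wminus z x) y) * wsgn y (wminus (wminus z x) y)"
proof -
  obtain P Q R where *: "snd (snd x) = P" "snd (snd y) = Q" "snd (snd (wminus (wminus z x) y)) = R" by blast
  have "snd (snd (wminus z x)) = Q \<union> R" "Q \<inter> R = {}" using assms * by (auto simp: wdec_def wminus_def)
  moreover have "finite P" "finite Q" "finite R" using assms(2,3) *
    by (auto simp: wdec_def wminus_def intro!: finite_subset[OF _ assms(1)] dest!: subsetD)
  ultimately show ?thesis unfolding wsgn_def * by (simp add: wedge_sign_union)
qed

lemma wcoeff_wmul: "wcoeff (wmul a b) z = (\<Sum>x\<in>wdec z. wsgn x (wminus z x) * (wcoeff a x * wcoeff b (wminus z x)))"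
  by (simp add: wcoeff_def wmul_def)

lemma wform_eqI: "(\<And>z. finite (snd (snd z)) \<Longrightarrow> wcoeff a z = wcoeff b z) \<Longrightarrow>
   (\<And>k \<alpha> J. infinite J \<Longrightarrow> a k \<alpha> J = b k \<alpha> J) \<Longrightarrow> a = b"
  unfolding wcoeff_def by (intro ext) (metis fst_conv snd_conv)

lemma wmul_assoc: "wmul (wmul a b) c = wmul a (wmul b c)"
proof (rule wform_eqI)
  fix z :: windex assume z: "finite (snd (snd z))"
  define f where "f p q r = wsgn p q * wsgn p r * wsgn q r * (wcoeff a p * wcoeff b q * wcoeff c r)" for p q r
  have "wcoeff (wmul (wmul a b) c) z = (\<Sum>x\<in>wdec z. \<Sum>y\<in>wdec x.
      (wsgn x (wminus z x) * wsgn y (wminus x y)) * (wcoeff a y * wcoeff b (wminus x y) * wcoeff c (wminus z x)))"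
    by (simp add: wcoeff_wmul sum_distrib_left sum_distrib_right algebra_simps)
  also have "\<dots> = (\<Sum>x\<in>wdec z. \<Sum>y\<in>wdec x. f y (wminus x y) (wminus z x))"
    unfolding f_def by (intro sum.cong refl arg_cong2[where f = "(*)"] wsgn_assoc z)
  also have "\<dots> = (\<Sum>x\<in>wdec z. \<Sum>y\<in>wdec (wminus z x). f x y (wminus (wminus z x) y))"
    by (rule wdec_sum_assoc)
  also have "\<dots> = (\<Sum>x\<in>wdec z. \<Sum>y\<in>wdec (wminus z x). (wsgn x (wminus z x) * wsgn y (wminus (wminus z x) y)) *
      (wcoeff a x * wcoeff b y * wcoeff c (wminus (wminus z x) y)))"
    unfolding f_def by (intro sum.cong refl arg_cong2[where f = "(*)"] wsgn_assoc'[symmetric] z)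
  also have "\<dots> = wcoeff (wmul a (wmul b c)) z"
    by (simp add: wcoeff_wmul sum_distrib_left sum_distrib_right algebra_simps)
  finally show "wcoeff (wmul (wmul a b) c) z = wcoeff (wmul a (wmul b c)) z" .
qed (simp add: wmul_infinite)

text \<open>The parity automorphism. With it the graded commutator with an odd form needs no
  splitting of the other argument by form degree. An infinite \<open>J\<close> has
  \<open>card J\<close> = 0 and thus counts as even.\<close>

definition par :: "wform \<Rightarrow> wform" where
  "par b = (\<lambda>k \<alpha> J. (-1) ^ card J * b k \<alpha> J)"

lemma wminus_wminus: "x \<in> wdec z \<Longrightarrow> wminus z (wminus z x) = x"
  "x \<in> wdec z \<Longrightarrow> wminus z x \<in> wdec z"
  by (auto simp: wdec_def wminus_def prod_eq_iff multiset_eq_iff subseteq_mset_def)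

lemma wmul_swap: "wcoeff (wmul a b) z =
   (\<Sum>x\<in>wdec z. wsgn (wminus z x) x * (wcoeff b x * wcoeff a (wminus z x)))"
  unfolding wcoeff_wmul
  by (rule sum.reindex_bij_witness[where i = "wminus z" and j = "wminus z"]) (auto simp: wminus_wminus)

text \<open>For disjoint P and Q every pair in the product of P and Q is out of order in exactly one
  of the two arrangements, so the two exponents add up to \<open>card P * card Q\<close>.\<close>

lemma wedge_sign_swap:
  assumes "finite P" "finite Q" "P \<inter> Q = {}"
  shows "wedge_sign P Q = (-1) ^ (card P * card Q) * wedge_sign Q P"
proof -
  let ?A = "{(i, l). i \<in> P \<and> l \<in> Q \<and> l < i}" and ?B = "{(i, l). i \<in> Q \<and> l \<in> P \<and> l < i}"
  have "card ?B = card (prod.swap ` ?B)" by (rule card_image[symmetric]) (auto simp: inj_on_def)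
  moreover have "P \<times> Q = ?A \<union> prod.swap ` ?B"
  proof (rule Set.set_eqI)
    fix x :: "nat \<times> nat"
    have "x \<in> P \<times> Q \<longleftrightarrow> fst x \<in> P \<and> snd x \<in> Q \<and> (snd x < fst x \<or> fst x < snd x)"
      using assms(3) by (cases x) (auto simp: nat_neq_iff[symmetric])
    then show "x \<in> P \<times> Q \<longleftrightarrow> x \<in> ?A \<union> prod.swap ` ?B"
      by (cases x) (simp add: image_iff, blast)
  qed
  moreover have finA: "finite ?A" by (rule finite_subset[of _ "P \<times> Q"]) (use assms in auto)
  moreover have finB: "finite ?B" by (rule finite_subset[of _ "Q \<times> P"]) (use assms in auto)
  moreover have "card (?A \<union> prod.swap ` ?B) = card ?A + card (prod.swap ` ?B)"
    using finA finB by (intro card_Un_disjoint) auto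
  ultimately have "card P * card Q = card ?A + card ?B" by (simp flip: card_cartesian_product)
  then show ?thesis by (simp add: wedge_sign_def power_add)
qed

lemma wsgn_swap:
  assumes "finite (snd (snd z))" "x \<in> wdec z"
  shows "wsgn (wminus z x) x = (-1) ^ (card (snd (snd (wminus z x))) * card (snd (snd x))) * wsgn x (wminus z x)"
  unfolding wsgn_def using assms
  by (intro wedge_sign_swap) (auto simp: wdec_def wminus_def intro: finite_subset[OF _ assms(1)])

text \<open>Oddness is expressed by \<open>par a = - a\<close>: coefficients of even form degree
  vanish. The exponent in \<open>wsgn_swap\<close> then has the parity of the degree of the factor
  from b, which is the sign that \<open>par\<close> inserts.\<close>

lemma wmul_comm_odd:
  assumes "par a = - a"
  shows "wmul a b = wmul (par b) a"
proof (rule wform_eqI)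
  fix z :: windex assume z: "finite (snd (snd z))"
  have a: "wcoeff a x = 0 \<or> odd (card (snd (snd x)))" for x
    using fun_cong[OF fun_cong[OF fun_cong[OF assms]], of "fst x" "fst (snd x)" "snd (snd x)"]
    by (auto simp: par_def wcoeff_def)
  show "wcoeff (wmul a b) z = wcoeff (wmul (par b) a) z"
    unfolding wmul_swap[of a] unfolding wcoeff_wmul
  proof (intro sum.cong refl)
    fix x assume x: "x \<in> wdec z"
    show "wsgn (wminus z x) x * (wcoeff b x * wcoeff a (wminus z x)) =
         wsgn x (wminus z x) * (wcoeff (par b) x * wcoeff a (wminus z x))"
      using a[of "wminus z x"] unfolding wsgn_swap[OF z x]
      by (auto simp: par_def wcoeff_def minus_one_power_iff)
  qed
qed (simp add: wmul_infinite)

lemma wmul_comm_even: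
  assumes "par a = a"
  shows "wmul a b = wmul b a"
proof (rule wform_eqI)
  fix z :: windex assume z: "finite (snd (snd z))"
  have a: "wcoeff a x = 0 \<or> even (card (snd (snd x)))" for x
    using fun_cong[OF fun_cong[OF fun_cong[OF assms]], of "fst x" "fst (snd x)" "snd (snd x)"]
    by (cases "even (card (snd (snd x)))") (auto simp: par_def wcoeff_def)
  show "wcoeff (wmul a b) z = wcoeff (wmul b a) z"
    unfolding wmul_swap[of a] unfolding wcoeff_wmul
  proof (intro sum.cong refl)
    fix x assume x: "x \<in> wdec z"
    show "wsgn (wminus z x) x * (wcoeff b x * wcoeff a (wminus z x)) =
         wsgn x (wminus z x) * (wcoeff b x * wcoeff a (wminus z x))"
      using a[of "wminus z x"] unfolding wsgn_swap[OF z x]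
      by (auto simp: minus_one_power_iff)
  qed
qed (simp add: wmul_infinite)

lemma wcoeff_add: "wcoeff (a + b) z = wcoeff a z + wcoeff b z"
  and wcoeff_scl: "wcoeff (scl c a) z = c * wcoeff a z"
  and wcoeff_par: "wcoeff (par a) z = (-1) ^ card (snd (snd z)) * wcoeff a z"
  by (simp_all add: wcoeff_def scl_def par_def)

lemma wmul_add_left: "wmul (a + a') b = wmul a b + wmul a' b"
  by (rule wform_eqI) (auto simp: wmul_infinite wcoeff_add wcoeff_wmul algebra_simps sum.distrib)

lemma wmul_add_right: "wmul a (b + b') = wmul a b + wmul a b'"
  by (rule wform_eqI) (auto simp: wmul_infinite wcoeff_add wcoeff_wmul algebra_simps sum.distrib)

lemma wmul_scl_left: "wmul (scl c a) b = scl c (wmul a b)"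
  by (rule wform_eqI) (auto simp: wcoeff_scl wcoeff_wmul algebra_simps sum_distrib_left, simp add: scl_def wmul_infinite)

lemma wmul_scl_right: "wmul a (scl c b) = scl c (wmul a b)"
  by (rule wform_eqI) (auto simp: wcoeff_scl wcoeff_wmul algebra_simps sum_distrib_left, simp add: scl_def wmul_infinite)

lemma wmul_par: "par (wmul a b) = wmul (par a) (par b)"
proof (rule wform_eqI)
  fix z :: windex assume z: "finite (snd (snd z))"
  have "card (snd (snd z)) = card (snd (snd x)) + card (snd (snd (wminus z x)))" if "x \<in> wdec z" for x
    using that z by (auto simp: wdec_def wminus_def card_Diff_subset finite_subset card_mono)
  then show "wcoeff (par (wmul a b)) z = wcoeff (wmul (par a) (par b)) z"
    by (auto simp: wcoeff_par wcoeff_wmul sum_distrib_left power_add intro!: sum.cong)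
qed (simp add: wmul_infinite par_def)

lemma scl_add: "scl c (a + b) = scl c a + scl c b"
  and scl_minus: "scl c (- a) = - scl c a"
  and scl_scl: "scl c (scl d a) = scl (c * d) a"
  and scl_one: "scl 1 a = a"
  and scl_zero: "scl c 0 = 0"
  and scl_left_zero: "scl 0 a = 0"
  and scl_left_add: "scl (c + d) a = scl c a + scl d a"
  and scl_left_minus: "scl (- c) a = - scl c a"
  by (auto simp: scl_def fun_eq_iff algebra_simps)

text \<open>Each operator below is shown to be additive once; this lemma and the next three then
  yield its rules for sums, zero, negatives and differences.\<close>

lemma additive_sum:
  fixes f :: "wform \<Rightarrow> wform"
  assumes "\<And>a b. f (a + b) = f a + f b"
  shows "f (sum g S) = (\<Sum>i\<in>S. f (g i))"
proof -
  have "f 0 = 0" using assms[of 0 0] by simp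
  then show ?thesis by (induction S rule: infinite_finite_induct) (auto simp: assms)
qed

lemma additive_zero:
  fixes f :: "wform \<Rightarrow> wform"
  assumes "\<And>a b. f (a + b) = f a + f b"
  shows "f 0 = 0"
  using assms[of 0 0] by simp

lemma additive_minus:
  fixes f :: "wform \<Rightarrow> wform"
  assumes "\<And>a b. f (a + b) = f a + f b"
  shows "f (- a) = - f a"
  using assms[of a "- a"] additive_zero[of f, OF assms] by (simp add: eq_neg_iff_add_eq_0 add.commute)

lemma additive_diff:
  fixes f :: "wform \<Rightarrow> wform"
  assumes "\<And>a b. f (a + b) = f a + f b"
  shows "f (a - b) = f a - f b"
  using assms[of a "- b"] additive_minus[of f, OF assms] by simp

lemmas scl_sum = additive_sum[of "scl c" for c, OF scl_add]
lemmas wmul_sum_left = additive_sum[of "\<lambda>a. wmul a b" for b, OF wmul_add_left]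
lemma yder_add: "yder p (a + b) = yder p a + yder p b"
  and yder_scl: "yder p (scl c a) = scl c (yder p a)"
  and yder_commute: "yder p (yder q a) = yder q (yder p a)"
  and yder_par: "yder p (par a) = par (yder p a)"
  and yder_dxw: "yder p (dxw j a) = dxw j (yder p a)"
  and yder_wone: "yder p wone = 0"
  by (auto simp: yder_def scl_def par_def dxw_def wone_def fun_eq_iff algebra_simps add_mset_commute)

lemmas yder_minus = additive_minus[of "yder p" for p, OF yder_add]
lemmas yder_diff = additive_diff[of "yder p" for p, OF yder_add]
lemmas yder_sum = additive_sum[of "yder p" for p, OF yder_add]

lemma par_add: "par (a + b) = par a + par b"
  and par_scl: "par (scl c a) = scl c (par a)"
  and par_par: "par (par a) = a"
  by (auto simp: par_def scl_def fun_eq_iff distrib_left minus_one_power_iff)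

lemmas par_minus = additive_minus[of par, OF par_add]
lemmas par_diff = additive_diff[of par, OF par_add]
lemmas par_sum = additive_sum[of par, OF par_add]

lemma dxw_add: "dxw j (a + b) = dxw j a + dxw j b"
  and dxw_scl: "dxw j (scl c a) = scl c (dxw j a)"
  by (auto simp: dxw_def scl_def fun_eq_iff algebra_simps)

lemmas dxw_zero = additive_zero[of "dxw j" for j, OF dxw_add]
lemmas dxw_minus = additive_minus[of "dxw j" for j, OF dxw_add]
lemmas dxw_diff = additive_diff[of "dxw j" for j, OF dxw_add]
lemmas dxw_sum = additive_sum[of "dxw j" for j, OF dxw_add]

lemma ymul_add: "ymul j (a + b) = ymul j a + ymul j b"
  and ymul_dxw: "ymul i (dxw j a) = dxw j (ymul i a)"
  by (auto simp: ymul_def scl_def dxw_def fun_eq_iff algebra_simps)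

lemmas ymul_zero = additive_zero[of "ymul j" for j, OF ymul_add]
lemmas ymul_sum = additive_sum[of "ymul j" for j, OF ymul_add]

section \<open>Generators and derivations acting on the product\<close>

lemma wmul_nested:
  "wmul a b k \<gamma> J = (\<Sum>s\<le>k. \<Sum>I\<in>Pow J. wedge_sign I (J - I) *
     (\<Sum>\<alpha> | \<alpha> \<subseteq># \<gamma>. a s \<alpha> I * b (k - s) (\<gamma> - \<alpha>) (J - I)))"
proof -
  have "wmul a b k \<gamma> J = (\<Sum>s\<le>k. \<Sum>\<alpha> | \<alpha> \<subseteq># \<gamma>. \<Sum>I\<in>Pow J. wedge_sign I (J - I) *
      (a s \<alpha> I * b (k - s) (\<gamma> - \<alpha>) (J - I)))"
    by (simp add: wmul_def wdec_def wsgn_def wminus_def wcoeff_def sum.cartesian_product case_prod_beta)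
  also have "\<dots> = (\<Sum>s\<le>k. \<Sum>I\<in>Pow J. \<Sum>\<alpha> | \<alpha> \<subseteq># \<gamma>. wedge_sign I (J - I) *
      (a s \<alpha> I * b (k - s) (\<gamma> - \<alpha>) (J - I)))"
    by (intro sum.cong refl sum.swap)
  finally show ?thesis by (simp add: sum_distrib_left)
qed

text \<open>The restriction to finite index sets is essential for its use with
  \<open>dxw_eq_wmul\<close>, which holds only there.\<close>

lemma wmul_cong:
  assumes "\<And>s \<alpha> I. s \<le> k \<Longrightarrow> finite I \<Longrightarrow> a s \<alpha> I = a' s \<alpha> I"
    and "\<And>s \<alpha> I. s \<le> k \<Longrightarrow> finite I \<Longrightarrow> b s \<alpha> I = b' s \<alpha> I"
  shows "wmul a b k \<gamma> J = wmul a' b' k \<gamma> J"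
proof (cases "finite J")
  case True
  then show ?thesis unfolding wmul_nested
    by (intro sum.cong refl arg_cong2[where f = "(*)"] assms)
      (auto intro: finite_subset)
qed (simp add: wmul_infinite)

lemma submset_reindex:
  fixes f :: "nat multiset \<Rightarrow> complex"
  shows "(\<Sum>\<alpha> | \<alpha> \<subseteq># add_mset p \<gamma> \<and> p \<in># \<alpha>. f \<alpha>) = (\<Sum>\<alpha> | \<alpha> \<subseteq># \<gamma>. f (add_mset p \<alpha>))"
  by (rule sum.reindex_bij_witness[where i = "add_mset p" and j = "\<lambda>\<alpha>. \<alpha> - {#p#}"])
    (auto simp: subset_eq_diff_conv insert_subset_eq_iff)

text \<open>The multiplicity of p in \<open>add_mset p \<gamma>\<close> is the sum of its
  multiplicities in the two factors. Each summand of this weight belongs to the derivative of one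
  factor.\<close>

lemma submset_leibniz:
  fixes f g :: "nat multiset \<Rightarrow> complex"
  shows "of_nat (count \<gamma> p + 1) * (\<Sum>\<alpha> | \<alpha> \<subseteq># add_mset p \<gamma>. f \<alpha> * g (add_mset p \<gamma> - \<alpha>)) =
    (\<Sum>\<alpha> | \<alpha> \<subseteq># \<gamma>. (of_nat (count \<alpha> p + 1) * f (add_mset p \<alpha>)) * g (\<gamma> - \<alpha>)) +
    (\<Sum>\<alpha> | \<alpha> \<subseteq># \<gamma>. f \<alpha> * (of_nat (count (\<gamma> - \<alpha>) p + 1) * g (add_mset p (\<gamma> - \<alpha>))))"
proof -
  let ?S = "{\<alpha>. \<alpha> \<subseteq># add_mset p \<gamma>}"
  have *: "count \<gamma> p + 1 = count \<alpha> p + count (add_mset p \<gamma> - \<alpha>) p" if "\<alpha> \<in> ?S" for \<alpha>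
    using that by (auto simp: subseteq_mset_def dest: spec[of _ p])
  have 1: "(\<Sum>\<alpha>\<in>?S. of_nat (count \<alpha> p) * f \<alpha> * g (add_mset p \<gamma> - \<alpha>)) =
      (\<Sum>\<alpha> | \<alpha> \<subseteq># add_mset p \<gamma> \<and> p \<in># \<alpha>. of_nat (count \<alpha> p) * f \<alpha> * g (add_mset p \<gamma> - \<alpha>))"
    by (rule sum.mono_neutral_right) (auto simp: finite_submultisets not_in_iff)
  \<comment> \<open>A submultiset of \<open>add_mset p \<gamma>\<close> that does not fit into
    \<open>\<gamma>\<close> uses up all copies of p, so the weight from its complement is 0.\<close>
  have 2: "(\<Sum>\<alpha>\<in>?S. f \<alpha> * (of_nat (count (add_mset p \<gamma> - \<alpha>) p) * g (add_mset p \<gamma> - \<alpha>))) =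
      (\<Sum>\<alpha> | \<alpha> \<subseteq># \<gamma>. f \<alpha> * (of_nat (count (add_mset p \<gamma> - \<alpha>) p) * g (add_mset p \<gamma> - \<alpha>)))"
  proof (rule sum.mono_neutral_right)
    show "\<forall>\<alpha>\<in>?S - {\<alpha>. \<alpha> \<subseteq># \<gamma>}. f \<alpha> * (of_nat (count (add_mset p \<gamma> - \<alpha>) p) * g (add_mset p \<gamma> - \<alpha>)) = 0"
    proof
      fix \<alpha> assume a: "\<alpha> \<in> ?S - {\<alpha>. \<alpha> \<subseteq># \<gamma>}"
      have "count (add_mset p \<gamma> - \<alpha>) p = 0"
      proof (rule ccontr)
        assume n: "count (add_mset p \<gamma> - \<alpha>) p \<noteq> 0"
        have "count \<alpha> v \<le> count \<gamma> v" for v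
          using a n by (cases "v = p") (auto simp: subseteq_mset_def dest: spec[of _ v])
        with a show False by (auto simp: subseteq_mset_def)
      qed
      then show "f \<alpha> * (of_nat (count (add_mset p \<gamma> - \<alpha>) p) * g (add_mset p \<gamma> - \<alpha>)) = 0" by simp
    qed
  qed (auto simp: finite_submultisets intro: subset_mset.order_trans)
  have "of_nat (count \<gamma> p + 1) * (\<Sum>\<alpha>\<in>?S. f \<alpha> * g (add_mset p \<gamma> - \<alpha>)) =
      (\<Sum>\<alpha>\<in>?S. (of_nat (count \<alpha> p) + of_nat (count (add_mset p \<gamma> - \<alpha>) p)) * (f \<alpha> * g (add_mset p \<gamma> - \<alpha>)))"
    unfolding sum_distrib_left by (intro sum.cong refl arg_cong2[where f = "(*)"]) (metis * of_nat_add)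
  also have "\<dots> = (\<Sum>\<alpha>\<in>?S. of_nat (count \<alpha> p) * f \<alpha> * g (add_mset p \<gamma> - \<alpha>)) +
      (\<Sum>\<alpha>\<in>?S. f \<alpha> * (of_nat (count (add_mset p \<gamma> - \<alpha>) p) * g (add_mset p \<gamma> - \<alpha>)))"
    by (simp add: sum.distrib[symmetric] algebra_simps)
  also have "\<dots> = (\<Sum>\<alpha> | \<alpha> \<subseteq># \<gamma>. (of_nat (count \<alpha> p + 1) * f (add_mset p \<alpha>)) * g (\<gamma> - \<alpha>)) +
    (\<Sum>\<alpha> | \<alpha> \<subseteq># \<gamma>. f \<alpha> * (of_nat (count (\<gamma> - \<alpha>) p + 1) * g (add_mset p (\<gamma> - \<alpha>))))"
    unfolding 1 2 submset_reindex
    by (intro arg_cong2[where f = "(+)"] sum.cong refl)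
      (auto simp: subset_mset.add_diff_assoc2[of _ _ "{#p#}", simplified, symmetric] algebra_simps)
  finally show ?thesis .
qed

lemma yder_wmul: "yder p (wmul a b) = wmul (yder p a) b + wmul a (yder p b)"
proof (intro ext)
  fix k \<gamma> J
  have "yder p (wmul a b) k \<gamma> J = (\<Sum>s\<le>k. \<Sum>I\<in>Pow J. wedge_sign I (J - I) * (of_nat (count \<gamma> p + 1) *
     (\<Sum>\<alpha> | \<alpha> \<subseteq># add_mset p \<gamma>. a s \<alpha> I * b (k - s) (add_mset p \<gamma> - \<alpha>) (J - I))))"
    unfolding yder_def wmul_nested by (simp add: sum_distrib_left mult_ac)
  also have "\<dots> = (wmul (yder p a) b + wmul a (yder p b)) k \<gamma> J"
    unfolding plus_fun_apply wmul_nested sum.distrib[symmetric] distrib_left[symmetric]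
      submset_leibniz[of \<gamma> p "\<lambda>\<alpha>. a _ \<alpha> _" "\<lambda>\<beta>. b _ \<beta> _"]
    by (simp only: yder_def)
  finally show "yder p (wmul a b) k \<gamma> J = (wmul (yder p a) b + wmul a (yder p b)) k \<gamma> J" .
qed

lemma wmul_ymul: "wmul (ymul p a) b = ymul p (wmul a b)"
proof (intro ext)
  fix k \<gamma> J
  show "wmul (ymul p a) b k \<gamma> J = ymul p (wmul a b) k \<gamma> J"
  proof (cases "p \<in># \<gamma>")
    case True
    then obtain \<delta> where \<delta>: "\<gamma> = add_mset p \<delta>" by (metis insert_DiffM)
    have "(\<Sum>\<alpha> | \<alpha> \<subseteq># \<gamma>. ymul p a s \<alpha> I * b t (\<gamma> - \<alpha>) K) =
        (\<Sum>\<alpha> | \<alpha> \<subseteq># \<delta>. a s \<alpha> I * b t (\<delta> - \<alpha>) K)" for s t I K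
    proof -
      have "(\<Sum>\<alpha> | \<alpha> \<subseteq># \<gamma>. ymul p a s \<alpha> I * b t (\<gamma> - \<alpha>) K) =
        (\<Sum>\<alpha> | \<alpha> \<subseteq># \<gamma> \<and> p \<in># \<alpha>. ymul p a s \<alpha> I * b t (\<gamma> - \<alpha>) K)"
        by (rule sum.mono_neutral_right) (auto simp: finite_submultisets ymul_def)
      then show ?thesis unfolding \<delta> submset_reindex by (simp add: ymul_def)
    qed
    then show ?thesis by (simp add: wmul_nested ymul_def[of p "wmul a b"] \<delta>)
  next
    case False
    then have "(\<Sum>\<alpha> | \<alpha> \<subseteq># \<gamma>. ymul p a s \<alpha> I * b t (\<gamma> - \<alpha>) K) = 0" for s t I K
      by (intro sum.neutral) (auto simp: ymul_def dest: mset_subset_eqD)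
    with False show ?thesis by (simp add: wmul_nested ymul_def[of p "wmul a b"])
  qed
qed

text \<open>The indicator function is the basis form dx_K; only the splitting of \<open>J\<close>
  into K and its complement contributes.\<close>

lemma wmul_basis:
  assumes "finite J"
  shows "wmul (\<lambda>k \<alpha> I. if k = 0 \<and> \<alpha> = {#} \<and> I = K then 1 else 0) b k \<gamma> J =
    (if K \<subseteq> J then wedge_sign K (J - K) * b k \<gamma> (J - K) else 0)"
proof -
  let ?e = "\<lambda>k \<alpha> I. if k = 0 \<and> \<alpha> = {#} \<and> I = K then 1 else 0 :: complex"
  have "wmul ?e b k \<gamma> J = (\<Sum>x\<in>wdec (k, \<gamma>, J). if x = (0, {#}, K) then wedge_sign K (J - K) * b k \<gamma> (J - K) else 0)"
    unfolding wmul_def by (intro sum.cong refl) (auto simp: wcoeff_def wsgn_def wminus_def)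
  also have "\<dots> = (if (0, {#}, K) \<in> wdec (k, \<gamma>, J) then wedge_sign K (J - K) * b k \<gamma> (J - K) else 0)"
    using assms by (simp add: finite_wdec)
  finally show ?thesis by (simp add: wdec_def)
qed

lemma dxw_wone: "dxw j wone = (\<lambda>k \<alpha> I. if k = 0 \<and> \<alpha> = {#} \<and> I = {j} then 1 else 0)"
proof (intro ext)
  fix k :: nat and \<alpha> :: "nat multiset" and I
  have "card {i \<in> {j}. i < j} = 0" by (rule card_eq_0_iff[THEN iffD2]) blast
  then have *: "(-1) ^ card {i \<in> {j}. i < j} = (1::complex)" by (simp only: power_0)
  show "dxw j wone k \<alpha> I = (if k = 0 \<and> \<alpha> = {#} \<and> I = {j} then 1 else 0)"
  proof (cases "I = {j}")
    case True
    have "dxw j wone k \<alpha> {j} = (-1) ^ card {i \<in> {j}. i < j} * wone k \<alpha> {}"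
      by (simp add: dxw_def del: Collect_conv_if)
    then show ?thesis unfolding True * by (simp add: wone_def)
  next
    case False
    then have "j \<in> I \<Longrightarrow> I - {j} \<noteq> {}" by blast
    then show ?thesis using False by (simp add: dxw_def wone_def)
  qed
qed

text \<open>At an infinite \<open>J\<close> the product is 0 by default, whereas \<open>dxw\<close>
  passes on the value of b; hence the restriction to finite \<open>J\<close>.\<close>

lemma dxw_eq_wmul:
  assumes "finite J"
  shows "dxw j b k \<gamma> J = wmul (dxw j wone) b k \<gamma> J"
proof -
  have "card {(i, l). i \<in> {j} \<and> l \<in> J - {j} \<and> l < i} = card (Pair j ` {i \<in> J. i < j})"
    by (rule arg_cong[where f = card]) auto
  then have "wedge_sign {j} (J - {j}) = (-1) ^ card {i \<in> J. i < j}"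
    by (simp add: wedge_sign_def card_image inj_on_def)
  moreover have "wmul (dxw j wone) b k \<gamma> J =
      (if {j} \<subseteq> J then wedge_sign {j} (J - {j}) * b k \<gamma> (J - {j}) else 0)"
    unfolding dxw_wone by (rule wmul_basis[OF assms])
  ultimately show ?thesis by (simp add: dxw_def[of j b])
qed

lemma par_dxw_wone: "par (dxw j wone) = - dxw j wone"
  unfolding dxw_wone par_def by (intro ext) simp

lemma dxw_wmul: "dxw j (wmul a b) = wmul (dxw j a) b"
proof (intro ext)
  fix k \<gamma> J
  show "dxw j (wmul a b) k \<gamma> J = wmul (dxw j a) b k \<gamma> J"
  proof (cases "finite J")
    case True
    then have "dxw j (wmul a b) k \<gamma> J = wmul (wmul (dxw j wone) a) b k \<gamma> J"
      by (simp add: dxw_eq_wmul wmul_assoc)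
    also have "\<dots> = wmul (dxw j a) b k \<gamma> J"
      by (rule wmul_cong) (simp_all add: dxw_eq_wmul)
    finally show ?thesis .
  qed (simp add: dxw_def wmul_infinite)
qed

text \<open>Moving the odd form dx_j to the front past a replaces a by \<open>par a\<close>, by
  graded commutativity; associativity does the rest.\<close>

lemma wmul_dxw: "wmul a (dxw j b) = dxw j (wmul (par a) b)"
proof (intro ext)
  fix k \<gamma> J
  have comm: "wmul a (dxw j wone) = wmul (dxw j wone) (par a)"
    using wmul_comm_odd[OF par_dxw_wone, of j "par a"] by (simp add: par_par)
  show "wmul a (dxw j b) k \<gamma> J = dxw j (wmul (par a) b) k \<gamma> J"
  proof (cases "finite J")
    case True
    have "wmul a (dxw j b) k \<gamma> J = wmul a (wmul (dxw j wone) b) k \<gamma> J"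
      by (rule wmul_cong) (simp_all add: dxw_eq_wmul)
    also have "\<dots> = wmul (wmul (dxw j wone) (par a)) b k \<gamma> J"
      by (simp add: comm flip: wmul_assoc)
    also have "\<dots> = dxw j (wmul (par a) b) k \<gamma> J"
      using True by (simp add: dxw_eq_wmul wmul_assoc)
    finally show ?thesis .
  qed (simp add: dxw_def wmul_infinite)
qed

section \<open>The Moyal--Weyl product\<close>

text \<open>The bidifferential operator $\frac1{m!}\mu\hat\Pi^m$, so that
  $a\circ b=\sum_m(-i\lambda)^m B_m(a,b)$.\<close>

primrec moyal_term :: "nat \<Rightarrow> nat \<Rightarrow> wform \<Rightarrow> wform \<Rightarrow> wform" where
  "moyal_term n 0 a b = wmul a b"
| "moyal_term n (Suc m) a b = (\<Sum>p<2*n. \<Sum>q<2*n.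
     scl (of_real (Pi_comp n p q) / of_nat (Suc m)) (moyal_term n m (yder p a) (yder q b)))"

lemma Pi_hat_sum:
  "(Pi_hat n ^^ m) (\<lambda>\<alpha> \<beta>. \<Sum>i\<in>S. c i * t i \<alpha> \<beta>) = (\<lambda>\<alpha> \<beta>. \<Sum>i\<in>S. c i * (Pi_hat n ^^ m) (t i) \<alpha> \<beta>)"
proof (induction m)
  case (Suc m)
  have "Pi_hat n (\<lambda>\<alpha> \<beta>. \<Sum>i\<in>S. c i * u i \<alpha> \<beta>) = (\<lambda>\<alpha> \<beta>. \<Sum>i\<in>S. c i * Pi_hat n (u i) \<alpha> \<beta>)" for u
  proof (intro ext)
    fix \<alpha> \<beta>
    have "Pi_hat n (\<lambda>\<alpha> \<beta>. \<Sum>i\<in>S. c i * u i \<alpha> \<beta>) \<alpha> \<beta> = (\<Sum>p<2*n. \<Sum>q<2*n. \<Sum>i\<in>S. c i * (of_real (Pi_comp n p q) *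
      of_nat (count \<alpha> p + 1) * of_nat (count \<beta> q + 1) * u i (add_mset p \<alpha>) (add_mset q \<beta>)))"
      unfolding Pi_hat_def by (simp only: sum_distrib_left mult_ac)
    also have "\<dots> = (\<Sum>i\<in>S. \<Sum>p<2*n. \<Sum>q<2*n. c i * (of_real (Pi_comp n p q) *
      of_nat (count \<alpha> p + 1) * of_nat (count \<beta> q + 1) * u i (add_mset p \<alpha>) (add_mset q \<beta>)))"
      by (subst (2) sum.swap, subst sum.swap[of _ _ "{..<2*n}"]) (rule refl)
    finally show "Pi_hat n (\<lambda>\<alpha> \<beta>. \<Sum>i\<in>S. c i * u i \<alpha> \<beta>) \<alpha> \<beta> = (\<Sum>i\<in>S. c i * Pi_hat n (u i) \<alpha> \<beta>)"
      unfolding Pi_hat_def by (simp only: sum_distrib_left)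
  qed
  with Suc show ?case by simp
qed simp

lemma mu_sum: "mu (\<lambda>\<alpha> \<beta>. \<Sum>i\<in>S. c i * t i \<alpha> \<beta>) \<gamma> = (\<Sum>i\<in>S. c i * mu (t i) \<gamma>)"
  unfolding mu_def by (subst sum.swap) (simp add: sum_distrib_left)

text \<open>One application of the bivector turns a tensor product into a sum of tensor products of
  derivatives, so its iterates reduce to \<open>yder\<close>.\<close>

lemma Pi_hat_tensor:
  "Pi_hat n (\<lambda>\<alpha> \<beta>. a s \<alpha> I * b t \<beta> K) =
    (\<lambda>\<alpha> \<beta>. \<Sum>i\<in>{..<2*n} \<times> {..<2*n}. of_real (Pi_comp n (fst i) (snd i)) *
       (yder (fst i) a s \<alpha> I * yder (snd i) b t \<beta> K))"
  by (simp add: Pi_hat_def yder_def sum.cartesian_product case_prod_beta mult_ac)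

lemma sum_wform_apply: "(sum f S) k \<alpha> J = (\<Sum>i\<in>S. (f i :: wform) k \<alpha> J)"
  by (induction S rule: infinite_finite_induct) auto

lemma moyal_term_eq:
  "moyal_term n m a b k \<gamma> J = (\<Sum>s\<le>k. \<Sum>I\<in>Pow J. wedge_sign I (J - I) *
          mu ((Pi_hat n ^^ m) (\<lambda>\<alpha> \<beta>. a s \<alpha> I * b (k - s) \<beta> (J - I))) \<gamma>) / fact m"
proof (induction m arbitrary: a b)
  case 0
  show ?case by (simp add: wmul_nested mu_def)
next
  case (Suc m)
  let ?c = "\<lambda>i. of_real (Pi_comp n (fst i) (snd i)) :: complex"
  let ?S = "{..<2*n} \<times> {..<2*n}"
  let ?t = "\<lambda>i s I. mu ((Pi_hat n ^^ m) (\<lambda>\<alpha> \<beta>. yder (fst i) a s \<alpha> I * yder (snd i) b (k - s) \<beta> (J - I))) \<gamma>"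
  have "(\<Sum>s\<le>k. \<Sum>I\<in>Pow J. wedge_sign I (J - I) *
          mu ((Pi_hat n ^^ Suc m) (\<lambda>\<alpha> \<beta>. a s \<alpha> I * b (k - s) \<beta> (J - I))) \<gamma>) =
      (\<Sum>s\<le>k. \<Sum>I\<in>Pow J. \<Sum>i\<in>?S. ?c i * (wedge_sign I (J - I) * ?t i s I))"
    \<comment> \<open>The innermost \<open>Pi_hat\<close> is peeled off: it acts on the original
      tensor product and leaves tensor products of derivatives, to which the induction hypothesis
      applies.\<close>
    unfolding funpow_Suc_right o_apply Pi_hat_tensor Pi_hat_sum mu_sum
    by (simp only: sum_distrib_left mult_ac)
  also have "\<dots> = (\<Sum>i\<in>?S. \<Sum>s\<le>k. \<Sum>I\<in>Pow J. ?c i * (wedge_sign I (J - I) * ?t i s I))"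
    by (subst (2) sum.swap, subst sum.swap) (rule refl)
  also have "\<dots> = (\<Sum>i\<in>?S. ?c i * (fact m * moyal_term n m (yder (fst i) a) (yder (snd i) b) k \<gamma> J))"
  proof (intro sum.cong refl)
    fix i
    have IH: "fact m * moyal_term n m (yder (fst i) a) (yder (snd i) b) k \<gamma> J =
        (\<Sum>s\<le>k. \<Sum>I\<in>Pow J. wedge_sign I (J - I) * ?t i s I)"
      unfolding Suc by simp
    show "(\<Sum>s\<le>k. \<Sum>I\<in>Pow J. ?c i * (wedge_sign I (J - I) * ?t i s I)) =
        ?c i * (fact m * moyal_term n m (yder (fst i) a) (yder (snd i) b) k \<gamma> J)"
      unfolding IH by (simp only: sum_distrib_left)
  qed
  also have "\<dots> / fact (Suc m) = moyal_term n (Suc m) a b k \<gamma> J"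
    by (simp add: sum_wform_apply sum.cartesian_product case_prod_beta scl_def sum_divide_distrib)
  finally show ?case by simp
qed

lemma moyal_eq: "moyal n a b k \<gamma> J = (\<Sum>m\<le>k. (- \<i>) ^ m * moyal_term n m a b (k - m) \<gamma> J)"
  by (simp add: moyal_def moyal_term_eq)

lemma moyal_term_add_left: "moyal_term n m (a + a') b = moyal_term n m a b + moyal_term n m a' b"
  by (induction m arbitrary: a a' b) (simp_all add: wmul_add_left yder_add scl_add sum.distrib)

lemma moyal_term_add_right: "moyal_term n m a (b + b') = moyal_term n m a b + moyal_term n m a b'"
  by (induction m arbitrary: a b b') (simp_all add: wmul_add_right yder_add scl_add sum.distrib)

lemmas moyal_term_zero_left = additive_zero[of "\<lambda>a. moyal_term n m a b" for n m b, OF moyal_term_add_left]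
lemmas moyal_term_zero_right = additive_zero[of "moyal_term n m a" for n m a, OF moyal_term_add_right]
lemmas moyal_term_sum_left = additive_sum[of "\<lambda>a. moyal_term n m a b" for n m b, OF moyal_term_add_left]
lemmas moyal_term_sum_right = additive_sum[of "moyal_term n m a" for n m a, OF moyal_term_add_right]

lemma moyal_term_scl_left: "moyal_term n m (scl c a) b = scl c (moyal_term n m a b)"
  by (induction m arbitrary: a b) (simp_all add: wmul_scl_left yder_scl scl_sum scl_scl mult.commute[of c])

lemma moyal_term_scl_right: "moyal_term n m a (scl c b) = scl c (moyal_term n m a b)"
  by (induction m arbitrary: a b) (simp_all add: wmul_scl_right yder_scl scl_sum scl_scl mult.commute[of c])

lemma yder_moyal_term: "yder p (moyal_term n m a b) = moyal_term n m (yder p a) b + moyal_term n m a (yder p b)"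
  by (induction m arbitrary: a b)
    (simp_all add: yder_wmul yder_sum yder_scl scl_add sum.distrib yder_commute[of p])

lemma par_moyal_term: "par (moyal_term n m a b) = moyal_term n m (par a) (par b)"
  by (induction m arbitrary: a b) (simp_all add: wmul_par par_sum par_scl yder_par)

lemma dxw_moyal_term: "dxw j (moyal_term n m a b) = moyal_term n m (dxw j a) b"
  by (induction m arbitrary: a b) (simp_all add: dxw_wmul dxw_sum dxw_scl yder_dxw)

lemma moyal_term_dxw: "moyal_term n m a (dxw j b) = dxw j (moyal_term n m (par a) b)"
  by (induction m arbitrary: a b) (simp_all add: wmul_dxw dxw_sum dxw_scl yder_dxw yder_par)

lemma Pi_comp_swap: "Pi_comp n q p = - Pi_comp n p q"
  by (auto simp: Pi_comp_def omega_comp_def)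

text \<open>Exchanging the factors transposes each of the m contractions, and the antisymmetry of
  \<open>Pi_comp\<close> gives one sign for each. Order 0 is graded commutativity of
  \<open>wmul\<close>.\<close>

lemma moyal_term_swap_odd:
  assumes "par a = - a"
  shows "moyal_term n m (par b) a = scl ((-1) ^ m) (moyal_term n m a b)"
  using assms
proof (induction m arbitrary: a b)
  case 0
  show ?case using wmul_comm_odd[OF 0, of b] by (simp add: scl_one)
next
  case (Suc m)
  have *: "moyal_term n m (par (yder p b)) (yder q a) = scl ((-1) ^ m) (moyal_term n m (yder q a) (yder p b))" for p q
    by (rule Suc.IH) (simp only: yder_par[symmetric] Suc.prems yder_minus)
  have "moyal_term n (Suc m) (par b) a = (\<Sum>p<2*n. \<Sum>q<2*n.
     scl (of_real (Pi_comp n p q) / of_nat (Suc m) * (-1) ^ m) (moyal_term n m (yder q a) (yder p b)))"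
    by (simp add: yder_par * scl_scl)
  also have "\<dots> = (\<Sum>q<2*n. \<Sum>p<2*n.
     scl (of_real (Pi_comp n p q) / of_nat (Suc m) * (-1) ^ m) (moyal_term n m (yder q a) (yder p b)))"
    by (rule sum.swap)
  also have "\<dots> = scl ((-1) ^ Suc m) (moyal_term n (Suc m) a b)"
    unfolding moyal_term.simps scl_sum scl_scl
    by (intro sum.cong refl arg_cong2[where f = scl]) (subst Pi_comp_swap, simp)
  finally show ?case .
qed

text \<open>The coefficients $L_N$, $R_N$ of $(-i\lambda)^N$ in $(a\circ b)\circ c$ and $a\circ(b\circ c)$.
  By the Leibniz rule for $B_m$ both satisfy
  $N\,T_N(a,b,c)=\sum\Pi_{pq}\,(T_{N-1}(\partial_pa,b,\partial_qc)+T_{N-1}(a,\partial_pb,\partial_qc)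
  +T_{N-1}(\partial_pa,\partial_qb,c))$, which reduces associativity to $N=0$.\<close>

definition assoc_left :: "nat \<Rightarrow> nat \<Rightarrow> wform \<Rightarrow> wform \<Rightarrow> wform \<Rightarrow> wform" where
  "assoc_left n N a b c = (\<Sum>m\<le>N. moyal_term n m (moyal_term n (N - m) a b) c)"

definition assoc_right :: "nat \<Rightarrow> nat \<Rightarrow> wform \<Rightarrow> wform \<Rightarrow> wform \<Rightarrow> wform" where
  "assoc_right n N a b c = (\<Sum>m\<le>N. moyal_term n m a (moyal_term n (N - m) b c))"

text \<open>The factor clears the denominator from which \<open>moyal_term\<close> builds up
  1/m!.\<close>

lemma moyal_term_Suc_scl:
  "scl (of_nat (Suc m)) (moyal_term n (Suc m) a b) =
    (\<Sum>p<2*n. \<Sum>q<2*n. scl (of_real (Pi_comp n p q)) (moyal_term n m (yder p a) (yder q b)))"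
  by (simp add: scl_sum scl_scl del: of_nat_Suc)

lemma moyal_term_left_Suc:
  "scl (of_nat (Suc l)) (moyal_term n m (moyal_term n (Suc l) a b) c) =
    (\<Sum>p<2*n. \<Sum>q<2*n. scl (of_real (Pi_comp n p q)) (moyal_term n m (moyal_term n l (yder p a) (yder q b)) c))"
  by (simp only: moyal_term_scl_left[of n m _ "moyal_term n (Suc l) a b", symmetric] moyal_term_Suc_scl moyal_term_sum_left)
    (simp only: moyal_term_scl_left)

lemma moyal_term_right_Suc:
  "scl (of_nat (Suc l)) (moyal_term n m a (moyal_term n (Suc l) b c)) =
    (\<Sum>p<2*n. \<Sum>q<2*n. scl (of_real (Pi_comp n p q)) (moyal_term n m a (moyal_term n l (yder p b) (yder q c))))"
  by (simp only: moyal_term_scl_right[of n m a _ "moyal_term n (Suc l) b c", symmetric] moyal_term_Suc_scl moyal_term_sum_right)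
    (simp only: moyal_term_scl_right)

text \<open>The weight \<open>Suc M\<close> is split as m plus \<open>Suc M - m\<close>: the first
  part clears the denominator of the outer product, the second that of the inner one. The boundary
  terms m = 0 and m = \<open>Suc M\<close> carry weight 0 in one part each.\<close>

lemma sum_split_weights:
  fixes F :: "nat \<Rightarrow> wform"
  shows "scl (of_nat (Suc M)) (\<Sum>m\<le>Suc M. F m) =
    (\<Sum>m\<le>M. scl (of_nat (Suc m)) (F (Suc m))) + (\<Sum>m\<le>M. scl (of_nat (Suc (M - m))) (F m))"
proof -
  have "scl (of_nat (Suc M)) (\<Sum>m\<le>Suc M. F m) =
      (\<Sum>m\<le>Suc M. scl (of_nat m) (F m)) + (\<Sum>m\<le>Suc M. scl (of_nat (Suc M - m)) (F m))"
    unfolding scl_sum sum.distrib[symmetric] scl_left_add[symmetric] of_nat_add[symmetric]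
    by (intro sum.cong refl arg_cong2[where f = scl]) simp
  also have "(\<Sum>m\<le>Suc M. scl (of_nat m) (F m)) = (\<Sum>m\<le>M. scl (of_nat (Suc m)) (F (Suc m)))"
    by (subst sum.atMost_Suc_shift) (simp add: scl_left_zero)
  also have "(\<Sum>m\<le>Suc M. scl (of_nat (Suc M - m)) (F m)) = (\<Sum>m\<le>M. scl (of_nat (Suc (M - m))) (F m))"
  proof -
    have "(\<Sum>m\<le>Suc M. scl (of_nat (Suc M - m)) (F m)) = (\<Sum>m\<le>M. scl (of_nat (Suc M - m)) (F m))"
      unfolding sum.atMost_Suc diff_self_eq_0 by (simp only: of_nat_0 scl_left_zero add_0_right)
    also have "\<dots> = (\<Sum>m\<le>M. scl (of_nat (Suc (M - m))) (F m))"
      by (intro sum.cong refl) (simp only: Suc_diff_le atMost_iff)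
    finally show ?thesis .
  qed
  finally show ?thesis .
qed

lemma assoc_left_Suc:
  "scl (of_nat (Suc M)) (assoc_left n (Suc M) a b c) = (\<Sum>p<2*n. \<Sum>q<2*n. scl (of_real (Pi_comp n p q))
     (assoc_left n M (yder p a) b (yder q c) + assoc_left n M a (yder p b) (yder q c) +
      assoc_left n M (yder p a) (yder q b) c))"
proof -
  \<comment> \<open>In the outer product the derivative of the inner one falls on a or on b, which
    contracts either of them with c; the inner product contributes the contraction of a with
    b.\<close>
  have "(\<Sum>m\<le>M. scl (of_nat (Suc m)) (moyal_term n (Suc m) (moyal_term n (M - m) a b) c)) = (\<Sum>p<2*n. \<Sum>q<2*n. \<Sum>m\<le>M.
     scl (of_real (Pi_comp n p q)) (moyal_term n m (moyal_term n (M - m) (yder p a) b) (yder q c) + moyal_term n m (moyal_term n (M - m) a (yder p b)) (yder q c)))"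
    unfolding moyal_term_Suc_scl yder_moyal_term moyal_term_add_left
    by (subst sum.swap, subst sum.swap[of _ "{..M}"]) (rule refl)
  moreover have "(\<Sum>m\<le>M. scl (of_nat (Suc (M - m))) (moyal_term n m (moyal_term n (Suc (M - m)) a b) c)) = (\<Sum>p<2*n. \<Sum>q<2*n. \<Sum>m\<le>M.
     scl (of_real (Pi_comp n p q)) (moyal_term n m (moyal_term n (M - m) (yder p a) (yder q b)) c))"
    unfolding moyal_term_left_Suc
    by (subst sum.swap, subst sum.swap[of _ "{..M}"]) (rule refl)
  moreover have "scl (of_nat (Suc M)) (assoc_left n (Suc M) a b c) =
      (\<Sum>m\<le>M. scl (of_nat (Suc m)) (moyal_term n (Suc m) (moyal_term n (M - m) a b) c)) +
      (\<Sum>m\<le>M. scl (of_nat (Suc (M - m))) (moyal_term n m (moyal_term n (Suc (M - m)) a b) c))"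
    unfolding assoc_left_def sum_split_weights by (simp del: moyal_term.simps add: Suc_diff_le)
  ultimately show ?thesis
    by (simp add: assoc_left_def scl_add scl_sum sum.distrib)
qed

lemma assoc_right_Suc:
  "scl (of_nat (Suc M)) (assoc_right n (Suc M) a b c) = (\<Sum>p<2*n. \<Sum>q<2*n. scl (of_real (Pi_comp n p q))
     (assoc_right n M (yder p a) b (yder q c) + assoc_right n M a (yder p b) (yder q c) +
      assoc_right n M (yder p a) (yder q b) c))"
proof -
  \<comment> \<open>Here the outer product contracts a with b or with c, and the inner one contracts
    b with c: the same three pairs as for the left bracketing.\<close>
  have "(\<Sum>m\<le>M. scl (of_nat (Suc m)) (moyal_term n (Suc m) a (moyal_term n (M - m) b c))) = (\<Sum>p<2*n. \<Sum>q<2*n. \<Sum>m\<le>M.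
     scl (of_real (Pi_comp n p q)) (moyal_term n m (yder p a) (moyal_term n (M - m) (yder q b) c) + moyal_term n m (yder p a) (moyal_term n (M - m) b (yder q c))))"
    unfolding moyal_term_Suc_scl yder_moyal_term moyal_term_add_right
    by (subst sum.swap, subst sum.swap[of _ "{..M}"]) (rule refl)
  moreover have "(\<Sum>m\<le>M. scl (of_nat (Suc (M - m))) (moyal_term n m a (moyal_term n (Suc (M - m)) b c))) = (\<Sum>p<2*n. \<Sum>q<2*n. \<Sum>m\<le>M.
     scl (of_real (Pi_comp n p q)) (moyal_term n m a (moyal_term n (M - m) (yder p b) (yder q c))))"
    unfolding moyal_term_right_Suc
    by (subst sum.swap, subst sum.swap[of _ "{..M}"]) (rule refl)
  moreover have "scl (of_nat (Suc M)) (assoc_right n (Suc M) a b c) =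
      (\<Sum>m\<le>M. scl (of_nat (Suc m)) (moyal_term n (Suc m) a (moyal_term n (M - m) b c))) +
      (\<Sum>m\<le>M. scl (of_nat (Suc (M - m))) (moyal_term n m a (moyal_term n (Suc (M - m)) b c)))"
    unfolding assoc_right_def sum_split_weights by (simp del: moyal_term.simps add: Suc_diff_le)
  ultimately show ?thesis
    by (simp add: assoc_right_def scl_add scl_sum sum.distrib add_ac)
qed

lemma assoc_left_eq_right: "assoc_left n N a b c = assoc_right n N a b c"
proof (induction N arbitrary: a b c)
  case 0
  show ?case by (simp add: assoc_left_def assoc_right_def wmul_assoc)
next
  case (Suc M)
  have "scl (of_nat (Suc M)) (assoc_left n (Suc M) a b c) = scl (of_nat (Suc M)) (assoc_right n (Suc M) a b c)"
    unfolding assoc_left_Suc assoc_right_Suc Suc ..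
  then have "scl (1 / of_nat (Suc M)) (scl (of_nat (Suc M)) (assoc_left n (Suc M) a b c)) =
      scl (1 / of_nat (Suc M)) (scl (of_nat (Suc M)) (assoc_right n (Suc M) a b c))" by simp
  then show ?case unfolding scl_scl by (simp add: scl_one del: of_nat_Suc)
qed

section \<open>Multiplication by powers of lambda, and associativity\<close>

definition lambda_mult :: "nat \<Rightarrow> wform \<Rightarrow> wform" where
  "lambda_mult m a = (\<lambda>k. if m \<le> k then a (k - m) else (\<lambda>_ _. 0))"

lemma lambda_mult_add: "lambda_mult m (a + b) = lambda_mult m a + lambda_mult m b"
  and lambda_mult_scl: "lambda_mult m (scl c a) = scl c (lambda_mult m a)"
  and yder_lambda_mult: "yder p (lambda_mult m a) = lambda_mult m (yder p a)"
  and lambda_mult_lambda_mult: "lambda_mult m (lambda_mult l a) = lambda_mult (m + l) a"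
  by (auto simp: lambda_mult_def scl_def yder_def fun_eq_iff)

lemmas lambda_mult_sum = additive_sum[of "lambda_mult m" for m, OF lambda_mult_add]

lemma wmul_lambda_mult_left: "wmul (lambda_mult m a) b = lambda_mult m (wmul a b)"
proof (intro ext)
  fix k \<gamma> J
  show "wmul (lambda_mult m a) b k \<gamma> J = lambda_mult m (wmul a b) k \<gamma> J"
  proof (cases "m \<le> k")
    case True
    let ?g = "\<lambda>s t. \<Sum>I\<in>Pow J. wedge_sign I (J - I) * (\<Sum>\<alpha> | \<alpha> \<subseteq># \<gamma>. a s \<alpha> I * b t (\<gamma> - \<alpha>) (J - I))"
    have "wmul (lambda_mult m a) b k \<gamma> J = (\<Sum>s\<le>k. if m \<le> s then ?g (s - m) (k - s) else 0)"
      unfolding wmul_nested by (intro sum.cong refl) (simp add: lambda_mult_def)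
    also have "\<dots> = (\<Sum>s\<in>{m..k}. ?g (s - m) (k - s))"
      by (rule sum.mono_neutral_cong_right) auto
    also have "\<dots> = (\<Sum>s\<le>k - m. ?g s (k - m - s))"
      by (rule sum.reindex_bij_witness[where i = "\<lambda>s. s + m" and j = "\<lambda>s. s - m"]) (use True in auto)
    finally show ?thesis using True by (simp add: lambda_mult_def wmul_nested)
  next
    case False
    then show ?thesis by (auto simp: lambda_mult_def wmul_nested intro!: sum.neutral)
  qed
qed

lemma wmul_lambda_mult_right: "wmul a (lambda_mult m b) = lambda_mult m (wmul a b)"
proof (intro ext)
  fix k \<gamma> J
  show "wmul a (lambda_mult m b) k \<gamma> J = lambda_mult m (wmul a b) k \<gamma> J"
  proof (cases "m \<le> k")
    case True
    let ?g = "\<lambda>s t. \<Sum>I\<in>Pow J. wedge_sign I (J - I) * (\<Sum>\<alpha> | \<alpha> \<subseteq># \<gamma>. a s \<alpha> I * b t (\<gamma> - \<alpha>) (J - I))"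
    have "wmul a (lambda_mult m b) k \<gamma> J = (\<Sum>s\<le>k. if m \<le> k - s then ?g s (k - s - m) else 0)"
      unfolding wmul_nested by (intro sum.cong refl) (simp add: lambda_mult_def)
    also have "\<dots> = (\<Sum>s\<le>k - m. ?g s (k - s - m))"
      by (rule sum.mono_neutral_cong_right) (use True in auto)
    finally show ?thesis using True by (simp add: lambda_mult_def wmul_nested add.commute)
  next
    case False
    then show ?thesis by (auto simp: lambda_mult_def wmul_nested intro!: sum.neutral)
  qed
qed

lemma moyal_term_lambda_mult_left: "moyal_term n m (lambda_mult l a) b = lambda_mult l (moyal_term n m a b)"
  by (induction m arbitrary: a b) (simp_all add: wmul_lambda_mult_left yder_lambda_mult lambda_mult_sum lambda_mult_scl)

lemma moyal_term_lambda_mult_right: "moyal_term n m a (lambda_mult l b) = lambda_mult l (moyal_term n m a b)"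
  by (induction m arbitrary: a b) (simp_all add: wmul_lambda_mult_right yder_lambda_mult lambda_mult_sum lambda_mult_scl)

text \<open>Order k of lambda sees no higher order of the factors, which permits replacing them by
  truncations.\<close>

lemma moyal_term_cong:
  assumes "\<And>s \<alpha> I. s \<le> k \<Longrightarrow> a s \<alpha> I = a' s \<alpha> I" and "\<And>s \<alpha> I. s \<le> k \<Longrightarrow> b s \<alpha> I = b' s \<alpha> I"
  shows "moyal_term n m a b k \<gamma> J = moyal_term n m a' b' k \<gamma> J"
  unfolding moyal_term_eq using assms by simp

text \<open>A fixed order of lambda meets only finitely many terms of the series. In this form they
  are a finite sum of forms, to which bilinearity applies.\<close>

lemma moyal_trunc:
  assumes "k \<le> M"
  shows "moyal n a b k \<gamma> J = (\<Sum>m\<le>M. scl ((- \<i>) ^ m) (lambda_mult m (moyal_term n m a b))) k \<gamma> J"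
proof -
  have "(\<Sum>m\<le>M. scl ((- \<i>) ^ m) (lambda_mult m (moyal_term n m a b))) k \<gamma> J =
      (\<Sum>m\<le>M. if m \<le> k then (- \<i>) ^ m * moyal_term n m a b (k - m) \<gamma> J else 0)"
    unfolding sum_wform_apply by (intro sum.cong refl) (simp add: scl_def lambda_mult_def)
  also have "\<dots> = (\<Sum>m\<le>k. (- \<i>) ^ m * moyal_term n m a b (k - m) \<gamma> J)"
    by (rule sum.mono_neutral_cong_right) (use assms in auto)
  finally show ?thesis by (simp add: moyal_eq)
qed

lemma moyal_assoc: "moyal n (moyal n a b) c = moyal n a (moyal n b c)"
proof (intro ext)
  fix k \<gamma> J
  \<comment> \<open>The truncation agrees with \<open>moyal n a b\<close> up to order k of lambda,
    and nothing else enters the coefficient at order k.\<close>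
  define P where "P a b = (\<Sum>l\<le>k. scl ((- \<i>) ^ l) (lambda_mult l (moyal_term n l a b)))" for a b
  \<comment> \<open>Terms are collected by m + l = N; those with m + l > k are divisible by too high
    a power of lambda to be seen at order k.\<close>
  have tri: "(\<Sum>m\<le>k. \<Sum>l\<le>k. scl ((- \<i>) ^ (m + l)) (lambda_mult (m + l) (F m l))) k \<gamma> J =
      (\<Sum>N\<le>k. (- \<i>) ^ N * (\<Sum>m\<le>N. F m (N - m)) (k - N) \<gamma> J)" for F
  proof -
    have "(\<Sum>m\<le>k. \<Sum>l\<le>k. scl ((- \<i>) ^ (m + l)) (lambda_mult (m + l) (F m l))) k \<gamma> J =
       (\<Sum>(m, l)\<in>{..k} \<times> {..k}. if m + l \<le> k then (- \<i>) ^ (m + l) * F m l (k - (m + l)) \<gamma> J else 0)"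
      unfolding sum_wform_apply sum.cartesian_product
      by (intro sum.cong refl) (auto simp: scl_def lambda_mult_def)
    also have "\<dots> = (\<Sum>(m, l)\<in>{(m, l). m + l \<le> k}. (- \<i>) ^ (m + l) * F m l (k - (m + l)) \<gamma> J)"
      by (rule sum.mono_neutral_cong_right) (auto split: if_splits)
    also have "\<dots> = (\<Sum>N\<le>k. \<Sum>m\<le>N. (- \<i>) ^ N * F m (N - m) (k - N) \<gamma> J)"
      unfolding sum.triangle_reindex_eq by (intro sum.cong refl) simp
    finally show ?thesis by (simp add: sum_wform_apply sum_distrib_left)
  qed
  have "moyal n (moyal n a b) c k \<gamma> J = (\<Sum>m\<le>k. (- \<i>) ^ m * moyal_term n m (P a b) c (k - m) \<gamma> J)"
    unfolding moyal_eq[of n "moyal n a b"] P_def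
    by (intro sum.cong refl arg_cong2[where f = "(*)"] moyal_term_cong moyal_trunc) auto
  also have "\<dots> = moyal n (P a b) c k \<gamma> J" by (simp add: moyal_eq)
  also have "\<dots> = (\<Sum>m\<le>k. \<Sum>l\<le>k. scl ((- \<i>) ^ (m + l)) (lambda_mult (m + l) (moyal_term n m (moyal_term n l a b) c))) k \<gamma> J"
    unfolding moyal_trunc[OF order_refl] unfolding P_def
    by (simp add: moyal_term_sum_left moyal_term_scl_left moyal_term_lambda_mult_left lambda_mult_sum lambda_mult_scl lambda_mult_lambda_mult scl_sum scl_scl power_add)
  also have "\<dots> = (\<Sum>N\<le>k. (- \<i>) ^ N * assoc_left n N a b c (k - N) \<gamma> J)"
    unfolding tri assoc_left_def ..
  also have "\<dots> = (\<Sum>N\<le>k. (- \<i>) ^ N * assoc_right n N a b c (k - N) \<gamma> J)"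
    unfolding assoc_left_eq_right ..
  also have "\<dots> = (\<Sum>m\<le>k. \<Sum>l\<le>k. scl ((- \<i>) ^ (m + l)) (lambda_mult (m + l) (moyal_term n m a (moyal_term n l b c)))) k \<gamma> J"
    unfolding tri assoc_right_def ..
  also have "\<dots> = moyal n a (P b c) k \<gamma> J"
    unfolding moyal_trunc[OF order_refl] unfolding P_def
    by (simp add: moyal_term_sum_right moyal_term_scl_right moyal_term_lambda_mult_right lambda_mult_sum lambda_mult_scl lambda_mult_lambda_mult scl_sum scl_scl power_add)
  also have "\<dots> = (\<Sum>m\<le>k. (- \<i>) ^ m * moyal_term n m a (P b c) (k - m) \<gamma> J)" by (simp add: moyal_eq)
  also have "\<dots> = moyal n a (moyal n b c) k \<gamma> J"
    unfolding moyal_eq[of n a "moyal n b c"] P_def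
    by (intro sum.cong refl arg_cong2[where f = "(*)"] moyal_term_cong moyal_trunc[symmetric]) auto
  finally show "moyal n (moyal n a b) c k \<gamma> J = moyal n a (moyal n b c) k \<gamma> J" .
qed

section \<open>Supercommutators, supports and the Fedosov degree\<close>

lemma scl_apply: "scl c b k \<alpha> J = c * b k \<alpha> J"
  by (simp add: scl_def)

lemma moyal_add_left: "moyal n (a + a') b = moyal n a b + moyal n a' b"
  by (intro ext) (simp add: moyal_eq moyal_term_add_left sum.distrib algebra_simps)

lemma moyal_add_right: "moyal n a (b + b') = moyal n a b + moyal n a b'"
  by (intro ext) (simp add: moyal_eq moyal_term_add_right sum.distrib algebra_simps)

lemma moyal_scl_left: "moyal n (scl c a) b = scl c (moyal n a b)"
  by (intro ext) (simp add: moyal_eq moyal_term_scl_left scl_apply sum_distrib_left mult_ac)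

lemma moyal_scl_right: "moyal n a (scl c b) = scl c (moyal n a b)"
  by (intro ext) (simp add: moyal_eq moyal_term_scl_right scl_apply sum_distrib_left mult_ac)

lemmas moyal_zero_left = additive_zero[of "\<lambda>a. moyal n a b" for n b, OF moyal_add_left]
lemmas moyal_zero_right = additive_zero[of "moyal n a" for n a, OF moyal_add_right]
lemmas moyal_minus_left = additive_minus[of "\<lambda>a. moyal n a b" for n b, OF moyal_add_left]
lemmas moyal_minus_right = additive_minus[of "moyal n a" for n a, OF moyal_add_right]
lemmas moyal_diff_left = additive_diff[of "\<lambda>a. moyal n a b" for n b, OF moyal_add_left]
lemmas moyal_diff_right = additive_diff[of "moyal n a" for n a, OF moyal_add_right]
lemmas moyal_sum_left = additive_sum[of "\<lambda>a. moyal n a b" for n b, OF moyal_add_left]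
lemmas moyal_sum_right = additive_sum[of "moyal n a" for n a, OF moyal_add_right]

lemma par_apply: "par b k \<alpha> J = (-1) ^ card J * b k \<alpha> J"
  by (simp add: par_def)

lemma moyal_par: "par (moyal n a b) = moyal n (par a) (par b)"
  by (intro ext) (simp add: moyal_eq par_moyal_term[symmetric] par_apply sum_distrib_left mult_ac)

lemma yder_moyal: "yder p (moyal n a b) = moyal n (yder p a) b + moyal n a (yder p b)"
proof (intro ext)
  fix k \<alpha> J
  have "yder p (moyal n a b) k \<alpha> J = (\<Sum>m\<le>k. (- \<i>) ^ m * yder p (moyal_term n m a b) (k - m) \<alpha> J)"
    by (simp add: yder_def moyal_eq sum_distrib_left mult_ac)
  then show "yder p (moyal n a b) k \<alpha> J = (moyal n (yder p a) b + moyal n a (yder p b)) k \<alpha> J"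
    by (simp add: yder_moyal_term moyal_eq sum.distrib distrib_left)
qed

lemma dxw_moyal: "dxw j (moyal n a b) = moyal n (dxw j a) b"
proof (intro ext)
  fix k \<alpha> J
  have "dxw j (moyal n a b) k \<alpha> J = (\<Sum>m\<le>k. (- \<i>) ^ m * dxw j (moyal_term n m a b) (k - m) \<alpha> J)"
    by (simp add: dxw_def moyal_eq sum_distrib_left mult_ac)
  then show "dxw j (moyal n a b) k \<alpha> J = moyal n (dxw j a) b k \<alpha> J"
    by (simp add: dxw_moyal_term moyal_eq)
qed

lemma moyal_dxw: "moyal n a (dxw j b) = dxw j (moyal n (par a) b)"
proof (intro ext)
  fix k \<alpha> J
  have "dxw j (moyal n (par a) b) k \<alpha> J = (\<Sum>m\<le>k. (- \<i>) ^ m * dxw j (moyal_term n m (par a) b) (k - m) \<alpha> J)"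
    by (simp add: dxw_def moyal_eq sum_distrib_left mult_ac)
  then show "moyal n a (dxw j b) k \<alpha> J = dxw j (moyal n (par a) b) k \<alpha> J"
    by (simp add: moyal_term_dxw moyal_eq)
qed

lemma i_over_lambda_add: "i_over_lambda (a + b) = i_over_lambda a + i_over_lambda b"
  and i_over_lambda_scl: "i_over_lambda (scl c a) = scl c (i_over_lambda a)"
  and i_over_lambda_par: "i_over_lambda (par a) = par (i_over_lambda a)"
  and i_over_lambda_dxw: "i_over_lambda (dxw j a) = dxw j (i_over_lambda a)"
  and i_over_lambda_yder: "i_over_lambda (yder j a) = yder j (i_over_lambda a)"
  and i_over_lambda_lambda_mult: "i_over_lambda (lambda_mult 1 a) = scl \<i> a"
  by (auto simp: i_over_lambda_def scl_def par_def dxw_def yder_def lambda_mult_def fun_eq_iff algebra_simps)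

lemmas i_over_lambda_zero = additive_zero[of i_over_lambda, OF i_over_lambda_add]
lemmas i_over_lambda_diff = additive_diff[of i_over_lambda, OF i_over_lambda_add]
lemmas i_over_lambda_sum = additive_sum[of i_over_lambda, OF i_over_lambda_add]

lemma moyal_lambda_mult_left: "moyal n (lambda_mult l a) b = lambda_mult l (moyal n a b)"
proof (intro ext)
  fix k \<alpha> J
  have "moyal n (lambda_mult l a) b k \<alpha> J = (\<Sum>m\<le>k. scl ((- \<i>) ^ m) (lambda_mult m (lambda_mult l (moyal_term n m a b)))) k \<alpha> J"
    by (simp add: moyal_trunc[OF order_refl] moyal_term_lambda_mult_left)
  also have "\<dots> = lambda_mult l (\<Sum>m\<le>k. scl ((- \<i>) ^ m) (lambda_mult m (moyal_term n m a b))) k \<alpha> J"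
    by (simp add: lambda_mult_sum lambda_mult_scl lambda_mult_lambda_mult add.commute)
  also have "\<dots> = lambda_mult l (moyal n a b) k \<alpha> J"
    by (cases "l \<le> k") (simp_all add: lambda_mult_def[of l] moyal_trunc[of "k - l" k])
  finally show "moyal n (lambda_mult l a) b k \<alpha> J = lambda_mult l (moyal n a b) k \<alpha> J" .
qed

lemma moyal_lambda_mult_right: "moyal n a (lambda_mult l b) = lambda_mult l (moyal n a b)"
proof (intro ext)
  fix k \<alpha> J
  have "moyal n a (lambda_mult l b) k \<alpha> J = (\<Sum>m\<le>k. scl ((- \<i>) ^ m) (lambda_mult m (lambda_mult l (moyal_term n m a b)))) k \<alpha> J"
    by (simp add: moyal_trunc[OF order_refl] moyal_term_lambda_mult_right)
  also have "\<dots> = lambda_mult l (\<Sum>m\<le>k. scl ((- \<i>) ^ m) (lambda_mult m (moyal_term n m a b))) k \<alpha> J"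
    by (simp add: lambda_mult_sum lambda_mult_scl lambda_mult_lambda_mult add.commute)
  also have "\<dots> = lambda_mult l (moyal n a b) k \<alpha> J"
    by (cases "l \<le> k") (simp_all add: lambda_mult_def[of l] moyal_trunc[of "k - l" k])
  finally show "moyal n a (lambda_mult l b) k \<alpha> J = lambda_mult l (moyal n a b) k \<alpha> J" .
qed

lemma lambda_mult_factor:
  assumes "c 0 = 0"
  shows "c = lambda_mult 1 (\<lambda>k. c (Suc k))"
proof
  fix k
  show "c k = lambda_mult 1 (\<lambda>k. c (Suc k)) k" using assms by (cases k) (simp_all add: lambda_mult_def zero_fun_def)
qed

text \<open>A form starting at order 1 is lambda times some d, on which i/lambda acts as
  multiplication of d by the scalar i. An order-0 part of c would be lost by the shift but would
  contribute to the product.\<close>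

lemma i_over_lambda_moyal_left:
  assumes "c 0 = 0"
  shows "moyal n (i_over_lambda c) b = i_over_lambda (moyal n c b)"
proof -
  obtain d where c: "c = lambda_mult 1 d" using lambda_mult_factor[of c, OF assms] by blast
  show ?thesis unfolding c by (simp only: moyal_lambda_mult_left i_over_lambda_lambda_mult moyal_scl_left)
qed

lemma i_over_lambda_moyal_right:
  assumes "c 0 = 0"
  shows "moyal n a (i_over_lambda c) = i_over_lambda (moyal n a c)"
proof -
  obtain d where c: "c = lambda_mult 1 d" using lambda_mult_factor[of c, OF assms] by blast
  show ?thesis unfolding c by (simp only: moyal_lambda_mult_right i_over_lambda_lambda_mult moyal_scl_right)
qed

text \<open>This is the graded commutator only if \<open>s\<close> is odd.\<close>

definition supercomm :: "nat \<Rightarrow> wform \<Rightarrow> wform \<Rightarrow> wform" where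
  "supercomm n s b = moyal n s b - moyal n (par b) s"

lemma moyal_order_zero: "moyal n a b 0 = wmul a b 0"
  by (intro ext) (simp add: moyal_eq)

text \<open>At order 0 of lambda the product is \<open>wmul\<close>, which is graded
  commutative.\<close>

lemma supercomm_order_zero: "par s = - s \<Longrightarrow> supercomm n s b 0 = 0"
  using wmul_comm_odd[of s b] by (simp only: supercomm_def fun_diff_def moyal_order_zero) (simp add: zero_fun_def)

text \<open>Under \<open>wmul\<close> an odd form anticommutes with itself, so its square equals its
  own negative.\<close>

lemma moyal_square_order_zero: "par s = - s \<Longrightarrow> moyal n s s 0 = 0"
proof -
  assume s: "par s = - s"
  have "wmul s s = - wmul s s"
    using wmul_comm_odd[OF s, of s] additive_minus[of "\<lambda>a. wmul a s", OF wmul_add_left] s by simp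
  then have "wmul s s 0 \<alpha> J = 0" for \<alpha> J
    using arg_cong[of _ _ "\<lambda>f. f 0 \<alpha> J", OF \<open>wmul s s = - wmul s s\<close>] by simp
  then show ?thesis by (intro ext) (simp add: moyal_order_zero)
qed

text \<open>Jacobi identity [s,[s,b]] = [s^2,b] for odd s: by associativity the two terms with
  \<open>par b\<close> between the factors s cancel. Moving i/lambda out of the products uses that
  bracket and square vanish at order 0.\<close>

lemma supercomm_supercomm:
  assumes "par s = - s"
  shows "supercomm n s (i_over_lambda (supercomm n s b)) =
    moyal n (i_over_lambda (moyal n s s)) b - moyal n b (i_over_lambda (moyal n s s))"
proof -
  have 0: "supercomm n s b 0 = 0" "par (supercomm n s b) 0 = 0"
    using supercomm_order_zero[OF assms, of n b] by (simp_all add: par_def zero_fun_def)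
  have "supercomm n s (i_over_lambda (supercomm n s b)) =
      i_over_lambda (moyal n s (supercomm n s b) - moyal n (par (supercomm n s b)) s)"
    unfolding supercomm_def[of n s "i_over_lambda _"] i_over_lambda_par[symmetric]
      i_over_lambda_moyal_right[of "supercomm n s b", OF 0(1)] i_over_lambda_moyal_left[of "par (supercomm n s b)", OF 0(2)] i_over_lambda_diff ..
  also have "moyal n s (supercomm n s b) - moyal n (par (supercomm n s b)) s =
      moyal n (moyal n s s) b - moyal n b (moyal n s s)"
    unfolding supercomm_def par_diff moyal_par par_par assms moyal_minus_left moyal_minus_right moyal_diff_left moyal_diff_right moyal_assoc
    by simp
  finally show ?thesis
    unfolding i_over_lambda_diff i_over_lambda_moyal_right[of "moyal n s s", OF moyal_square_order_zero[OF assms]]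
     i_over_lambda_moyal_left[of "moyal n s s", OF moyal_square_order_zero[OF assms]] .
qed

text \<open>Forms are functions on all indices; this confines them to the generators with index
  below d. In particular only finite \<open>J\<close> occur, where \<open>card\<close> obeys the
  expected rules.\<close>

definition supported :: "nat \<Rightarrow> wform \<Rightarrow> bool" where
  "supported d a \<longleftrightarrow> (\<forall>k \<alpha> J. a k \<alpha> J \<noteq> 0 \<longrightarrow> set_mset \<alpha> \<subseteq> {..<d} \<and> J \<subseteq> {..<d})"

lemma supported_finite: "supported d a \<Longrightarrow> infinite J \<Longrightarrow> a k \<alpha> J = 0"
  unfolding supported_def using finite_subset[OF _ finite_lessThan] by blast

lemma supported_zero: "supported d 0"
  and supported_add: "supported d a \<Longrightarrow> supported d b \<Longrightarrow> supported d (a + b)"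
  and supported_minus: "supported d a \<Longrightarrow> supported d (- a)"
  and supported_diff: "supported d a \<Longrightarrow> supported d b \<Longrightarrow> supported d (a - b)"
  and supported_scl: "supported d a \<Longrightarrow> supported d (scl c a)"
  and supported_par: "supported d a \<Longrightarrow> supported d (par a)"
  and supported_i_over_lambda: "supported d a \<Longrightarrow> supported d (i_over_lambda a)"
  and supported_wone: "supported d wone"
  unfolding supported_def scl_def par_def i_over_lambda_def wone_def
  by (simp_all, (metis add.right_neutral add_0 diff_zero diff_0_right)+)

lemma supported_sum: "(\<And>i. i \<in> S \<Longrightarrow> supported d (f i)) \<Longrightarrow> supported d (sum f S)"
  by (induction S rule: infinite_finite_induct) (auto intro: supported_zero supported_add)

lemma supported_yder: "supported d a \<Longrightarrow> supported d (yder j a)"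
  by (fastforce simp: supported_def yder_def)

lemma supported_dxw: "supported d a \<Longrightarrow> j < d \<Longrightarrow> supported d (dxw j a)"
  by (fastforce simp: supported_def dxw_def split: if_splits)

lemma supported_ymul:
  assumes "supported d a" "j < d" shows "supported d (ymul j a)"
  unfolding supported_def
proof (intro allI impI)
  fix k \<alpha> J assume "ymul j a k \<alpha> J \<noteq> 0"
  then have *: "j \<in># \<alpha>" "a k (\<alpha> - {#j#}) J \<noteq> 0" by (auto simp: ymul_def split: if_splits)
  then have "set_mset (\<alpha> - {#j#}) \<subseteq> {..<d}" "J \<subseteq> {..<d}" using assms by (auto simp: supported_def)
  moreover have "set_mset \<alpha> = insert j (set_mset (\<alpha> - {#j#}))" using *(1) by (metis insert_DiffM set_mset_add_mset_insert)
  ultimately show "set_mset \<alpha> \<subseteq> {..<d} \<and> J \<subseteq> {..<d}" using assms by auto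
qed

lemma wmul_nonzero:
  assumes "wmul a b k \<gamma> J \<noteq> 0"
  obtains s \<alpha> I where "s \<le> k" "\<alpha> \<subseteq># \<gamma>" "I \<subseteq> J" "a s \<alpha> I \<noteq> 0" "b (k - s) (\<gamma> - \<alpha>) (J - I) \<noteq> 0"
proof -
  obtain x where "x \<in> wdec (k, \<gamma>, J)" "wsgn x (wminus (k, \<gamma>, J) x) * (wcoeff a x * wcoeff b (wminus (k, \<gamma>, J) x)) \<noteq> 0"
    using assms unfolding wmul_def by (rule sum.not_neutral_contains_not_neutral)
  then show thesis using that by (auto simp: wdec_def wcoeff_def wminus_def)
qed

lemma supported_wmul:
  assumes "supported d a" "supported d b" shows "supported d (wmul a b)"
  unfolding supported_def
proof (intro allI impI)
  fix k \<gamma> J assume "wmul a b k \<gamma> J \<noteq> 0"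
  then obtain s \<alpha> I where *: "\<alpha> \<subseteq># \<gamma>" "I \<subseteq> J" "a s \<alpha> I \<noteq> 0" "b (k - s) (\<gamma> - \<alpha>) (J - I) \<noteq> 0"
    by (rule wmul_nonzero)
  have "set_mset \<alpha> \<subseteq> {..<d}" "I \<subseteq> {..<d}" "set_mset (\<gamma> - \<alpha>) \<subseteq> {..<d}" "J - I \<subseteq> {..<d}"
    using assms *(3,4) by (auto simp: supported_def)
  moreover have "set_mset \<gamma> = set_mset \<alpha> \<union> set_mset (\<gamma> - \<alpha>)"
    using *(1) by (metis set_mset_union subset_mset.add_diff_inverse)
  ultimately show "set_mset \<gamma> \<subseteq> {..<d} \<and> J \<subseteq> {..<d}" by auto
qed

lemma supported_moyal_term: "supported d a \<Longrightarrow> supported d b \<Longrightarrow> supported d (moyal_term n m a b)"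
  by (induction m arbitrary: a b) (auto intro!: supported_wmul supported_sum supported_scl supported_yder)

lemma moyal_nonzero:
  assumes "moyal n a b k \<gamma> J \<noteq> 0"
  obtains m where "m \<le> k" "moyal_term n m a b (k - m) \<gamma> J \<noteq> 0"
proof -
  obtain m where "m \<in> {..k}" "(- \<i>) ^ m * moyal_term n m a b (k - m) \<gamma> J \<noteq> 0"
    using assms unfolding moyal_eq by (rule sum.not_neutral_contains_not_neutral)
  then show thesis using that by auto
qed

lemma supported_moyal:
  assumes "supported d a" "supported d b" shows "supported d (moyal n a b)"
  unfolding supported_def
  using supported_moyal_term[OF assms, of n] by (metis moyal_nonzero supported_def)

text \<open>The bound is an integer because \<open>i_over_lambda\<close> and \<open>yder\<close>
  lower it, possibly below 0.\<close>

definition fedosov_ge :: "int \<Rightarrow> wform \<Rightarrow> bool" where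
  "fedosov_ge q a \<longleftrightarrow> (\<forall>k \<alpha> J. a k \<alpha> J \<noteq> 0 \<longrightarrow> q \<le> int (size \<alpha>) + 2 * int k)"

lemma fedosov_ge_zero: "fedosov_ge q 0"
  and fedosov_ge_add: "fedosov_ge q a \<Longrightarrow> fedosov_ge q b \<Longrightarrow> fedosov_ge q (a + b)"
  and fedosov_ge_diff: "fedosov_ge q a \<Longrightarrow> fedosov_ge q b \<Longrightarrow> fedosov_ge q (a - b)"
  and fedosov_ge_scl: "fedosov_ge q a \<Longrightarrow> fedosov_ge q (scl c a)"
  unfolding fedosov_ge_def scl_def
  by (simp_all, (metis add.right_neutral add_0 diff_zero diff_0_right)+)

lemma fedosov_ge_sum: "(\<And>i. i \<in> S \<Longrightarrow> fedosov_ge q (f i)) \<Longrightarrow> fedosov_ge q (sum f S)"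
  by (induction S rule: infinite_finite_induct) (auto intro: fedosov_ge_zero fedosov_ge_add)

lemma fedosov_ge_i_over_lambda: "fedosov_ge q a \<Longrightarrow> fedosov_ge (q - 2) (i_over_lambda a)"
  by (fastforce simp: fedosov_ge_def i_over_lambda_def)

lemma fedosov_ge_yder: "fedosov_ge q a \<Longrightarrow> fedosov_ge (q - 1) (yder j a)"
  by (fastforce simp: fedosov_ge_def yder_def)

lemma fedosov_ge_ymul: "fedosov_ge q a \<Longrightarrow> fedosov_ge (q + 1) (ymul j a)"
  unfolding fedosov_ge_def
proof (intro allI impI)
  fix k \<alpha> J assume "\<forall>k \<alpha> J. a k \<alpha> J \<noteq> 0 \<longrightarrow> q \<le> int (size \<alpha>) + 2 * int k" "ymul j a k \<alpha> J \<noteq> 0"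
  then have "j \<in># \<alpha>" "q \<le> int (size (\<alpha> - {#j#})) + 2 * int k" by (auto simp: ymul_def split: if_splits)
  then show "q + 1 \<le> int (size \<alpha>) + 2 * int k" using size_Diff_singleton[of j \<alpha>] size_Suc_Diff1[of j \<alpha>] by simp
qed

lemma fedosov_ge_contr: "fedosov_ge q a \<Longrightarrow> fedosov_ge q (contr j a)"
  by (fastforce simp: fedosov_ge_def contr_def split: if_splits)

lemma fedosov_ge_dxw: "fedosov_ge q a \<Longrightarrow> fedosov_ge q (dxw j a)"
  by (fastforce simp: fedosov_ge_def dxw_def split: if_splits)

lemma fedosov_ge_wmul:
  assumes "fedosov_ge p a" "fedosov_ge q b" shows "fedosov_ge (p + q) (wmul a b)"
  unfolding fedosov_ge_def
proof (intro allI impI)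
  fix k \<gamma> J assume "wmul a b k \<gamma> J \<noteq> 0"
  then obtain s \<alpha> I where *: "s \<le> k" "\<alpha> \<subseteq># \<gamma>" "I \<subseteq> J" "a s \<alpha> I \<noteq> 0" "b (k - s) (\<gamma> - \<alpha>) (J - I) \<noteq> 0"
    by (rule wmul_nonzero)
  then have "p \<le> int (size \<alpha>) + 2 * int s" "q \<le> int (size (\<gamma> - \<alpha>)) + 2 * int (k - s)"
    using assms unfolding fedosov_ge_def by blast+
  moreover have "size \<gamma> = size \<alpha> + size (\<gamma> - \<alpha>)" using *(2) by (metis size_union subset_mset.add_diff_inverse)
  ultimately show "p + q \<le> int (size \<gamma>) + 2 * int k" using *(1) by (simp add: of_nat_diff)
qed

text \<open>Every contraction differentiates both factors and so removes two variables y.\<close>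

lemma fedosov_ge_moyal_term: "fedosov_ge p a \<Longrightarrow> fedosov_ge q b \<Longrightarrow> fedosov_ge (p + q - 2 * int m) (moyal_term n m a b)"
proof (induction m arbitrary: a b p q)
  case 0
  then show ?case by (simp add: fedosov_ge_wmul)
next
  case (Suc m)
  have "fedosov_ge (p + q - 2 * int (Suc m)) (moyal_term n m (yder i a) (yder j b))" for i j
    using Suc.IH[OF fedosov_ge_yder[OF Suc.prems(1), of i] fedosov_ge_yder[OF Suc.prems(2), of j]]
    by (simp add: algebra_simps)
  then show ?case by (simp only: moyal_term.simps) (intro fedosov_ge_sum fedosov_ge_scl)
qed

text \<open>The loss of 2m through m contractions is made up by the accompanying power m of lambda,
  which has weight 2.\<close>

lemma fedosov_ge_moyal:
  assumes "fedosov_ge p a" "fedosov_ge q b" shows "fedosov_ge (p + q) (moyal n a b)"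
  unfolding fedosov_ge_def
proof (intro allI impI)
  fix k \<gamma> J assume "moyal n a b k \<gamma> J \<noteq> 0"
  then obtain m where "m \<le> k" "moyal_term n m a b (k - m) \<gamma> J \<noteq> 0" by (rule moyal_nonzero)
  then show "p + q \<le> int (size \<gamma>) + 2 * int k"
    using fedosov_ge_moyal_term[OF assms, of m n] by (fastforce simp: fedosov_ge_def of_nat_diff)
qed

section \<open>The homotopy operator\<close>

lemma delta_add: "delta n (a + b) = delta n a + delta n b"
  by (simp only: delta_def yder_add dxw_add sum.distrib)

lemma delta_star_add: "delta_star n (a + b) = delta_star n a + delta_star n b"
proof -
  have "contr i (a + b) = contr i a + contr i b" for i
    by (auto simp: contr_def fun_eq_iff algebra_simps)
  then show ?thesis by (simp only: delta_star_def ymul_add sum.distrib)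
qed

lemmas delta_diff = additive_diff[of "delta n" for n, OF delta_add]
text \<open>The division by the total degree inside \<open>delta_minus\<close>. It is split off
  because \<open>delta\<close> and \<open>delta_star\<close> preserve the total degree and hence
  commute with it.\<close>

definition total_inv :: "wform \<Rightarrow> wform" where
  "total_inv b = (\<lambda>k \<alpha> J. if size \<alpha> + card J > 0 then b k \<alpha> J / of_nat (size \<alpha> + card J) else 0)"

lemma delta_minus_eq: "delta_minus n b = delta_star n (total_inv b)"
  by (simp add: delta_minus_def total_inv_def)

lemma total_inv_add: "total_inv (a + b) = total_inv a + total_inv b"
  by (auto simp: total_inv_def fun_eq_iff add_divide_distrib)

lemma delta_minus_add: "delta_minus n (a + b) = delta_minus n a + delta_minus n b"
  by (simp only: delta_minus_eq total_inv_add delta_star_add)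

lemmas delta_minus_diff = additive_diff[of "delta_minus n" for n, OF delta_minus_add]

lemma supported_total_inv: "supported d b \<Longrightarrow> supported d (total_inv b)"
  unfolding supported_def total_inv_def by (metis div_0)

lemma supported_delta: "supported (2*n) b \<Longrightarrow> supported (2*n) (delta n b)"
  unfolding delta_def by (intro supported_sum supported_dxw supported_yder) auto

section \<open>Commutation relations of the generators\<close>

lemma card_less_insert:
  "l \<notin> J \<Longrightarrow> card {x \<in> insert l J. x < (i::nat)} = card {x \<in> J. x < i} + (if l < i then 1 else 0)"
proof -
  assume l: "l \<notin> J"
  have fin: "finite {x \<in> J. x < i}" by (rule finite_subset[of _ "{..<i}"]) auto
  have "{x \<in> insert l J. x < i} = (if l < i then insert l {x \<in> J. x < i} else {x \<in> J. x < i})" by auto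
  then show ?thesis using l fin by simp
qed

text \<open>For distinct i and j exactly one of i < j and j < i holds, so one of the two orders
  counts one more smaller index than the other.\<close>

lemma dxw_anticommute: "dxw i (dxw j b) = - dxw j (dxw i b)"
proof (intro ext)
  fix k \<alpha> J
  show "dxw i (dxw j b) k \<alpha> J = (- dxw j (dxw i b)) k \<alpha> J"
  proof (cases "i \<in> J \<and> j \<in> J \<and> i \<noteq> j")
    case True
    define K where "K = J - {i, j}"
    have K: "J = insert i (insert j K)" "i \<notin> K" "j \<notin> K" "i \<noteq> j"
      using True by (auto simp: K_def)
    have J: "J - {i} = insert j K" "J - {j} = insert i K" "insert j K - {j} = K" "insert i K - {i} = K" using K by auto
    have "(-1) ^ card {x \<in> insert i (insert j K). x < i} * ((-1) ^ card {x \<in> insert j K. x < j} * b k \<alpha> K) =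
       - ((-1) ^ card {x \<in> insert i (insert j K). x < j} * ((-1) ^ card {x \<in> insert i K. x < i} * b k \<alpha> K))"
    proof -
      have ij: "i \<notin> insert j K" using K by simp
      show ?thesis
        unfolding card_less_insert[OF ij] card_less_insert[OF K(2)] card_less_insert[OF K(3)]
        using K(4) by (cases "i < j") simp_all
    qed
    moreover have "dxw i (dxw j b) k \<alpha> J = (-1) ^ card {x \<in> insert i (insert j K). x < i} * ((-1) ^ card {x \<in> insert j K. x < j} * b k \<alpha> K)"
      using True unfolding dxw_def J by (simp only: J K(1)) simp
    moreover have "dxw j (dxw i b) k \<alpha> J = (-1) ^ card {x \<in> insert i (insert j K). x < j} * ((-1) ^ card {x \<in> insert i K. x < i} * b k \<alpha> K)"
      using True unfolding dxw_def J by (simp only: J K(1)) simp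
    ultimately show ?thesis by simp
  next
    case False
    then show ?thesis by (auto simp: dxw_def)
  qed
qed

lemma contr_anticommute: "contr i (contr j b) = - contr j (contr i b)"
proof (intro ext)
  fix k \<alpha> J
  show "contr i (contr j b) k \<alpha> J = (- contr j (contr i b)) k \<alpha> J"
  proof (cases "i \<notin> J \<and> j \<notin> J \<and> i \<noteq> j")
    case True
    have "(-1) ^ card {x \<in> J. x < i} * ((-1) ^ card {x \<in> insert i J. x < j} * b k \<alpha> (insert j (insert i J))) =
       - ((-1) ^ card {x \<in> J. x < j} * ((-1) ^ card {x \<in> insert j J. x < i} * b k \<alpha> (insert i (insert j J))))"
      unfolding card_less_insert[OF conjunct1[OF True]] card_less_insert[OF conjunct1[OF conjunct2[OF True]]]
      using True by (cases "i < j") (simp_all add: insert_commute[of i j])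
    then show ?thesis using True by (simp add: contr_def)
  next
    case False
    then show ?thesis by (auto simp: contr_def)
  qed
qed

text \<open>Canonical anticommutation relation. For i distinct from l the exponents of the two
  composites differ by the indicators of i < l and l < i, which add up to 1.\<close>

lemma contr_dxw: "contr l (dxw i b) = (if i = l then b else 0) - dxw i (contr l b)"
proof (intro ext)
  fix k \<alpha> J
  show "contr l (dxw i b) k \<alpha> J = ((if i = l then b else 0) - dxw i (contr l b)) k \<alpha> J"
  proof (cases "i = l")
    case True
    have 1: "{x \<in> J - {l}. x < l} = {x \<in> J. x < l}" "{x \<in> insert l J. x < l} = {x \<in> J. x < l}" by auto
    show ?thesis
    proof (cases "l \<in> J")
      case True
      then have "insert l (J - {l}) = J" by auto
      then have "dxw l (contr l b) k \<alpha> J = b k \<alpha> J" using True unfolding dxw_def contr_def 1 by simp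
      moreover have "contr l (dxw l b) k \<alpha> J = 0" using True by (simp add: contr_def)
      ultimately show ?thesis unfolding \<open>i = l\<close> by simp
    next
      case False
      then have "insert l J - {l} = J" by auto
      then have "contr l (dxw l b) k \<alpha> J = b k \<alpha> J" using False unfolding dxw_def contr_def 1 by simp
      moreover have "dxw l (contr l b) k \<alpha> J = 0" using False by (simp add: dxw_def)
      ultimately show ?thesis unfolding \<open>i = l\<close> by simp
    qed
  next
    case False
    show ?thesis
    proof (cases "l \<notin> J \<and> i \<in> J")
      case True
      define K where "K = J - {i}"
      have K: "J = insert i K" "i \<notin> K" using True by (auto simp: K_def)
      have l: "l \<notin> K" using True K by auto
      have J: "insert l J - {i} = insert l K" "J - {i} = K" using K False by auto
      have "(-1) ^ card {x \<in> insert i K. x < l} * ((-1) ^ card {x \<in> insert l (insert i K). x < i} * b k \<alpha> (insert l K)) =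
         - ((-1) ^ card {x \<in> insert i K. x < i} * ((-1) ^ card {x \<in> K. x < l} * b k \<alpha> (insert l K)))"
      proof -
        have li: "l \<notin> insert i K" using l False by simp
        show ?thesis
          unfolding card_less_insert[OF li] card_less_insert[OF K(2)] card_less_insert[OF l]
          using False by (cases "i < l") simp_all
      qed
      moreover have "contr l (dxw i b) k \<alpha> J =
          (-1) ^ card {x \<in> insert i K. x < l} * ((-1) ^ card {x \<in> insert l (insert i K). x < i} * b k \<alpha> (insert l K))"
        using True unfolding contr_def dxw_def J by (simp add: K(1))
      moreover have "dxw i (contr l b) k \<alpha> J = (-1) ^ card {x \<in> insert i K. x < i} * ((-1) ^ card {x \<in> K. x < l} * b k \<alpha> (insert l K))"
        using True l unfolding contr_def dxw_def J by (simp add: K(1))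
      ultimately show ?thesis using False by simp
    next
      case F2: False
      then show ?thesis using False by (cases "l \<in> J") (simp_all add: dxw_def contr_def)
    qed
  qed
qed

lemma yder_ymul: "yder i (ymul l b) = ymul l (yder i b) + (if i = l then b else 0)"
proof (intro ext)
  fix k \<alpha> J
  show "yder i (ymul l b) k \<alpha> J = (ymul l (yder i b) + (if i = l then b else 0)) k \<alpha> J"
  proof (cases "l \<in># \<alpha>")
    case True
    then obtain \<beta> where \<beta>: "\<alpha> = add_mset l \<beta>" by (metis insert_DiffM)
    show ?thesis
      by (cases "i = l") (simp_all add: yder_def ymul_def \<beta> add_mset_commute[of i l] algebra_simps)
  next
    case False
    then have "count \<alpha> l = 0" by (simp add: not_in_iff)
    with False show ?thesis by (cases "i = l") (simp_all add: yder_def ymul_def)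
  qed
qed

lemma contr_yder: "contr l (yder i b) = yder i (contr l b)"
  and contr_ymul: "contr l (ymul i b) = ymul i (contr l b)"
  by (auto simp: yder_def ymul_def contr_def fun_eq_iff)

lemma ymul_commute: "ymul i (ymul j b) = ymul j (ymul i b)"
proof (intro ext)
  fix k \<alpha> J
  have "j \<in># \<alpha> - {#i#} \<longleftrightarrow> i \<in># \<alpha> - {#j#}" if "i \<in># \<alpha>" "j \<in># \<alpha>"
    using that by (cases "i = j") (auto simp flip: count_greater_zero_iff)
  then show "ymul i (ymul j b) k \<alpha> J = ymul j (ymul i b) k \<alpha> J"
    by (auto simp: ymul_def add_mset_commute[of i j] dest: in_diffD)
qed

lemma antisym_sum_zero:
  fixes f :: "nat \<Rightarrow> nat \<Rightarrow> wform"
  assumes "\<And>i j. i \<in> S \<Longrightarrow> j \<in> S \<Longrightarrow> f i j = - f j i"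
  shows "(\<Sum>i\<in>S. \<Sum>j\<in>S. f i j) = 0"
proof -
  have "(\<Sum>i\<in>S. \<Sum>j\<in>S. f i j) = (\<Sum>i\<in>S. \<Sum>j\<in>S. - f j i)"
    by (intro sum.cong refl assms)
  also have "\<dots> = - (\<Sum>i\<in>S. \<Sum>j\<in>S. f i j)" unfolding sum_negf by (subst sum.swap) (rule refl)
  finally have *: "(\<Sum>i\<in>S. \<Sum>j\<in>S. f i j) = - (\<Sum>i\<in>S. \<Sum>j\<in>S. f i j)" .
  show ?thesis
  proof (intro ext)
    fix k \<alpha> J
    show "(\<Sum>i\<in>S. \<Sum>j\<in>S. f i j) k \<alpha> J = 0 k \<alpha> J" using arg_cong[OF *, of "\<lambda>f. f k \<alpha> J"] by simp
  qed
qed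

lemma contr_sum: "contr i (sum f S) = (\<Sum>j\<in>S. contr i (f j))"
  by (rule additive_sum) (auto simp: contr_def fun_eq_iff algebra_simps)

lemmas ymul_minus = additive_minus[of "ymul j" for j, OF ymul_add]
lemmas ymul_diff = additive_diff[of "ymul j" for j, OF ymul_add]

text \<open>The multiplications by y commute while the contractions anticommute.\<close>

lemma delta_star_delta_star: "delta_star n (delta_star n b) = 0"
  unfolding delta_star_def contr_sum contr_ymul ymul_sum
proof (rule antisym_sum_zero)
  fix i j
  show "ymul i (ymul j (contr i (contr j b))) = - ymul j (ymul i (contr j (contr i b)))"
    unfolding ymul_commute[of i j] contr_anticommute[of i j] ymul_minus ..
qed

text \<open>The mixed terms of the two composites cancel. What remains are the number operators: the
  sum of the y_l d/dy_l counts the factors y, the sum of dx_i times contraction counts the factors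
  dx. The support guarantees that the indices below 2n account for all factors.\<close>

lemma delta_star_delta:
  assumes "supported (2*n) b"
  shows "(delta_star n (delta n b) + delta n (delta_star n b)) k \<alpha> J = of_nat (size \<alpha> + card J) * b k \<alpha> J"
proof -
  have "delta_star n (delta n b) = (\<Sum>l<2*n. \<Sum>i<2*n.
      (if i = l then ymul l (yder l b) else 0) - ymul l (dxw i (yder i (contr l b))))"
    unfolding delta_star_def delta_def contr_sum ymul_sum contr_dxw ymul_diff contr_yder
    by (intro sum.cong refl) (simp add: ymul_zero)
  also have "\<dots> = (\<Sum>l<2*n. ymul l (yder l b)) - (\<Sum>l<2*n. \<Sum>i<2*n. ymul l (dxw i (yder i (contr l b))))"
    by (simp add: sum_subtractf)
  finally have 1: "delta_star n (delta n b) = \<dots>" .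
  have "delta n (delta_star n b) = (\<Sum>i<2*n. \<Sum>l<2*n.
      ymul l (dxw i (yder i (contr l b))) + (if i = l then dxw i (contr i b) else 0))"
    unfolding delta_star_def delta_def yder_sum dxw_sum yder_ymul dxw_add ymul_dxw
    by (intro sum.cong refl) (simp add: dxw_zero)
  also have "\<dots> = (\<Sum>i<2*n. \<Sum>l<2*n. ymul l (dxw i (yder i (contr l b)))) + (\<Sum>i<2*n. dxw i (contr i b))"
    by (simp add: sum.distrib)
  finally have 2: "delta n (delta_star n b) = \<dots>" .
  have 3: "delta_star n (delta n b) + delta n (delta_star n b) = (\<Sum>l<2*n. ymul l (yder l b)) + (\<Sum>i<2*n. dxw i (contr i b))"
    unfolding 1 2 by (subst sum.swap[of _ _ "{..<2*n}"]) simp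
  have y: "ymul l (yder l b) k \<alpha> J = of_nat (count \<alpha> l) * b k \<alpha> J" for l
  proof (cases "l \<in># \<alpha>")
    case True
    then obtain \<beta> where \<beta>: "\<alpha> = add_mset l \<beta>" by (metis insert_DiffM)
    show ?thesis by (simp add: ymul_def yder_def \<beta>)
  next
    case False
    then have "count \<alpha> l = 0" by (simp add: not_in_iff)
    with False show ?thesis by (simp add: ymul_def)
  qed
  have x: "dxw i (contr i b) k \<alpha> J = of_nat (if i \<in> J then 1 else 0) * b k \<alpha> J" for i
  proof (cases "i \<in> J")
    case True
    have "insert i (J - {i}) = J" using True by auto
    moreover have "{x \<in> J - {i}. x < i} = {x \<in> J. x < i}" by auto
    ultimately show ?thesis using True by (simp only: dxw_def contr_def) simp
  qed (simp add: dxw_def)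
  show ?thesis
  proof (cases "b k \<alpha> J = 0")
    case True
    then show ?thesis unfolding 3 by (simp add: sum_wform_apply x y)
  next
    case False
    then have s: "set_mset \<alpha> \<subseteq> {..<2*n}" "J \<subseteq> {..<2*n}" using assms by (auto simp: supported_def)
    have "(\<Sum>l<2*n. count \<alpha> l) = size \<alpha>"
      unfolding size_multiset_overloaded_eq by (rule sum.mono_neutral_right) (use s in \<open>auto simp: not_in_iff\<close>)
    moreover have "(\<Sum>i<2*n. if i \<in> J then 1 else 0 :: nat) = card J"
      using s by (simp add: sum.If_cases Int_absorb1)
    ultimately show ?thesis unfolding 3 plus_fun_apply sum_wform_apply x y
      by (simp only: sum_distrib_right[symmetric] of_nat_sum[symmetric] of_nat_add distrib_right)
  qed
qed

lemma total_inv_delta: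
  assumes "supported (2*n) b"
  shows "total_inv (delta n b) = delta n (total_inv b)"
proof -
  have "total_inv (dxw i (yder i b)) = dxw i (yder i (total_inv b))" for i
  proof (intro ext)
    fix k \<alpha> J
    show "total_inv (dxw i (yder i b)) k \<alpha> J = dxw i (yder i (total_inv b)) k \<alpha> J"
    \<comment> \<open>For finite \<open>J\<close> the removed index i and the additional y_i balance
      in the total degree. For infinite \<open>J\<close>, where \<open>card\<close> does not react
      to the removal, the coefficient vanishes by the support.\<close>
    proof (cases "i \<in> J \<and> finite J")
      case True
      then obtain c where "card J = Suc c" "card (J - {i}) = c" by (metis card_Suc_Diff1)
      then show ?thesis by (simp add: total_inv_def dxw_def yder_def)
    next
      case False
      then show ?thesis using supported_finite[OF assms, of "J - {i}"] by (auto simp: total_inv_def dxw_def yder_def)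
    qed
  qed
  then show ?thesis by (simp only: delta_def additive_sum[of total_inv, OF total_inv_add])
qed

lemma total_inv_delta_star:
  assumes "supported (2*n) b"
  shows "total_inv (delta_star n b) = delta_star n (total_inv b)"
proof -
  have "total_inv (ymul i (contr i b)) = ymul i (contr i (total_inv b))" for i
  proof (intro ext)
    fix k \<alpha> J
    show "total_inv (ymul i (contr i b)) k \<alpha> J = ymul i (contr i (total_inv b)) k \<alpha> J"
    proof (cases "i \<in># \<alpha> \<and> i \<notin> J \<and> finite J")
      case True
      then obtain \<beta> where \<beta>: "\<alpha> = add_mset i \<beta>" by (metis insert_DiffM)
      show ?thesis using True by (simp add: total_inv_def contr_def ymul_def \<beta>)
    next
      case False
      then show ?thesis using supported_finite[OF assms, of "insert i J"] by (auto simp: total_inv_def contr_def ymul_def)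
    qed
  qed
  then show ?thesis by (simp only: delta_star_def additive_sum[of total_inv, OF total_inv_add])
qed

lemma delta_minus_delta_minus:
  assumes "supported (2*n) b"
  shows "delta_minus n (delta_minus n b) = 0"
  by (simp only: delta_minus_eq total_inv_delta_star supported_total_inv[OF assms] delta_star_delta_star)

text \<open>Division by the total degree normalizes \<open>delta_star_delta\<close> to the identity;
  the component of total degree 0 is assumed to vanish, since no division is possible there.\<close>

lemma hodge_decomposition:
  assumes "supported (2*n) b" and "\<And>k. b k {#} {} = 0"
  shows "delta_minus n (delta n b) + delta n (delta_minus n b) = b"
proof (intro ext)
  fix k \<alpha> J
  \<comment> \<open>An infinite \<open>J\<close> has \<open>card J\<close> = 0 as well, so
    finiteness from the support is needed here.\<close>
  have "size \<alpha> + card J > 0 \<or> b k \<alpha> J = 0"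
    using assms(2)[of k] supported_finite[OF assms(1), of J k \<alpha>] by (auto simp: card_gt_0_iff)
  then show "(delta_minus n (delta n b) + delta n (delta_minus n b)) k \<alpha> J = b k \<alpha> J"
    unfolding delta_minus_eq total_inv_delta[OF assms(1)] delta_star_delta[OF supported_total_inv[OF assms(1)]]
    by (auto simp: total_inv_def simp del: of_nat_add)
qed

text \<open>Contraction does not affect the degree, and the multiplication by y in
  \<open>delta_star\<close> raises it by one.\<close>

lemma fedosov_ge_delta_minus:
  assumes "fedosov_ge q b" shows "fedosov_ge (q + 1) (delta_minus n b)"
proof -
  have "total_inv b k \<alpha> J \<noteq> 0 \<Longrightarrow> b k \<alpha> J \<noteq> 0" for k \<alpha> J
    by (auto simp: total_inv_def split: if_splits)
  then have "fedosov_ge q (total_inv b)" using assms unfolding fedosov_ge_def by blast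
  then show ?thesis unfolding delta_minus_eq delta_star_def by (intro fedosov_ge_sum fedosov_ge_ymul fedosov_ge_contr)
qed

section \<open>Graded commutators with odd and even forms\<close>

lemma fpart_par: "fpart p (par b) = par (fpart p b)"
  and par_fpart: "par (fpart p b) = scl ((-1) ^ p) (fpart p b)"
  by (auto simp: fpart_def par_def scl_def fun_eq_iff)

lemma fpart_sum:
  assumes "supported d a" shows "(\<Sum>p\<le>d. fpart p a) = a"
proof (intro ext)
  fix k \<alpha> J
  have "(\<Sum>p\<le>d. fpart p a) k \<alpha> J = (if card J \<le> d then a k \<alpha> J else 0)"
    by (simp add: sum_wform_apply fpart_def)
  moreover have "card J \<le> d" if "a k \<alpha> J \<noteq> 0"
    using that assms card_mono[of "{..<d}" J] by (auto simp: supported_def)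
  ultimately show "(\<Sum>p\<le>d. fpart p a) k \<alpha> J = a k \<alpha> J" by auto
qed

text \<open>For odd a only odd p contribute, and then the sign (-1)^(pq) is (-1)^q, which is the
  action of \<open>par\<close> on the part of b of degree q.\<close>

lemma gcomm_odd:
  assumes "supported (2*n) a" "supported (2*n) b" "par a = - a"
  shows "gcomm n a b = supercomm n a b"
proof -
  have *: "scl ((-1) ^ (p * q)) (moyal n (fpart q b) (fpart p a)) = moyal n (fpart q (par b)) (fpart p a)" for p q
  proof (cases "odd p")
    case True
    then have "(-1) ^ (p * q) = ((-1) ^ q :: complex)" by (simp add: power_mult)
    then show ?thesis by (simp only: fpart_par par_fpart moyal_scl_left)
  next
    case False
    have "fpart p a k \<alpha> J = 0" for k \<alpha> J
      using False arg_cong[OF assms(3), of "\<lambda>f. f k \<alpha> J"] by (auto simp: fpart_def par_def)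
    then have "fpart p a = 0" by (intro ext) simp
    then show ?thesis by (simp only: moyal_zero_right scl_zero)
  qed
  have "gcomm n a b = (\<Sum>p\<le>2*n. \<Sum>q\<le>2*n. moyal n (fpart p a) (fpart q b)) -
      (\<Sum>p\<le>2*n. \<Sum>q\<le>2*n. moyal n (fpart q (par b)) (fpart p a))"
    unfolding gcomm_def * sum_subtractf ..
  also have "\<dots> = moyal n (\<Sum>p\<le>2*n. fpart p a) (\<Sum>q\<le>2*n. fpart q b) -
      moyal n (\<Sum>q\<le>2*n. fpart q (par b)) (\<Sum>p\<le>2*n. fpart p a)"
    unfolding moyal_sum_left moyal_sum_right by (subst (2) sum.swap) (rule refl)
  also have "\<dots> = supercomm n a b"
    by (simp only: fpart_sum assms(1,2) supported_par supercomm_def)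
  finally show ?thesis .
qed

lemma gcomm_even:
  assumes "supported (2*n) a" "supported (2*n) b" "par a = a"
  shows "gcomm n a b = moyal n a b - moyal n b a"
proof -
  have *: "scl ((-1) ^ (p * q)) (moyal n (fpart q b) (fpart p a)) = moyal n (fpart q b) (fpart p a)" for p q
  proof (cases "even p")
    case True
    then have "(-1) ^ (p * q) = (1 :: complex)" by (simp add: power_mult)
    then show ?thesis by (simp only: scl_one)
  next
    case False
    have "fpart p a k \<alpha> J = 0" for k \<alpha> J
      using False arg_cong[OF assms(3), of "\<lambda>f. f k \<alpha> J"] by (auto simp: fpart_def par_def)
    then have "fpart p a = 0" by (intro ext) simp
    then show ?thesis by (simp only: moyal_zero_right scl_zero)
  qed
  have "gcomm n a b = (\<Sum>p\<le>2*n. \<Sum>q\<le>2*n. moyal n (fpart p a) (fpart q b)) -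
      (\<Sum>p\<le>2*n. \<Sum>q\<le>2*n. moyal n (fpart q b) (fpart p a))"
    unfolding gcomm_def * sum_subtractf ..
  also have "\<dots> = moyal n (\<Sum>p\<le>2*n. fpart p a) (\<Sum>q\<le>2*n. fpart q b) -
      moyal n (\<Sum>q\<le>2*n. fpart q b) (\<Sum>p\<le>2*n. fpart p a)"
    unfolding moyal_sum_left moyal_sum_right by (subst (2) sum.swap) (rule refl)
  also have "\<dots> = moyal n a b - moyal n b a"
    by (simp only: fpart_sum assms(1,2))
  finally show ?thesis .
qed

text \<open>The terms of even order cancel, and those of order at least 3 vanish.\<close>

lemma i_over_lambda_supercomm_quadratic:
  assumes "par s = - s"
    and "\<And>p q r. p < 2*n \<Longrightarrow> q < 2*n \<Longrightarrow> r < 2*n \<Longrightarrow> yder p (yder q (yder r s)) = 0"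
  shows "i_over_lambda (supercomm n s b) = scl 2 (moyal_term n 1 s b)"
proof (intro ext)
  fix k \<alpha> J
  have high: "moyal_term n (Suc (Suc (Suc m))) s b = 0" for m
    by (simp add: assms(2) moyal_term_zero_left scl_zero del: of_nat_Suc)
  \<comment> \<open>By \<open>moyal_term_swap_odd\<close> the reversed product differs at order m by
    the sign (-1)^m, which produces the factor 1 - (-1)^m.\<close>
  have "supercomm n s b (Suc k) \<alpha> J = (\<Sum>m\<le>Suc k. (- \<i>) ^ m * (1 - (-1) ^ m) * moyal_term n m s b (Suc k - m) \<alpha> J)"
    unfolding supercomm_def fun_diff_def moyal_eq sum_subtractf[symmetric] moyal_term_swap_odd[OF assms(1)]
    by (intro sum.cong refl) (simp add: scl_apply algebra_simps)
  also have "\<dots> = (\<Sum>m\<le>Suc k. if m = 1 then - \<i> * 2 * moyal_term n 1 s b k \<alpha> J else 0)"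
  proof (intro sum.cong refl)
    fix m assume "m \<in> {..Suc k}"
    consider "m = 0" | "m = 1" | "m = 2" | l where "m = Suc (Suc (Suc l))"
      by (metis One_nat_def Suc_1 not0_implies_Suc)
    then show "(- \<i>) ^ m * (1 - (-1) ^ m) * moyal_term n m s b (Suc k - m) \<alpha> J =
        (if m = 1 then - \<i> * 2 * moyal_term n 1 s b k \<alpha> J else 0)"
      by cases (simp_all add: high del: moyal_term.simps)
  qed
  also have "\<dots> = - \<i> * 2 * moyal_term n 1 s b k \<alpha> J"
    by (subst sum.delta[OF finite_atMost]) (simp only: atMost_iff, simp)
  finally have "supercomm n s b (Suc k) \<alpha> J = - \<i> * 2 * moyal_term n 1 s b k \<alpha> J" .
  then have "\<i> * supercomm n s b (Suc k) \<alpha> J = \<i> * (- \<i> * 2 * moyal_term n 1 s b k \<alpha> J)" by (simp only:)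
  also have "\<dots> = 2 * moyal_term n 1 s b k \<alpha> J" by (simp only: mult.assoc[symmetric]) simp
  finally show "i_over_lambda (supercomm n s b) k \<alpha> J = scl 2 (moyal_term n 1 s b) k \<alpha> J"
    by (simp only: i_over_lambda_def scl_apply)
qed

section \<open>Partial derivatives\<close>

lemma continuous_map_fun_upd2:
  assumes "x \<in> topspace (Euclidean_space d)" "i < d" "j < d"
  shows "continuous_map euclidean (Euclidean_space d) (\<lambda>p :: real \<times> real. x(i := fst p, j := snd p))"
  unfolding Euclidean_space_def continuous_map_in_subtopology continuous_map_componentwise_UNIV
proof (intro conjI allI)
  fix k
  show "continuous_map euclidean euclideanreal (\<lambda>p :: real \<times> real. (x(i := fst p, j := snd p)) k)"
    by (cases "k = j"; cases "k = i") (auto simp: intro!: continuous_intros)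
qed (use assms in \<open>auto simp: topspace_Euclidean_space\<close>)

lemma open_slice2:
  assumes "openin (Euclidean_space d) W" "x \<in> W" "i < d" "j < d"
  shows "open {p :: real \<times> real. x(i := fst p, j := snd p) \<in> W}"
  using openin_continuous_map_preimage[OF continuous_map_fun_upd2[of x d i j] assms(1)]
    openin_subset[OF assms(1)] assms by auto

lemma open_slice:
  assumes "openin (Euclidean_space d) W" "x \<in> W" "j < d"
  shows "open {t. x(j := t) \<in> W}"
proof -
  have "open ((\<lambda>t. (t, t)) -` {p :: real \<times> real. x(j := fst p, j := snd p) \<in> W})"
    by (intro open_vimage open_slice2[OF assms(1,2,3,3)] continuous_intros)
  then show ?thesis by (simp add: vimage_def)
qed

section \<open>Symmetry of mixed partial derivatives\<close>

lemma mixed_difference_mvt: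
  fixes F :: "real \<Rightarrow> real \<Rightarrow> real"
  assumes "0 < h"
    and 1: "\<And>s t. s \<in> {a..a+h} \<Longrightarrow> t \<in> {b..b+h} \<Longrightarrow> ((\<lambda>s. F s t) has_real_derivative F1 s t) (at s)"
    and 2: "\<And>s t. s \<in> {a..a+h} \<Longrightarrow> t \<in> {b..b+h} \<Longrightarrow> ((\<lambda>t. F1 s t) has_real_derivative F12 s t) (at t)"
  shows "\<exists>s\<in>{a..a+h}. \<exists>t\<in>{b..b+h}. F (a+h) (b+h) - F (a+h) b - F a (b+h) + F a b = h * h * F12 s t"
proof -
  have "((\<lambda>s. F s (b+h) - F s b) has_real_derivative F1 s (b+h) - F1 s b) (at s)"
    if "a \<le> s" "s \<le> a + h" for s
    using that assms(1) by (intro DERIV_diff 1) auto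
  from MVT2[of a "a+h" "\<lambda>s. F s (b+h) - F s b", OF _ this] assms(1)
  obtain s where s: "a < s" "s < a + h" "(F (a+h) (b+h) - F (a+h) b) - (F a (b+h) - F a b) = h * (F1 s (b+h) - F1 s b)"
    by auto
  have "((\<lambda>t. F1 s t) has_real_derivative F12 s t) (at t)" if "b \<le> t" "t \<le> b + h" for t
    using that s by (intro 2) auto
  from MVT2[of b "b+h" "F1 s", OF _ this] assms(1)
  obtain t where t: "b < t" "t < b + h" "F1 s (b+h) - F1 s b = h * F12 s t"
    by auto
  show ?thesis using s t by (intro bexI[of _ s] bexI[of _ t]) auto
qed

text \<open>The second difference over a small square does not depend on the order of the variables.
  Two applications of the mean value theorem in each order express it by values of F12 and of F21
  inside the square, and continuity compares these with the values at the corner.\<close>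

lemma mixed_partials_eq:
  fixes F :: "real \<Rightarrow> real \<Rightarrow> real"
  assumes S: "open S" "(a, b) \<in> S"
    and 1: "\<And>s t. (s, t) \<in> S \<Longrightarrow> ((\<lambda>s. F s t) has_real_derivative F1 s t) (at s)"
    and 2: "\<And>s t. (s, t) \<in> S \<Longrightarrow> ((\<lambda>t. F s t) has_real_derivative F2 s t) (at t)"
    and 12: "\<And>s t. (s, t) \<in> S \<Longrightarrow> ((\<lambda>t. F1 s t) has_real_derivative F12 s t) (at t)"
    and 21: "\<And>s t. (s, t) \<in> S \<Longrightarrow> ((\<lambda>s. F2 s t) has_real_derivative F21 s t) (at s)"
    and c12: "continuous_on S (\<lambda>p. F12 (fst p) (snd p))"
    and c21: "continuous_on S (\<lambda>p. F21 (fst p) (snd p))"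
  shows "F12 a b = F21 a b"
proof (rule ccontr)
  assume ne: "F12 a b \<noteq> F21 a b"
  \<comment> \<open>Half the gap: a number cannot be closer than this to both \<open>F12 a b\<close>
    and \<open>F21 a b\<close>.\<close>
  define e where "e = \<bar>F12 a b - F21 a b\<bar> / 2"
  have e: "e > 0" using ne by (simp add: e_def)
  obtain d0 where d0: "d0 > 0" "ball (a, b) d0 \<subseteq> S" using S open_contains_ball by blast
  have "isCont (\<lambda>p. F12 (fst p) (snd p)) (a, b)" "isCont (\<lambda>p. F21 (fst p) (snd p)) (a, b)"
    using c12 c21 S continuous_on_eq_continuous_at by blast+
  then obtain d1 d2 where d1: "d1 > 0" "\<And>p. dist p (a, b) < d1 \<Longrightarrow> dist (F12 (fst p) (snd p)) (F12 a b) < e"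
    and d2: "d2 > 0" "\<And>p. dist p (a, b) < d2 \<Longrightarrow> dist (F21 (fst p) (snd p)) (F21 a b) < e"
    using e unfolding continuous_at_eps_delta by (metis fst_conv snd_conv)
  \<comment> \<open>Points of the square of side h have distance at most 2h from its corner, so a
    third of the radius leaves strict room.\<close>
  define h where "h = min d0 (min d1 d2) / 3"
  have h: "h > 0" "2 * h < d0" "2 * h < d1" "2 * h < d2" using d0(1) d1(1) d2(1) by (auto simp: h_def)
  have box: "dist (s, t) (a, b) \<le> 2 * h" if "s \<in> {a..a+h}" "t \<in> {b..b+h}" for s t
  proof -
    have "dist (s, t) (a, b) \<le> dist s a + dist t b" by (simp add: dist_prod_def sqrt_sum_squares_le_sum)
    also have "\<dots> \<le> 2 * h" using that by (auto simp: dist_real_def)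
    finally show ?thesis .
  qed
  have inS: "(s, t) \<in> S" if "s \<in> {a..a+h}" "t \<in> {b..b+h}" for s t
    using box[OF that] h d0 by (auto simp: dist_commute)
  obtain s t where st: "s \<in> {a..a+h}" "t \<in> {b..b+h}"
    "F (a+h) (b+h) - F (a+h) b - F a (b+h) + F a b = h * h * F12 s t"
    using mixed_difference_mvt[of h a b F F1 F12] h(1) 1 12 inS by blast
  obtain t' s' where st': "t' \<in> {b..b+h}" "s' \<in> {a..a+h}"
    "F (a+h) (b+h) - F a (b+h) - F (a+h) b + F a b = h * h * F21 s' t'"
    using mixed_difference_mvt[of h b a "\<lambda>t s. F s t" "\<lambda>t s. F2 s t" "\<lambda>t s. F21 s t"] h(1) 2 21 inS by blast
  have "h * h * F12 s t = h * h * F21 s' t'" using st(3) st'(3) by linarith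
  then have "F12 s t = F21 s' t'" using h(1) by simp
  moreover have "dist (F12 s t) (F12 a b) < e" using d1(2)[of "(s, t)"] box[OF st(1,2)] h by simp
  moreover have "dist (F21 s' t') (F21 a b) < e" using d2(2)[of "(s', t')"] box[OF st'(2,1)] h by simp
  ultimately show False by (simp add: e_def dist_real_def abs_if split: if_splits)
qed

lemma smooth_on_has_pd:
  assumes "smooth_on d W f" "x \<in> W" "i < d"
  shows "((\<lambda>t. f (x(i := t))) has_vector_derivative pd i f x) (at (x i))"
  using assms unfolding smooth_on_def pd_def vector_derivative_works[symmetric]
  by (auto dest: spec[of _ "[]"])

lemma smooth_on_pd:
  assumes "smooth_on d W f" "i < d"
  shows "smooth_on d W (pd i f)"
  unfolding smooth_on_def
proof (intro allI impI)
  fix js :: "nat list" assume "set js \<subseteq> {..<d}"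
  then have "set (js @ [i]) \<subseteq> {..<d}" using assms(2) by auto
  from assms(1)[unfolded smooth_on_def, rule_format, OF this]
  show "continuous_map (subtopology (Euclidean_space d) W) euclidean (foldr pd js (pd i f)) \<and>
        (\<forall>x\<in>W. \<forall>ia<d. (\<lambda>t. foldr pd js (pd i f) (x(ia := t))) differentiable at (x ia))"
    by simp
qed

lemma smooth_on_continuous:
  "smooth_on d W f \<Longrightarrow> continuous_map (subtopology (Euclidean_space d) W) euclidean f"
  unfolding smooth_on_def by (auto dest: spec[of _ "[]"])

lemma pd_commute:
  fixes f :: "coords \<Rightarrow> complex"
  assumes f: "smooth_on d W f" and W: "openin (Euclidean_space d) W" and x: "x \<in> W" and ij: "i < d" "j < d"
  shows "pd i (pd j f) x = pd j (pd i f) x"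
proof (cases "i = j")
  case False
  define u where "u s t = x(i := s, j := t)" for s t
  define S where "S = {p. u (fst p) (snd p) \<in> W}"
  have upd: "(u s t)(i := s') = u s' t" "(u s t)(j := t') = u s t'" "u s t i = s" "u s t j = t" for s t s' t'
    using False by (auto simp: u_def fun_eq_iff)
  have S: "open S" "(x i, x j) \<in> S"
    using open_slice2[OF W x ij] x by (auto simp: S_def u_def)
  have D1: "((\<lambda>s. g (u s t)) has_vector_derivative pd i g (u s t)) (at s)"
    and D2: "((\<lambda>t. g (u s t)) has_vector_derivative pd j g (u s t)) (at t)"
    if "smooth_on d W g" "(s, t) \<in> S" for g :: "coords \<Rightarrow> complex" and s t
    using smooth_on_has_pd[OF that(1), of "u s t" i] smooth_on_has_pd[OF that(1), of "u s t" j] that(2) ij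
    by (simp_all add: S_def upd)
  have C: "continuous_on S (\<lambda>p. g (u (fst p) (snd p)))" if "smooth_on d W g" for g :: "coords \<Rightarrow> complex"
  proof -
    have "continuous_map (top_of_set S) (subtopology (Euclidean_space d) W) (\<lambda>p. u (fst p) (snd p))"
      using continuous_map_fun_upd2[of x d i j] openin_subset[OF W] x ij
      by (auto simp: continuous_map_in_subtopology S_def u_def intro: continuous_map_from_subtopology)
    from continuous_map_compose[OF this smooth_on_continuous[OF that]] show ?thesis
      by (simp add: o_def)
  qed
  \<comment> \<open>The mean value theorem concerns real functions, so L stands for the real and the
    imaginary part.\<close>
  have main: "L (pd j (pd i f) x) = L (pd i (pd j f) x)" if L: "bounded_linear L" for L :: "complex \<Rightarrow> real"
  proof -
    note B = bounded_linear.has_vector_derivative[OF L]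
    have "L (pd j (pd i f) (u (x i) (x j))) = L (pd i (pd j f) (u (x i) (x j)))"
      by (rule mixed_partials_eq[OF S, of "\<lambda>s t. L (f (u s t))" "\<lambda>s t. L (pd i f (u s t))" "\<lambda>s t. L (pd j f (u s t))"])
        (auto simp: has_real_derivative_iff_has_vector_derivative
          intro!: B D1 D2 C f smooth_on_pd ij bounded_linear.continuous_on[OF L])
    moreover have "u (x i) (x j) = x" by (simp add: u_def)
    ultimately show ?thesis by simp
  qed
  show ?thesis using main[OF bounded_linear_Re] main[OF bounded_linear_Im] by (simp add: complex_eq_iff)
qed simp

section \<open>Differentiation of Weyl-valued functions\<close>

definition pdw :: "nat \<Rightarrow> (coords \<Rightarrow> wform) \<Rightarrow> coords \<Rightarrow> wform" where
  "pdw j b x = (\<lambda>k \<alpha> J. pd j (\<lambda>z. b z k \<alpha> J) x)"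

text \<open>The relation records differentiability along with the value, since \<open>pd\<close>
  alone is an unspecified vector where no derivative exists.\<close>

definition has_pdw :: "(coords \<Rightarrow> wform) \<Rightarrow> wform \<Rightarrow> nat \<Rightarrow> coords \<Rightarrow> bool" where
  "has_pdw b D j x \<longleftrightarrow> (\<forall>k \<alpha> J. ((\<lambda>t. b (x(j := t)) k \<alpha> J) has_vector_derivative D k \<alpha> J) (at (x j)))"

lemma has_pdw_imp_pdw: "has_pdw b D j x \<Longrightarrow> pdw j b x = D"
  unfolding has_pdw_def pdw_def pd_def by (intro ext) (auto intro: vector_derivative_at)

lemma has_pdw_add: "has_pdw a A j x \<Longrightarrow> has_pdw b B j x \<Longrightarrow> has_pdw (\<lambda>z. a z + b z) (A + B) j x"
  by (auto simp: has_pdw_def intro: has_vector_derivative_add)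

lemma has_pdw_diff: "has_pdw a A j x \<Longrightarrow> has_pdw b B j x \<Longrightarrow> has_pdw (\<lambda>z. a z - b z) (A - B) j x"
  by (auto simp: has_pdw_def intro: has_vector_derivative_diff)

lemma has_pdw_zero: "has_pdw (\<lambda>z. 0) 0 j x"
  by (simp add: has_pdw_def)

lemma has_pdw_sum: "(\<And>i. i \<in> S \<Longrightarrow> has_pdw (f i) (F i) j x) \<Longrightarrow> has_pdw (\<lambda>z. \<Sum>i\<in>S. f i z) (\<Sum>i\<in>S. F i) j x"
  by (induction S rule: infinite_finite_induct) (auto intro: has_pdw_add has_pdw_zero)

lemma has_pdw_scl: "has_pdw a A j x \<Longrightarrow> has_pdw (\<lambda>z. scl c (a z)) (scl c A) j x"
  by (auto simp: has_pdw_def scl_def intro: has_vector_derivative_mult_right)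

lemma has_pdw_par: "has_pdw a A j x \<Longrightarrow> has_pdw (\<lambda>z. par (a z)) (par A) j x"
  by (auto simp: has_pdw_def par_def intro: has_vector_derivative_mult_right)

lemma has_pdw_yder: "has_pdw a A j x \<Longrightarrow> has_pdw (\<lambda>z. yder i (a z)) (yder i A) j x"
  by (auto simp: has_pdw_def yder_def intro: has_vector_derivative_mult_right simp del: of_nat_add of_nat_Suc)

lemma has_pdw_dxw: "has_pdw a A j x \<Longrightarrow> has_pdw (\<lambda>z. dxw i (a z)) (dxw i A) j x"
  by (auto simp: has_pdw_def dxw_def intro: has_vector_derivative_mult_right)

lemma has_pdw_i_over_lambda: "has_pdw a A j x \<Longrightarrow> has_pdw (\<lambda>z. i_over_lambda (a z)) (i_over_lambda A) j x"
  by (auto simp: has_pdw_def i_over_lambda_def intro: has_vector_derivative_mult_right)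

lemma has_pdw_wmul:
  assumes "has_pdw a A j x" "has_pdw b B j x"
  shows "has_pdw (\<lambda>z. wmul (a z) (b z)) (wmul A (b x) + wmul (a x) B) j x"
  unfolding has_pdw_def
proof (intro allI)
  fix k \<gamma> J
  have c: "((\<lambda>t. wcoeff (a (x(j := t))) v) has_vector_derivative wcoeff A v) (at (x j))"
    "((\<lambda>t. wcoeff (b (x(j := t))) v) has_vector_derivative wcoeff B v) (at (x j))" for v
    using assms by (auto simp: has_pdw_def wcoeff_def)
  have p: "((\<lambda>t. wcoeff (a (x(j := t))) v * wcoeff (b (x(j := t))) w) has_vector_derivative
      (wcoeff A v * wcoeff (b x) w + wcoeff (a x) v * wcoeff B w)) (at (x j))" for v w
    using has_vector_derivative_mult[OF c(1)[of v] c(2)[of w]] by (simp add: add.commute)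
  have "((\<lambda>t. wmul (a (x(j := t))) (b (x(j := t))) k \<gamma> J) has_vector_derivative
     (\<Sum>v\<in>wdec (k, \<gamma>, J). wsgn v (wminus (k, \<gamma>, J) v) *
      (wcoeff A v * wcoeff (b x) (wminus (k, \<gamma>, J) v) + wcoeff (a x) v * wcoeff B (wminus (k, \<gamma>, J) v)))) (at (x j))"
    unfolding wmul_def by (intro has_vector_derivative_sum has_vector_derivative_mult_right p)
  then show "((\<lambda>t. wmul (a (x(j := t))) (b (x(j := t))) k \<gamma> J) has_vector_derivative
     (wmul A (b x) + wmul (a x) B) k \<gamma> J) (at (x j))"
    by (simp add: wmul_def distrib_left sum.distrib)
qed

lemma has_pdw_moyal_term:
  "has_pdw a A j x \<Longrightarrow> has_pdw b B j x \<Longrightarrow>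
    has_pdw (\<lambda>z. moyal_term n m (a z) (b z)) (moyal_term n m A (b x) + moyal_term n m (a x) B) j x"
proof (induction m arbitrary: a b A B)
  case 0
  then show ?case unfolding moyal_term.simps by (rule has_pdw_wmul)
next
  case (Suc m)
  then show ?case unfolding moyal_term.simps sum.distrib[symmetric] scl_add[symmetric]
    by (intro has_pdw_sum has_pdw_scl Suc.IH has_pdw_yder)
qed

lemma has_pdw_moyal:
  assumes "has_pdw a A j x" "has_pdw b B j x"
  shows "has_pdw (\<lambda>z. moyal n (a z) (b z)) (moyal n A (b x) + moyal n (a x) B) j x"
  unfolding has_pdw_def
proof (intro allI)
  fix k \<gamma> J
  have "((\<lambda>t. moyal n (a (x(j := t))) (b (x(j := t))) k \<gamma> J) has_vector_derivative
     (\<Sum>m\<le>k. (- \<i>) ^ m * (moyal_term n m A (b x) + moyal_term n m (a x) B) (k - m) \<gamma> J)) (at (x j))"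
    unfolding moyal_eq using has_pdw_moyal_term[OF assms, of n]
    by (intro has_vector_derivative_sum has_vector_derivative_mult_right) (auto simp: has_pdw_def)
  then show "((\<lambda>t. moyal n (a (x(j := t))) (b (x(j := t))) k \<gamma> J) has_vector_derivative
     (moyal n A (b x) + moyal n (a x) B) k \<gamma> J) (at (x j))"
    by (simp add: moyal_eq distrib_left sum.distrib)
qed

text \<open>The slice of the open set W through x in direction j is open, so values on W determine
  the derivative at x.\<close>

lemma pdw_cong:
  assumes W: "openin (Euclidean_space d) W" "x \<in> W" "j < d" and eq: "\<And>z. z \<in> W \<Longrightarrow> a z = b z"
  shows "pdw j a x = pdw j b x"
proof (intro ext)
  fix k \<alpha> J
  have "\<forall>\<^sub>F t in nhds (x j). a (x(j := t)) k \<alpha> J = b (x(j := t)) k \<alpha> J"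
    using open_slice[OF W] W(2) eq by (auto simp: eventually_nhds intro!: exI[of _ "{t. x(j := t) \<in> W}"])
  then show "pdw j a x k \<alpha> J = pdw j b x k \<alpha> J"
    unfolding pdw_def pd_def by (intro vector_derivative_cong_eq) (auto simp: eventually_at_filter elim: eventually_mono)
qed

definition wsmooth :: "nat \<Rightarrow> coords set \<Rightarrow> (coords \<Rightarrow> wform) \<Rightarrow> bool" where
  "wsmooth d W b \<longleftrightarrow> (\<forall>k \<alpha> J. smooth_on d W (\<lambda>x. b x k \<alpha> J))"

lemma wsmooth_has_pdw: "wsmooth d W b \<Longrightarrow> x \<in> W \<Longrightarrow> j < d \<Longrightarrow> has_pdw b (pdw j b x) j x"
  unfolding wsmooth_def has_pdw_def pdw_def using smooth_on_has_pd by blast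

lemma wsmooth_pdw: "wsmooth d W b \<Longrightarrow> j < d \<Longrightarrow> wsmooth d W (pdw j b)"
  unfolding wsmooth_def pdw_def using smooth_on_pd by (metis (mono_tags, lifting) ext)

lemma pdw_commute:
  assumes "wsmooth d W b" "openin (Euclidean_space d) W" "x \<in> W" "i < d" "j < d"
  shows "pdw i (pdw j b) x = pdw j (pdw i b) x"
  using assms(1) unfolding wsmooth_def pdw_def by (intro ext pd_commute[OF _ assms(2-5)]) auto

section \<open>The operator $d-\delta$\<close>

text \<open>Adding an index to a finite set flips its parity. At infinite sets \<open>card\<close>
  stays 0, and the support makes both sides vanish.\<close>

lemma par_dxw:
  assumes "supported d b"
  shows "par (dxw j b) = - dxw j (par b)"
proof (intro ext)
  fix k \<alpha> J
  show "par (dxw j b) k \<alpha> J = (- dxw j (par b)) k \<alpha> J"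
  proof (cases "j \<in> J \<and> finite J")
    case True
    then obtain c where "card J = Suc c" "card (J - {j}) = c" by (metis card_Suc_Diff1)
    then show ?thesis by (simp add: par_def dxw_def)
  next
    case False
    then show ?thesis using supported_finite[OF assms, of "J - {j}"] by (auto simp: par_def dxw_def)
  qed
qed

lemma ext_d_eq: "ext_d n b x = (\<Sum>j<2*n. dxw j (pdw j b x))"
  by (simp add: ext_d_def pdw_def)

definition d_minus_delta :: "nat \<Rightarrow> (coords \<Rightarrow> wform) \<Rightarrow> coords \<Rightarrow> wform" where
  "d_minus_delta n b x = ext_d n b x - delta n (b x)"

text \<open>In this form d - delta is built from the derivations d/dx_j - d/dy_j, which commute with
  one another; this is the source of both the graded Leibniz rule and the vanishing square.\<close>

lemma d_minus_delta_eq: "d_minus_delta n b x = (\<Sum>j<2*n. dxw j (pdw j b x - yder j (b x)))"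
  by (simp only: d_minus_delta_def ext_d_eq delta_def dxw_diff sum_subtractf)

text \<open>Differentiability of first order only: products are differentiated once, and second
  derivatives are taken only of s and b, which are smooth.\<close>

definition wdifferentiable :: "nat \<Rightarrow> coords set \<Rightarrow> (coords \<Rightarrow> wform) \<Rightarrow> bool" where
  "wdifferentiable d W b \<longleftrightarrow> (\<forall>x\<in>W. \<forall>j<d. has_pdw b (pdw j b x) j x)"

lemma wdifferentiableD: "wdifferentiable d W b \<Longrightarrow> x \<in> W \<Longrightarrow> j < d \<Longrightarrow> has_pdw b (pdw j b x) j x"
  by (simp add: wdifferentiable_def)

lemma wdifferentiableI: "(\<And>x j. x \<in> W \<Longrightarrow> j < d \<Longrightarrow> has_pdw b (B j x) j x) \<Longrightarrow> wdifferentiable d W b"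
  unfolding wdifferentiable_def using has_pdw_imp_pdw by fastforce

lemma wsmooth_wdifferentiable: "wsmooth d W b \<Longrightarrow> wdifferentiable d W b"
  by (simp add: wdifferentiable_def wsmooth_has_pdw)

lemma wdifferentiable_diff: "wdifferentiable d W a \<Longrightarrow> wdifferentiable d W b \<Longrightarrow> wdifferentiable d W (\<lambda>z. a z - b z)"
  by (rule wdifferentiableI, rule has_pdw_diff) (auto intro: wdifferentiableD)

lemma wdifferentiable_moyal: "wdifferentiable d W a \<Longrightarrow> wdifferentiable d W b \<Longrightarrow> wdifferentiable d W (\<lambda>z. moyal n (a z) (b z))"
  by (rule wdifferentiableI, rule has_pdw_moyal) (auto intro: wdifferentiableD)

lemma wdifferentiable_i_over_lambda: "wdifferentiable d W a \<Longrightarrow> wdifferentiable d W (\<lambda>z. i_over_lambda (a z))"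
  by (rule wdifferentiableI, rule has_pdw_i_over_lambda) (auto intro: wdifferentiableD)

lemma wdifferentiable_par: "wdifferentiable d W a \<Longrightarrow> wdifferentiable d W (\<lambda>z. par (a z))"
  by (rule wdifferentiableI, rule has_pdw_par) (auto intro: wdifferentiableD)

lemma wdifferentiable_supercomm: "wdifferentiable d W a \<Longrightarrow> wdifferentiable d W b \<Longrightarrow> wdifferentiable d W (\<lambda>z. supercomm n (a z) (b z))"
  unfolding supercomm_def by (intro wdifferentiable_diff wdifferentiable_moyal wdifferentiable_par)

lemma wsmooth_wdifferentiable_d_minus_delta:
  assumes "wsmooth (2*n) W b"
  shows "wdifferentiable (2*n) W (d_minus_delta n b)"
  unfolding d_minus_delta_eq
  by (rule wdifferentiableI, rule has_pdw_sum, rule has_pdw_dxw, rule has_pdw_diff[OF _ has_pdw_yder])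
    (auto intro!: wsmooth_has_pdw[OF assms] wsmooth_has_pdw[OF wsmooth_pdw[OF assms]])

lemma d_minus_delta_add:
  assumes "wdifferentiable (2*n) W a" "wdifferentiable (2*n) W b" "x \<in> W"
  shows "d_minus_delta n (\<lambda>z. a z + b z) x = d_minus_delta n a x + d_minus_delta n b x"
proof -
  have "pdw j (\<lambda>z. a z + b z) x = pdw j a x + pdw j b x" if "j < 2*n" for j
    by (rule has_pdw_imp_pdw[OF has_pdw_add]) (use assms that in \<open>auto intro: wdifferentiableD\<close>)
  then have "ext_d n (\<lambda>z. a z + b z) x = ext_d n a x + ext_d n b x"
    unfolding ext_d_eq sum.distrib[symmetric] dxw_add[symmetric] by (intro sum.cong refl) simp
  then show ?thesis unfolding d_minus_delta_def delta_add by simp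
qed

lemma d_minus_delta_diff:
  assumes "wdifferentiable (2*n) W a" "wdifferentiable (2*n) W b" "x \<in> W"
  shows "d_minus_delta n (\<lambda>z. a z - b z) x = d_minus_delta n a x - d_minus_delta n b x"
proof -
  have "pdw j (\<lambda>z. a z - b z) x = pdw j a x - pdw j b x" if "j < 2*n" for j
    by (rule has_pdw_imp_pdw[OF has_pdw_diff]) (use assms that in \<open>auto intro: wdifferentiableD\<close>)
  then have "ext_d n (\<lambda>z. a z - b z) x = ext_d n a x - ext_d n b x"
    unfolding ext_d_eq sum_subtractf[symmetric] dxw_diff[symmetric] by (intro sum.cong refl) simp
  then show ?thesis unfolding d_minus_delta_def delta_diff by simp
qed

lemma d_minus_delta_i_over_lambda:
  assumes "wdifferentiable (2*n) W a" "x \<in> W"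
  shows "d_minus_delta n (\<lambda>z. i_over_lambda (a z)) x = i_over_lambda (d_minus_delta n a x)"
proof -
  have "pdw j (\<lambda>z. i_over_lambda (a z)) x = i_over_lambda (pdw j a x)" if "j < 2*n" for j
    by (rule has_pdw_imp_pdw[OF has_pdw_i_over_lambda]) (use assms that in \<open>auto intro: wdifferentiableD\<close>)
  then show ?thesis
    unfolding d_minus_delta_eq i_over_lambda_sum i_over_lambda_dxw i_over_lambda_diff i_over_lambda_yder
    by (intro sum.cong refl) simp
qed

text \<open>Each d/dx_j - d/dy_j is a derivation of \<open>moyal\<close>; drawing dx_j out of the
  second factor past the first one produces the parity sign.\<close>

lemma d_minus_delta_moyal:
  assumes "wdifferentiable (2*n) W a" "wdifferentiable (2*n) W b" "x \<in> W"
  shows "d_minus_delta n (\<lambda>z. moyal n (a z) (b z)) x = moyal n (d_minus_delta n a x) (b x) + moyal n (par (a x)) (d_minus_delta n b x)"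
proof -
  have p: "pdw j (\<lambda>z. moyal n (a z) (b z)) x = moyal n (pdw j a x) (b x) + moyal n (a x) (pdw j b x)" if "j < 2*n" for j
    by (rule has_pdw_imp_pdw[OF has_pdw_moyal]) (use assms that in \<open>auto intro: wdifferentiableD\<close>)
  have "d_minus_delta n (\<lambda>z. moyal n (a z) (b z)) x = (\<Sum>j<2*n.
      dxw j (moyal n (pdw j a x - yder j (a x)) (b x) + moyal n (a x) (pdw j b x - yder j (b x))))"
    unfolding d_minus_delta_eq yder_moyal moyal_diff_left moyal_diff_right
    by (intro sum.cong refl arg_cong[where f = "dxw _"]) (simp only: p lessThan_iff, simp add: fun_eq_iff)
  also have "\<dots> = moyal n (d_minus_delta n a x) (b x) + moyal n (par (a x)) (d_minus_delta n b x)"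
    unfolding dxw_add sum.distrib d_minus_delta_eq moyal_sum_left moyal_sum_right moyal_dxw par_par
      dxw_moyal[symmetric] ..
  finally show ?thesis .
qed

section \<open>Supports and degree bounds under differentiation\<close>

lemma pdw_coeff_zero:
  assumes W: "openin (Euclidean_space d) W" "x \<in> W" "j < d" and eq: "\<And>z. z \<in> W \<Longrightarrow> b z k \<alpha> J = 0"
  shows "pdw j b x k \<alpha> J = 0"
proof -
  have "((\<lambda>t. b (x(j := t)) k \<alpha> J) has_vector_derivative 0) (at (x j))"
    by (rule has_vector_derivative_transform_within_open[where S = "{t. x(j := t) \<in> W}" and f = "\<lambda>_. 0"])
      (use open_slice[OF W] W(2) eq in auto)
  then show ?thesis by (simp add: pdw_def pd_def vector_derivative_at)
qed

lemma supported_pdw: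
  assumes W: "openin (Euclidean_space d) W" "x \<in> W" "j < d" and "\<And>z. z \<in> W \<Longrightarrow> supported d (b z)"
  shows "supported d (pdw j b x)"
  unfolding supported_def
proof (intro allI impI)
  fix k \<alpha> J assume "pdw j b x k \<alpha> J \<noteq> 0"
  then obtain z where "z \<in> W" "b z k \<alpha> J \<noteq> 0" using pdw_coeff_zero[OF W, of b k \<alpha> J] by blast
  then show "set_mset \<alpha> \<subseteq> {..<d} \<and> J \<subseteq> {..<d}" using assms(4) by (auto simp: supported_def)
qed

lemma fedosov_ge_pdw:
  assumes W: "openin (Euclidean_space d) W" "x \<in> W" "j < d" and "\<And>z. z \<in> W \<Longrightarrow> fedosov_ge q (b z)"
  shows "fedosov_ge q (pdw j b x)"
  unfolding fedosov_ge_def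
proof (intro allI impI)
  fix k \<alpha> J assume "pdw j b x k \<alpha> J \<noteq> 0"
  then obtain z where "z \<in> W" "b z k \<alpha> J \<noteq> 0" using pdw_coeff_zero[OF W, of b k \<alpha> J] by blast
  then show "q \<le> int (size \<alpha>) + 2 * int k" using assms(4) by (auto simp: fedosov_ge_def)
qed

lemma supported_ext_d:
  assumes "openin (Euclidean_space (2*n)) W" "x \<in> W" and "\<And>z. z \<in> W \<Longrightarrow> supported (2*n) (b z)"
  shows "supported (2*n) (ext_d n b x)"
  unfolding ext_d_eq using assms by (intro supported_sum supported_dxw supported_pdw) auto

lemma supported_d_minus_delta:
  assumes "openin (Euclidean_space (2*n)) W" "x \<in> W" and "\<And>z. z \<in> W \<Longrightarrow> supported (2*n) (b z)"
  shows "supported (2*n) (d_minus_delta n b x)"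
  unfolding d_minus_delta_def using assms by (intro supported_diff supported_ext_d supported_delta) auto

lemma fedosov_ge_ext_d:
  assumes "openin (Euclidean_space (2*n)) W" "x \<in> W" and "\<And>z. z \<in> W \<Longrightarrow> fedosov_ge q (b z)"
  shows "fedosov_ge q (ext_d n b x)"
  unfolding ext_d_eq using assms by (intro fedosov_ge_sum fedosov_ge_dxw fedosov_ge_pdw) auto

lemma d_minus_delta_par:
  assumes "wdifferentiable (2*n) W b" "openin (Euclidean_space (2*n)) W" "x \<in> W"
    and "\<And>z. z \<in> W \<Longrightarrow> supported (2*n) (b z)"
  shows "d_minus_delta n (\<lambda>z. par (b z)) x = - par (d_minus_delta n b x)"
proof -
  have p: "pdw j (\<lambda>z. par (b z)) x = par (pdw j b x)" if "j < 2*n" for j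
    by (rule has_pdw_imp_pdw[OF has_pdw_par]) (use assms that in \<open>auto intro: wdifferentiableD\<close>)
  have "supported (2*n) (pdw j b x - yder j (b x))" if "j < 2*n" for j
    using assms that by (intro supported_diff supported_pdw supported_yder) auto
  from par_dxw[OF this]
  have "dxw j (par (pdw j b x - yder j (b x))) = - par (dxw j (pdw j b x - yder j (b x)))" if "j < 2*n" for j
    using that by simp
  then show ?thesis unfolding d_minus_delta_eq par_sum sum_negf[symmetric]
    by (intro sum.cong refl) (simp only: p lessThan_iff yder_par par_diff)
qed

lemma d_minus_delta_d_minus_delta:
  assumes b: "wsmooth (2*n) W b" and W: "openin (Euclidean_space (2*n)) W" "x \<in> W"
  shows "d_minus_delta n (d_minus_delta n b) x = 0"
proof -
  \<comment> \<open>The expansion of (d/dx_i - d/dy_i)(d/dx_j - d/dy_j) b. It is symmetric in i and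
    j, while dx_i and dx_j anticommute.\<close>
  define E where "E i j = pdw i (pdw j b) x - yder j (pdw i b x) - (yder i (pdw j b x) - yder i (yder j (b x)))" for i j
  have E: "E i j = E j i" if "i < 2*n" "j < 2*n" for i j
    unfolding E_def pdw_commute[OF b W that] yder_commute[of i j] by (simp add: fun_eq_iff)
  have p: "pdw i (d_minus_delta n b) x = (\<Sum>j<2*n. dxw j (pdw i (pdw j b) x - yder j (pdw i b x)))" if "i < 2*n" for i
    unfolding d_minus_delta_eq
    by (rule has_pdw_imp_pdw, rule has_pdw_sum, rule has_pdw_dxw, rule has_pdw_diff[OF _ has_pdw_yder])
      (use that W in \<open>auto intro!: wsmooth_has_pdw[OF b] wsmooth_has_pdw[OF wsmooth_pdw[OF b]]\<close>)
  have "d_minus_delta n (d_minus_delta n b) x = (\<Sum>i<2*n. dxw i (pdw i (d_minus_delta n b) x - yder i (d_minus_delta n b x)))"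
    by (rule d_minus_delta_eq)
  also have "\<dots> = (\<Sum>i<2*n. \<Sum>j<2*n. dxw i (dxw j (E i j)))"
  proof (intro sum.cong refl)
    fix i assume "i \<in> {..<2*n}"
    then have "pdw i (d_minus_delta n b) x - yder i (d_minus_delta n b x) = (\<Sum>j<2*n. dxw j (E i j))"
      unfolding d_minus_delta_eq[of n b x] yder_sum yder_dxw yder_diff E_def
      by (simp only: lessThan_iff p dxw_diff sum_subtractf)
    then show "dxw i (pdw i (d_minus_delta n b) x - yder i (d_minus_delta n b x)) = (\<Sum>j<2*n. dxw i (dxw j (E i j)))"
      by (simp only: dxw_sum)
  qed
  also have "\<dots> = 0"
    by (rule antisym_sum_zero) (subst dxw_anticommute, simp only: E lessThan_iff)
  finally show ?thesis .
qed

lemma d_minus_delta_cong: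
  assumes "openin (Euclidean_space (2*n)) W" "x \<in> W" "\<And>z. z \<in> W \<Longrightarrow> a z = b z"
  shows "d_minus_delta n a x = d_minus_delta n b x"
  unfolding d_minus_delta_eq using assms pdw_cong[OF assms(1,2) _ assms(3)] by (intro sum.cong refl) simp

text \<open>With $s=\Gamma+r$ one has $D=d-\delta+\frac i\lambda[s,\cdot]$, because $\delta\Gamma=0$, and
  $\Omega+\omega=(d-\delta)s+\frac i\lambda s^2$.\<close>

definition total_curvature :: "nat \<Rightarrow> (coords \<Rightarrow> wform) \<Rightarrow> coords \<Rightarrow> wform" where
  "total_curvature n s z = d_minus_delta n s z + i_over_lambda (moyal n (s z) (s z))"

definition total_derivative :: "nat \<Rightarrow> (coords \<Rightarrow> wform) \<Rightarrow> (coords \<Rightarrow> wform) \<Rightarrow> coords \<Rightarrow> wform" where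
  "total_derivative n s b z = d_minus_delta n b z + i_over_lambda (supercomm n (s z) (b z))"

text \<open>As d - delta has square zero and s is odd, the derivative of the curvature is i/lambda
  times the commutator of (d - delta)s with s. By associativity s commutes with its square, so the
  bracket of s with the curvature is the opposite commutator.\<close>

lemma bianchi:
  assumes W: "openin (Euclidean_space (2*n)) W" "x \<in> W"
    and s: "wsmooth (2*n) W s" "\<And>z. z \<in> W \<Longrightarrow> par (s z) = - s z"
  shows "d_minus_delta n (total_curvature n s) x + i_over_lambda (moyal n (s x) (total_curvature n s x) - moyal n (total_curvature n s x) (s x)) = 0"
proof -
  note ws = wsmooth_wdifferentiable[OF s(1)]
  note 0 = moyal_square_order_zero[OF s(2)[OF W(2)], of n]
  have 1: "d_minus_delta n (total_curvature n s) x = i_over_lambda (moyal n (d_minus_delta n s x) (s x) - moyal n (s x) (d_minus_delta n s x))"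
    unfolding total_curvature_def[abs_def]
      d_minus_delta_add[OF wsmooth_wdifferentiable_d_minus_delta[OF s(1)] wdifferentiable_i_over_lambda[OF wdifferentiable_moyal[OF ws ws]] W(2)]
      d_minus_delta_i_over_lambda[OF wdifferentiable_moyal[OF ws ws] W(2)] d_minus_delta_moyal[OF ws ws W(2)] d_minus_delta_d_minus_delta[OF s(1) W] s(2)[OF W(2)]
      moyal_minus_left by simp
  have "moyal n (s x) (total_curvature n s x) - moyal n (total_curvature n s x) (s x) =
      moyal n (s x) (d_minus_delta n s x) - moyal n (d_minus_delta n s x) (s x)"
    unfolding total_curvature_def moyal_add_left moyal_add_right
      i_over_lambda_moyal_left[of "moyal n (s x) (s x)", OF 0] i_over_lambda_moyal_right[of "moyal n (s x) (s x)", OF 0] moyal_assoc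
    by (simp add: fun_eq_iff)
  then show ?thesis unfolding 1 i_over_lambda_add[symmetric]
    by (simp only: diff_add_cancel add_diff_cancel_left' diff_add_eq add_diff_eq diff_self i_over_lambda_zero)
qed

text \<open>The derivation rule turns (d - delta)[s,b] into [(d - delta)s, b] - [s, (d - delta)b].
  The second term cancels against the mixed term of the outer bracket, and the double bracket
  becomes [s^2,b] by \<open>supercomm_supercomm\<close>.\<close>

lemma total_derivative_total_derivative:
  assumes W: "openin (Euclidean_space (2*n)) W" "x \<in> W"
    and s: "wsmooth (2*n) W s" "\<And>z. z \<in> W \<Longrightarrow> par (s z) = - s z"
    and b: "wsmooth (2*n) W b" "\<And>z. z \<in> W \<Longrightarrow> supported (2*n) (b z)"
  shows "total_derivative n s (total_derivative n s b) x = i_over_lambda (moyal n (total_curvature n s x) (b x) - moyal n (b x) (total_curvature n s x))"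
proof -
  note ws = wsmooth_wdifferentiable[OF s(1)] and wb = wsmooth_wdifferentiable[OF b(1)]
  have 1: "d_minus_delta n (total_derivative n s b) x = i_over_lambda (d_minus_delta n (\<lambda>z. supercomm n (s z) (b z)) x)"
    unfolding total_derivative_def[abs_def]
      d_minus_delta_add[OF wsmooth_wdifferentiable_d_minus_delta[OF b(1)] wdifferentiable_i_over_lambda[OF wdifferentiable_supercomm[OF ws wb]] W(2)]
      d_minus_delta_d_minus_delta[OF b(1) W] d_minus_delta_i_over_lambda[OF wdifferentiable_supercomm[OF ws wb] W(2)] by simp
  have dp: "d_minus_delta n (\<lambda>z. par (b z)) x = - par (d_minus_delta n b x)" by (rule d_minus_delta_par[OF wb W b(2)])
  have 2: "d_minus_delta n (\<lambda>z. supercomm n (s z) (b z)) x = (moyal n (d_minus_delta n s x) (b x) - moyal n (b x) (d_minus_delta n s x)) - supercomm n (s x) (d_minus_delta n b x)"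
    unfolding supercomm_def d_minus_delta_diff[OF wdifferentiable_moyal[OF ws wb] wdifferentiable_moyal[OF wdifferentiable_par[OF wb] ws] W(2)]
      d_minus_delta_moyal[OF ws wb W(2)] d_minus_delta_moyal[OF wdifferentiable_par[OF wb] ws W(2)] par_par
      dp s(2)[OF W(2)] moyal_minus_left
    by (simp add: fun_eq_iff)
  have sc: "supercomm n (s x) (a + c) = supercomm n (s x) a + supercomm n (s x) c" for a c
    unfolding supercomm_def moyal_add_right par_add moyal_add_left by (simp add: fun_eq_iff)
  have "total_derivative n s (total_derivative n s b) x = i_over_lambda (d_minus_delta n (\<lambda>z. supercomm n (s z) (b z)) x) +
      i_over_lambda (supercomm n (s x) (d_minus_delta n b x) + supercomm n (s x) (i_over_lambda (supercomm n (s x) (b x))))"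
    unfolding total_derivative_def[of n s "total_derivative n s b"] 1 unfolding total_derivative_def sc ..
  also have "\<dots> = i_over_lambda ((moyal n (d_minus_delta n s x) (b x) - moyal n (b x) (d_minus_delta n s x)) +
      supercomm n (s x) (i_over_lambda (supercomm n (s x) (b x))))"
    unfolding 2 i_over_lambda_add i_over_lambda_diff by (simp add: fun_eq_iff)
  also have "(moyal n (d_minus_delta n s x) (b x) - moyal n (b x) (d_minus_delta n s x)) +
      supercomm n (s x) (i_over_lambda (supercomm n (s x) (b x))) = moyal n (total_curvature n s x) (b x) - moyal n (b x) (total_curvature n s x)"
    unfolding supercomm_supercomm[OF s(2)[OF W(2)]] total_curvature_def moyal_add_left moyal_add_right by (simp add: fun_eq_iff)
  finally show ?thesis .
qed

section \<open>Linear combinations of smooth functions\<close>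

lemma foldr_pd_lincomb:
  fixes L :: "'i \<Rightarrow> 'b::real_normed_vector \<Rightarrow> 'c::real_normed_vector"
  assumes W: "openin (Euclidean_space d) W" and f: "\<And>i. i \<in> S \<Longrightarrow> smooth_on d W (f i)"
    and L: "\<And>i. i \<in> S \<Longrightarrow> bounded_linear (L i)" and eq: "\<And>x. x \<in> W \<Longrightarrow> h x = (\<Sum>i\<in>S. L i (f i x))"
    and js: "set js \<subseteq> {..<d}" and x: "x \<in> W"
  shows "foldr pd js h x = (\<Sum>i\<in>S. L i (foldr pd js (f i) x))"
    and "j < d \<Longrightarrow> ((\<lambda>t. foldr pd js h (x(j := t))) has_vector_derivative (\<Sum>i\<in>S. L i (pd j (foldr pd js (f i)) x))) (at (x j))"
proof -
  have sm: "smooth_on d W (foldr pd js (f i))" if "i \<in> S" "set js \<subseteq> {..<d}" for i js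
    using that(2) by (induction js) (auto intro: smooth_on_pd f[OF that(1)])
  have D: "((\<lambda>t. g (x(j := t))) has_vector_derivative (\<Sum>i\<in>S. L i (pd j (foldr pd js (f i)) x))) (at (x j))"
    if "set js \<subseteq> {..<d}" "j < d" "x \<in> W" and g: "\<And>x. x \<in> W \<Longrightarrow> g x = (\<Sum>i\<in>S. L i (foldr pd js (f i) x))" for js j x g
  proof (rule has_vector_derivative_transform_within_open[where S = "{t. x(j := t) \<in> W}"])
    show "((\<lambda>t. \<Sum>i\<in>S. L i (foldr pd js (f i) (x(j := t)))) has_vector_derivative
        (\<Sum>i\<in>S. L i (pd j (foldr pd js (f i)) x))) (at (x j))"
      by (intro has_vector_derivative_sum bounded_linear.has_vector_derivative[OF L] smooth_on_has_pd[OF sm that(3,2)] that(1))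
  qed (use open_slice[OF W that(3,2)] that(3) g in auto)
  have F: "foldr pd js h x = (\<Sum>i\<in>S. L i (foldr pd js (f i) x))" if "set js \<subseteq> {..<d}" "x \<in> W" for js x
    using that
  proof (induction js arbitrary: x)
    case Nil
    then show ?case by (simp add: eq)
  next
    case (Cons j js)
    then have "((\<lambda>t. foldr pd js h (x(j := t))) has_vector_derivative (\<Sum>i\<in>S. L i (pd j (foldr pd js (f i)) x))) (at (x j))"
      by (intro D) auto
    then show ?case by (simp add: pd_def[of j "foldr pd js h"] vector_derivative_at)
  qed
  show "foldr pd js h x = (\<Sum>i\<in>S. L i (foldr pd js (f i) x))" by (rule F[OF js x])
  show "((\<lambda>t. foldr pd js h (x(j := t))) has_vector_derivative (\<Sum>i\<in>S. L i (pd j (foldr pd js (f i)) x))) (at (x j))" if "j < d"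
    by (rule D[OF js that x F[OF js]])
qed

text \<open>The maps L may lead from real to complex values, as for the coefficients of
  \<open>Gamma_form\<close> in terms of the real Christoffel symbols. The equation for h is required
  on W only, since chart data are uncontrolled outside the domain.\<close>

lemma smooth_on_lincomb:
  fixes L :: "'i \<Rightarrow> 'b::real_normed_vector \<Rightarrow> 'c::real_normed_vector"
  assumes W: "openin (Euclidean_space d) W" and f: "\<And>i. i \<in> S \<Longrightarrow> smooth_on d W (f i)"
    and L: "\<And>i. i \<in> S \<Longrightarrow> bounded_linear (L i)" and eq: "\<And>x. x \<in> W \<Longrightarrow> h x = (\<Sum>i\<in>S. L i (f i x))"
  shows "smooth_on d W h"
  unfolding smooth_on_def
proof (intro allI impI conjI ballI)
  fix js :: "nat list" assume js: "set js \<subseteq> {..<d}"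
  note F = foldr_pd_lincomb[OF W f L eq js]
  have c: "continuous_map (subtopology (Euclidean_space d) W) euclidean (foldr pd js (f i))" if "i \<in> S" for i
    using f[OF that] js by (auto simp: smooth_on_def)
  have "continuous_map (subtopology (Euclidean_space d) W) euclidean (\<lambda>x. L i (foldr pd js (f i) x))" if "i \<in> S" for i
  proof -
    have "continuous_map euclidean euclidean (L i)"
      using L[OF that] by (simp add: linear_continuous_on)
    from continuous_map_compose[OF c[OF that] this] show ?thesis by (simp add: o_def)
  qed
  then have "continuous_map (subtopology (Euclidean_space d) W) euclidean (\<lambda>x. \<Sum>i\<in>S. L i (foldr pd js (f i) x))"
    by (cases "finite S") (auto intro: continuous_map_sum)
  then show "continuous_map (subtopology (Euclidean_space d) W) euclidean (foldr pd js h)"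
    by (rule continuous_map_eq) (auto simp: F(1))
  show "(\<lambda>t. foldr pd js h (x(i := t))) differentiable at (x i)" if "x \<in> W" "i < d" for x i
    using foldr_pd_lincomb(2)[OF W f L eq js that] by (auto intro: differentiableI_vector)
qed

lemma smooth_on_const:
  assumes "openin (Euclidean_space d) W" "\<And>x. x \<in> W \<Longrightarrow> h x = c"
  shows "smooth_on d W h"
proof -
  have fp: "foldr pd js (\<lambda>_. c) = (\<lambda>_. if js = [] then c else 0)" for js
  proof (induction js)
    case (Cons j js)
    then show ?case by (simp add: pd_def[abs_def])
  qed simp
  have "smooth_on d W (\<lambda>_. c)" unfolding smooth_on_def fp by simp
  \<comment> \<open>A one-term combination transfers smoothness from the constant to a function that
    equals it on W only.\<close>
  from smooth_on_lincomb[OF assms(1), of "{()}" "\<lambda>_ _. c" "\<lambda>_ x. x" h] this assms(2)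
  show ?thesis by (simp add: bounded_linear_ident)
qed

section \<open>Flatness of the Fedosov connection\<close>

definition quad_form :: "nat \<Rightarrow> (nat \<Rightarrow> nat \<Rightarrow> nat \<Rightarrow> real) \<Rightarrow> wform" where
  "quad_form n g = (\<Sum>i<2*n. \<Sum>j<2*n. \<Sum>k<2*n.
     scl (of_real (g i j k) / 2) (ymul i (ymul j (dxw k wone))))"

definition totally_symmetric :: "nat \<Rightarrow> (nat \<Rightarrow> nat \<Rightarrow> nat \<Rightarrow> real) \<Rightarrow> bool" where
  "totally_symmetric d g \<longleftrightarrow> (\<forall>i<d. \<forall>j<d. \<forall>k<d. g i j k = g j i k \<and> g i j k = g i k j)"

lemma totally_symmetricD:
  assumes "totally_symmetric d g" "i < d" "j < d" "k < d"
  shows "g i j k = g j i k" "g i j k = g i k j" "g i j k = g k j i"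
  using assms unfolding totally_symmetric_def by metis+

lemma par_ymul: "par (ymul i b) = ymul i (par b)"
  by (auto simp: par_def ymul_def fun_eq_iff)

lemma par_quad_form: "par (quad_form n g) = - quad_form n g"
  unfolding quad_form_def par_sum par_scl par_ymul par_dxw_wone ymul_minus scl_minus sum_negf ..

lemma supported_quad_form: "supported (2*n) (quad_form n g)"
  unfolding quad_form_def
  by (intro supported_sum supported_scl supported_ymul supported_dxw supported_wone) auto

lemma fedosov_ge_quad_form: "fedosov_ge 2 (quad_form n g)"
proof -
  have "fedosov_ge 0 wone" by (simp add: fedosov_ge_def)
  from fedosov_ge_ymul[OF fedosov_ge_ymul[OF fedosov_ge_dxw[OF this]]] show ?thesis
    unfolding quad_form_def by (intro fedosov_ge_sum fedosov_ge_scl) simp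
qed

text \<open>The derivative hits either of the two variables y; by symmetry of g both contributions
  agree, and the factor 1/2 disappears.\<close>

lemma yder_quad_form:
  assumes g: "totally_symmetric (2*n) g" and p: "p < 2*n"
  shows "yder p (quad_form n g) =
    (\<Sum>i<2*n. \<Sum>k<2*n. scl (of_real (g p i k)) (ymul i (dxw k wone)))"
proof -
  let ?f = "\<lambda>i j k. scl (of_real (g i j k) / 2) (ymul j (dxw k wone))"
  have "yder p (quad_form n g) = (\<Sum>i<2*n. \<Sum>j<2*n. \<Sum>k<2*n.
      (if i = p then ?f p j k else 0) + (if j = p then ?f p i k else 0))"
    unfolding quad_form_def yder_sum yder_scl
  proof (intro sum.cong refl)
    fix i j k assume "i \<in> {..<2*n}" "j \<in> {..<2*n}" "k \<in> {..<2*n}"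
    then have "g i p k = g p i k" using totally_symmetricD(1)[OF g, of i p k] p by simp
    then show "scl (of_real (g i j k) / 2) (yder p (ymul i (ymul j (dxw k wone)))) =
        (if i = p then ?f p j k else 0) + (if j = p then ?f p i k else 0)"
      by (simp only: yder_ymul yder_dxw yder_wone dxw_zero ymul_zero)
        (auto simp: scl_add scl_zero ymul_zero)
  qed
  also have "\<dots> = (\<Sum>i<2*n. if i = p then \<Sum>j<2*n. \<Sum>k<2*n. ?f p j k else 0) +
      (\<Sum>i<2*n. \<Sum>j<2*n. if j = p then \<Sum>k<2*n. ?f p i k else 0)"
    unfolding sum.distrib by (intro arg_cong2[where f = "(+)"] sum.cong refl) auto
  also have "\<dots> = (\<Sum>j<2*n. \<Sum>k<2*n. ?f p j k) + (\<Sum>i<2*n. \<Sum>k<2*n. ?f p i k)"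
    using p by simp
  also have "\<dots> = (\<Sum>i<2*n. \<Sum>k<2*n. scl (of_real (g p i k)) (ymul i (dxw k wone)))"
    unfolding sum.distrib[symmetric] scl_left_add[symmetric] by simp
  finally show ?thesis .
qed

lemma yder_yder_quad_form:
  assumes g: "totally_symmetric (2*n) g" and p: "p < 2*n" and q: "q < 2*n"
  shows "yder q (yder p (quad_form n g)) = (\<Sum>k<2*n. scl (of_real (g p q k)) (dxw k wone))"
proof -
  have "yder q (yder p (quad_form n g)) = (\<Sum>i<2*n. if i = q then \<Sum>k<2*n. scl (of_real (g p q k)) (dxw k wone) else 0)"
    unfolding yder_quad_form[OF g p] yder_sum yder_scl
    by (intro sum.cong refl, simp only: yder_ymul yder_dxw yder_wone dxw_zero ymul_zero) (auto simp: scl_zero)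
  then show ?thesis using q by simp
qed

text \<open>After differentiation the coefficient is symmetric in p and k, whereas dx_p and dx_k
  anticommute.\<close>

lemma delta_quad_form:
  assumes g: "totally_symmetric (2*n) g"
  shows "delta n (quad_form n g) = 0"
proof -
  have "delta n (quad_form n g) = (\<Sum>p<2*n. \<Sum>i<2*n. \<Sum>k<2*n. scl (of_real (g p i k)) (ymul i (dxw p (dxw k wone))))"
    unfolding delta_def by (intro sum.cong refl) (simp only: lessThan_iff yder_quad_form[OF g] dxw_sum dxw_scl ymul_dxw)
  also have "\<dots> = (\<Sum>i<2*n. \<Sum>p<2*n. \<Sum>k<2*n. scl (of_real (g p i k)) (ymul i (dxw p (dxw k wone))))"
    by (rule sum.swap)
  also have "\<dots> = 0"
  proof (rule sum.neutral, rule ballI, rule antisym_sum_zero)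
    fix i p k assume "i \<in> {..<2*n}" "p \<in> {..<2*n}" "k \<in> {..<2*n}"
    then have "g p i k = g k i p" using totally_symmetricD(3)[OF g] by simp
    then show "scl (of_real (g p i k)) (ymul i (dxw p (dxw k wone))) = - scl (of_real (g k i p)) (ymul i (dxw k (dxw p wone)))"
      unfolding dxw_anticommute[of p k] ymul_minus scl_minus by simp
  qed
  finally show ?thesis .
qed

lemma wmul_dxw_wone:
  assumes "supported d b"
  shows "wmul (dxw k wone) b = dxw k b"
proof (intro ext)
  fix m \<alpha> J
  show "wmul (dxw k wone) b m \<alpha> J = dxw k b m \<alpha> J"
  proof (cases "finite J")
    case False
    then show ?thesis using supported_finite[OF assms, of "J - {k}"] by (simp add: wmul_infinite dxw_def)
  qed (simp add: dxw_eq_wmul)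
qed

lemma sum4_swap:
  "(\<Sum>j\<in>S. \<Sum>m\<in>S. \<Sum>i\<in>S. \<Sum>p\<in>S. F j m i p) = (\<Sum>p\<in>S. \<Sum>m\<in>S. \<Sum>i\<in>S. \<Sum>j\<in>S. (F j m i p :: wform))"
  unfolding sum.cartesian_product
  by (rule sum.reindex_bij_witness[where i = "\<lambda>(p, m, i, j). (j, m, i, p)" and j = "\<lambda>(p, m, i, j). (j, m, i, p)"])
    auto

text \<open>A form quadratic in y acts through the first-order term alone. The normalization of
  \<open>Pi_comp\<close> by -1/2 and the factor 2 of
  \<open>i_over_lambda_supercomm_quadratic\<close> combine to the coefficient -omega.\<close>

lemma bracket_quad_form:
  assumes g: "totally_symmetric (2*n) g" and b: "supported (2*n) b"
  shows "i_over_lambda (supercomm n (quad_form n g) b) = (\<Sum>p<2*n. \<Sum>q<2*n. \<Sum>i<2*n. \<Sum>k<2*n.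
     scl (- of_real (omega_comp n p q * g p i k)) (ymul i (dxw k (yder q b))))"
proof -
  have "i_over_lambda (supercomm n (quad_form n g) b) = scl 2 (moyal_term n 1 (quad_form n g) b)"
    by (rule i_over_lambda_supercomm_quadratic[OF par_quad_form])
      (simp only: yder_yder_quad_form[OF g] yder_sum yder_scl yder_dxw yder_wone dxw_zero scl_zero sum.neutral_const)
  also have "\<dots> = (\<Sum>p<2*n. \<Sum>q<2*n. scl (- of_real (omega_comp n p q)) (wmul (yder p (quad_form n g)) (yder q b)))"
    by (simp add: scl_sum scl_scl Pi_comp_def)
  also have "\<dots> = (\<Sum>p<2*n. \<Sum>q<2*n. \<Sum>i<2*n. \<Sum>k<2*n.
     scl (- of_real (omega_comp n p q * g p i k)) (ymul i (dxw k (yder q b))))"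
  proof (intro sum.cong refl)
    fix p q assume "p \<in> {..<2*n}"
    then have "wmul (yder p (quad_form n g)) (yder q b) =
      (\<Sum>i<2*n. \<Sum>k<2*n. scl (of_real (g p i k)) (ymul i (dxw k (yder q b))))"
      by (simp only: lessThan_iff yder_quad_form[OF g] wmul_sum_left wmul_scl_left wmul_ymul
          wmul_dxw_wone[OF supported_yder[OF b]])
    then show "scl (- of_real (omega_comp n p q)) (wmul (yder p (quad_form n g)) (yder q b)) =
      (\<Sum>i<2*n. \<Sum>k<2*n. scl (- of_real (omega_comp n p q * g p i k)) (ymul i (dxw k (yder q b))))"
      by (simp add: scl_sum scl_scl)
  qed
  finally show ?thesis .
qed

lemma Gamma_form_eq: "Gamma_form n D x = quad_form n (chris n D x)"
  by (simp add: Gamma_form_def quad_form_def)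

text \<open>Both sides are sums of the terms y_i dx_j d/dy_m. Writing the connection through lowered
  Christoffel symbols puts the contracted index in the last place; total symmetry moves it to the
  first place, where the bracket has it.\<close>

lemma nabla_eq:
  assumes g: "totally_symmetric (2*n) (chris n (D U) x)" and b: "supported (2*n) (b U x)"
  shows "nabla_W n D b U x = ext_d n (b U) x + i_over_lambda (supercomm n (Gamma_form n (D U) x) (b U x))"
proof -
  let ?g = "chris n (D U) x" and ?T = "\<lambda>i j m. ymul i (dxw j (yder m (b U x)))"
  have scl_sum_left: "scl (of_real (\<Sum>p<2*n. c p)) a = (\<Sum>p<2*n. scl (of_real (c p)) a)" for c a
    by (intro ext) (simp add: scl_apply sum_wform_apply sum_distrib_right)
  have "nabla_W n D b U x = ext_d n (b U) x - (\<Sum>j<2*n. \<Sum>m<2*n. \<Sum>i<2*n.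
      scl (of_real (D U (coord_field j) (coord_field i) x m)) (?T i j m))"
    unfolding nabla_W_def cov_deriv_def ext_d_def dxw_diff sum_subtractf dxw_sum dxw_scl ymul_dxw ..
  also have "(\<Sum>j<2*n. \<Sum>m<2*n. \<Sum>i<2*n. scl (of_real (D U (coord_field j) (coord_field i) x m)) (?T i j m)) =
      (\<Sum>j<2*n. \<Sum>m<2*n. \<Sum>i<2*n. \<Sum>p<2*n. scl (of_real (?g j i p * omega_comp n p m)) (?T i j m))"
    by (intro sum.cong refl) (simp only: lessThan_iff christoffel scl_sum_left)
  also have "\<dots> = (\<Sum>p<2*n. \<Sum>m<2*n. \<Sum>i<2*n. \<Sum>j<2*n. scl (of_real (?g j i p * omega_comp n p m)) (?T i j m))"
    by (rule sum4_swap)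
  also have "\<dots> = (\<Sum>p<2*n. \<Sum>m<2*n. \<Sum>i<2*n. \<Sum>j<2*n. scl (of_real (omega_comp n p m * ?g p i j)) (?T i j m))"
  proof (intro sum.cong refl)
    fix p m i j assume "p \<in> {..<2*n}" "i \<in> {..<2*n}" "j \<in> {..<2*n}"
    then have "?g j i p = ?g p i j" using totally_symmetricD(3)[OF g] by simp
    then show "scl (of_real (?g j i p * omega_comp n p m)) (?T i j m) = scl (of_real (omega_comp n p m * ?g p i j)) (?T i j m)"
      by (simp only: mult.commute)
  qed
  finally show ?thesis unfolding Gamma_form_eq bracket_quad_form[OF g b] scl_left_minus sum_negf
    by (simp only: add_uminus_conv_diff)
qed

section \<open>Symmetry and smoothness of the Christoffel symbols\<close>

lemma coord_field_vfields:
  assumes "openin (Euclidean_space d) W" "i < d"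
  shows "coord_field i \<in> vfields d W"
proof -
  have "smooth_on d W (\<lambda>x. coord_field i x j)" for j
    by (rule smooth_on_const[OF assms(1), where c = "if j = i then 1 else 0"]) (simp add: coord_field_def)
  then show ?thesis using assms(2) by (auto simp: vfields_def smooth_map_def coord_field_def)
qed

lemma dderiv_const: "dderiv d \<xi> (\<lambda>z. c) x = 0"
  by (simp add: dderiv_def pd_def)

text \<open>On coordinate fields all directional derivatives of components vanish. Absence of
  torsion then gives symmetry in the first two indices, and parallelism of omega, paired with
  coordinate fields, symmetry in the last two.\<close>

lemma totally_symmetric_chris:
  assumes W: "openin (Euclidean_space (2*n)) W" "x \<in> W"
    and D: "torsion_free (2*n) W D" "parallel_omega n W D"
  shows "totally_symmetric (2*n) (chris n D x)"
  unfolding totally_symmetric_def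
proof (intro allI impI conjI)
  fix i j k assume ijk: "i < 2*n" "j < 2*n" "k < 2*n"
  note v = coord_field_vfields[OF W(1)]
  have "D (coord_field i) (coord_field j) x m = D (coord_field j) (coord_field i) x m" if "m < 2*n" for m
  proof -
    have "D (coord_field i) (coord_field j) x m - D (coord_field j) (coord_field i) x m =
        dderiv (2*n) (coord_field i) (\<lambda>z. coord_field j z m) x - dderiv (2*n) (coord_field j) (\<lambda>z. coord_field i z m) x"
      using D(1) v[OF ijk(1)] v[OF ijk(2)] W(2) that unfolding torsion_free_def by blast
    also have "\<dots> = 0" by (simp add: coord_field_def[of j] coord_field_def[of i] dderiv_const)
    finally show ?thesis by simp
  qed
  then show "chris n D x i j k = chris n D x j i k" unfolding chris_def by (intro sum.cong) auto
  have "dderiv (2*n) (coord_field i) (\<lambda>z. omega_pair n (coord_field j z) (coord_field k z)) x =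
      omega_pair n (D (coord_field i) (coord_field j) x) (coord_field k x) +
      omega_pair n (coord_field j x) (D (coord_field i) (coord_field k) x)"
    using D(2) v[OF ijk(1)] v[OF ijk(2)] v[OF ijk(3)] W(2) unfolding parallel_omega_def by blast
  moreover have "dderiv (2*n) (coord_field i) (\<lambda>z. omega_pair n (coord_field j z) (coord_field k z)) x = 0"
    by (simp add: coord_field_def[of j] coord_field_def[of k] dderiv_const)
  moreover have "omega_pair n u (coord_field k x) = - (\<Sum>m<2*n. u m * omega_comp n k m)" for u
  proof -
    have "omega_pair n u (coord_field k x) = (\<Sum>a<2*n. \<Sum>l<2*n. if l = k then omega_comp n a k * u a else 0)"
      unfolding omega_pair_def by (intro sum.cong refl) (simp add: coord_field_def)
    also have "\<dots> = (\<Sum>a<2*n. - (u a * omega_comp n k a))"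
      using ijk(3) by (auto simp: omega_comp_def intro!: sum.cong)
    finally show ?thesis by (simp add: sum_negf)
  qed
  moreover have "omega_pair n (coord_field j x) u = (\<Sum>m<2*n. u m * omega_comp n j m)" for u
  proof -
    have "omega_pair n (coord_field j x) u = (\<Sum>a<2*n. if a = j then (\<Sum>l<2*n. u l * omega_comp n j l) else 0)"
      unfolding omega_pair_def by (intro sum.cong refl) (simp add: coord_field_def mult.commute)
    also have "\<dots> = (\<Sum>m<2*n. u m * omega_comp n j m)" using ijk(2) by simp
    finally show ?thesis .
  qed
  ultimately show "chris n D x i j k = chris n D x i k j" by (simp add: chris_def)
qed

lemma wsmooth_Gamma_form:
  assumes W: "openin (Euclidean_space (2*n)) W" and D: "affine_connection (2*n) W D"
  shows "wsmooth (2*n) W (Gamma_form n D)"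
  unfolding wsmooth_def
proof (intro allI)
  fix l \<alpha> J
  have chris: "smooth_on (2*n) W (\<lambda>x. chris n D x i j k)" if "i < 2*n" "j < 2*n" for i j k
  proof (rule smooth_on_lincomb[OF W, where S = "{..<2*n}" and f = "\<lambda>m x. D (coord_field i) (coord_field j) x m"
        and L = "\<lambda>m c. c *\<^sub>R omega_comp n k m"])
    have "D (coord_field i) (coord_field j) \<in> vfields (2*n) W"
      using D coord_field_vfields[OF W] that unfolding affine_connection_def by blast
    then show "smooth_on (2*n) W (\<lambda>x. D (coord_field i) (coord_field j) x m)" if "m \<in> {..<2*n}" for m
      using that by (simp add: vfields_def smooth_map_def)
  qed (auto simp: chris_def bounded_linear_mult_left)
  show "smooth_on (2*n) W (\<lambda>x. Gamma_form n D x l \<alpha> J)"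
  proof (rule smooth_on_lincomb[OF W, where S = "{..<2*n} \<times> {..<2*n} \<times> {..<2*n}"
      and f = "\<lambda>(i, j, k) x. chris n D x i j k"
        and L = "\<lambda>(i, j, k) c. c *\<^sub>R (ymul i (ymul j (dxw k wone)) l \<alpha> J / 2)"])
    fix x assume "x \<in> W"
    show "Gamma_form n D x l \<alpha> J = (\<Sum>v\<in>{..<2*n} \<times> {..<2*n} \<times> {..<2*n}.
        (case v of (i, j, k) \<Rightarrow> \<lambda>c. c *\<^sub>R (ymul i (ymul j (dxw k wone)) l \<alpha> J / 2))
         ((case v of (i, j, k) \<Rightarrow> \<lambda>x. chris n D x i j k) x))"
      unfolding Gamma_form_def sum_wform_apply sum.cartesian_product
      by (intro sum.cong refl) (auto simp: scl_apply scaleR_conv_of_real)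
  qed (auto simp: bounded_linear_scaleR_left intro: chris)
qed

lemma wsmooth_add:
  assumes "openin (Euclidean_space d) W" "wsmooth d W a" "wsmooth d W b"
  shows "wsmooth d W (\<lambda>z. a z + b z)"
  unfolding wsmooth_def
proof (intro allI)
  fix k \<alpha> J
  have "smooth_on d W (\<lambda>x. if i then b x k \<alpha> J else a x k \<alpha> J)" for i
    using assms(2,3) by (cases i) (simp_all add: wsmooth_def)
  then show "smooth_on d W (\<lambda>x. (a x + b x) k \<alpha> J)"
    by (rule smooth_on_lincomb[OF assms(1), where S = "{False, True}" and L = "\<lambda>_ c. c"
          and f = "\<lambda>i x. if i then b x k \<alpha> J else a x k \<alpha> J"])
      (auto simp: bounded_linear_ident)
qed

section \<open>Vanishing of the total curvature\<close>

lemma moyal_term_no_form: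
  assumes "\<And>k \<alpha>. a k \<alpha> {} = 0" shows "moyal_term n m a b k \<gamma> {} = 0"
  using assms
proof (induction m arbitrary: a b)
  case 0
  show ?case using wmul_nonzero[of a b k \<gamma> "{}"] 0 by auto
next
  case (Suc m)
  then show ?case by (simp add: sum_wform_apply scl_apply yder_def)
qed

text \<open>An odd form has no part of form degree 0, hence neither has its square, and d - delta
  raises the form degree. This supplies the hypothesis of
  \<open>hodge_decomposition\<close>.\<close>

lemma total_curvature_no_form:
  assumes "par (s z) = - s z"
  shows "total_curvature n s z k \<gamma> {} = 0"
proof -
  have "s z k \<alpha> {} = 0" for k \<alpha>
    using arg_cong[OF assms, of "\<lambda>f. f k \<alpha> {}"] by (simp add: par_def)
  then have "moyal n (s z) (s z) k \<gamma> {} = 0" for k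
    by (simp add: moyal_eq moyal_term_no_form)
  then show ?thesis by (simp add: total_curvature_def d_minus_delta_eq sum_wform_apply dxw_def i_over_lambda_def)
qed

text \<open>For $A=(d-\delta)s+\frac i\lambda s^2$ the Bianchi identity reads $\delta A=dA+\frac i\lambda[s,A]$, so
  $\delta^-A=0$ and the homotopy formula give $A=\delta^-(dA+\frac i\lambda[s,A])$, which raises
  the Fedosov degree.\<close>

lemma total_curvature_zero:
  assumes W: "openin (Euclidean_space (2*n)) W"
    and s: "wsmooth (2*n) W s" "\<And>z. z \<in> W \<Longrightarrow> par (s z) = - s z"
      "\<And>z. z \<in> W \<Longrightarrow> supported (2*n) (s z)" "\<And>z. z \<in> W \<Longrightarrow> fedosov_ge 2 (s z)"
    and A: "\<And>z. z \<in> W \<Longrightarrow> delta_minus n (total_curvature n s z) = 0"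
    and x: "x \<in> W"
  shows "total_curvature n s x = 0"
proof -
  have sup: "supported (2*n) (total_curvature n s z)" if "z \<in> W" for z
    unfolding total_curvature_def using that s(3) by (intro supported_add supported_d_minus_delta[OF W] supported_i_over_lambda supported_moyal) auto
  have deg: "\<forall>z\<in>W. fedosov_ge (int N) (total_curvature n s z)" for N
  proof (induction N)
    case 0
    show ?case by (simp add: fedosov_ge_def)
  next
    case (Suc N)
    show ?case
    proof
      fix z assume z: "z \<in> W"
      let ?A = "total_curvature n s" and ?C = "i_over_lambda (moyal n (s z) (total_curvature n s z) - moyal n (total_curvature n s z) (s z))"
      have "delta n (?A z) = ext_d n ?A z + ?C"
        using bianchi[OF W z s(1,2)] unfolding d_minus_delta_def by (simp add: algebra_simps)
      moreover have "fedosov_ge (int N) (ext_d n ?A z)" using Suc by (intro fedosov_ge_ext_d[OF W z]) auto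
      \<comment> \<open>The 2 gained from s pays exactly for the division by lambda.\<close>
      moreover have "fedosov_ge (2 + int N - 2) ?C"
        using fedosov_ge_moyal[OF s(4)[OF z], of "int N" "?A z" n] fedosov_ge_moyal[OF _ s(4)[OF z], of "int N" "?A z" n] Suc z
        by (intro fedosov_ge_i_over_lambda fedosov_ge_diff) (auto simp: add.commute)
      ultimately have "fedosov_ge (int N) (delta n (?A z))" by (simp add: fedosov_ge_add)
      from fedosov_ge_delta_minus[OF this, of n]
      have "fedosov_ge (int (Suc N)) (delta_minus n (delta n (?A z)) + delta n (delta_minus n (?A z)))"
        unfolding A[OF z] using additive_zero[of "delta n", OF delta_add] by (simp add: add.commute)
      then show "fedosov_ge (int (Suc N)) (?A z)"
        using hodge_decomposition[OF sup[OF z] total_curvature_no_form[of s z n, OF s(2)[OF z]]] by simp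
    qed
  qed
  show ?thesis
  proof (intro ext)
    fix k \<alpha> J
    show "total_curvature n s x k \<alpha> J = 0 k \<alpha> J"
      \<comment> \<open>The bound exceeds the degree of the given component by one, so its
        coefficient must be 0.\<close>
      using deg[of "Suc (size \<alpha> + 2 * k)"] x unfolding fedosov_ge_def by fastforce
  qed
qed

section \<open>The symplectic form in the Weyl algebra\<close>

lemma supported_omega_form: "supported (2*n) (omega_form n)"
  unfolding omega_form_def by (intro supported_sum supported_dxw supported_wone) auto

lemma par_omega_form: "par (omega_form n) = omega_form n"
proof -
  have "par (dxw j (dxw l wone)) = dxw j (dxw l wone)" if "l < d" for j l d
    using par_dxw[OF supported_dxw[OF supported_wone that], of j] by (simp add: par_dxw_wone dxw_minus)
  then show ?thesis unfolding omega_form_def par_sum by (intro sum.cong refl) auto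
qed

text \<open>The form contains no y, so every contraction with it vanishes and only the product of
  order 0 remains; there an even form commutes with everything.\<close>

lemma moyal_omega_form:
  "moyal n (omega_form n) b = wmul (omega_form n) b" "moyal n b (omega_form n) = wmul (omega_form n) b"
proof -
  have y: "yder p (omega_form n) = 0" for p
    unfolding omega_form_def yder_sum yder_dxw yder_wone dxw_zero by simp
  have B: "moyal_term n (Suc m) (omega_form n) b = 0" "moyal_term n (Suc m) b (omega_form n) = 0" for m
    by (simp_all add: y moyal_term_zero_left moyal_term_zero_right scl_zero del: of_nat_Suc)
  have "moyal n a c = wmul a c" if *: "\<And>m. moyal_term n (Suc m) a c = 0" for a c
  proof (intro ext)
    fix k \<gamma> J
    have "moyal n a c k \<gamma> J = (\<Sum>m\<le>k. if m = 0 then wmul a c k \<gamma> J else 0)"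
      unfolding moyal_eq
    proof (intro sum.cong refl)
      fix m
      show "(- \<i>) ^ m * moyal_term n m a c (k - m) \<gamma> J = (if m = 0 then wmul a c k \<gamma> J else 0)"
        by (cases m) (simp_all add: * del: moyal_term.simps(2))
    qed
    then show "moyal n a c k \<gamma> J = wmul a c k \<gamma> J" by simp
  qed
  from this[OF B(1)] this[OF B(2)] wmul_comm_even[OF par_omega_form, of n b]
  show "moyal n (omega_form n) b = wmul (omega_form n) b" "moyal n b (omega_form n) = wmul (omega_form n) b"
    by simp_all
qed

text \<open>Since \<open>delta_minus\<close> has square zero, it kills \<open>\<rho>\<close>, and
  the homotopy formula shrinks to \<open>delta_minus n (delta n \<rho>) = \<rho>\<close>. Thus both
  terms of the difference are mapped to \<open>\<rho>\<close>.\<close>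

lemma delta_minus_total_curvature:
  assumes sup: "supported (2*n) \<rho>" "supported (2*n) c" and r: "\<rho> = delta_minus n c" and deg: "\<And>k. \<rho> k {#} {} = 0"
  shows "delta_minus n (c - delta n \<rho>) = 0"
proof -
  have "delta_minus n \<rho> = 0" unfolding r by (rule delta_minus_delta_minus[OF sup(2)])
  then have "delta_minus n (delta n \<rho>) = \<rho>"
    using hodge_decomposition[OF sup(1) deg] additive_zero[of "delta n", OF delta_add] by simp
  then show ?thesis unfolding delta_minus_diff r[symmetric] by simp
qed

text \<open>A pullback reads the section only at the image point, which matters because sections are
  known on chart domains only.\<close>

lemma pullback_cong_minus:
  assumes "b (\<phi> x) = - c (\<phi> x)"
  shows "pullback d \<phi> b x = - pullback d \<phi> c x"
  unfolding pullback_def assms by (intro ext) (simp add: sum_negf)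

lemma strat_sectionsD:
  assumes "b \<in> strat_sections n X" "U \<in> objs X"
  shows "wsmooth (2*n) (odom X U) (b U)" and "x \<in> odom X U \<Longrightarrow> supported (2*n) (b U x)"
proof -
  have *: "smooth_on (2*n) (odom X U) (\<lambda>x. b U x k \<alpha> J) \<and>
      (\<forall>x\<in>odom X U. b U x k \<alpha> J \<noteq> 0 \<longrightarrow> set_mset \<alpha> \<subseteq> {..<2*n} \<and> J \<subseteq> {..<2*n})" for k \<alpha> J
    using conjunct1[OF assms(1)[unfolded strat_sections_def mem_Collect_eq], THEN bspec, OF assms(2)]
    by (elim allE)
  show "wsmooth (2*n) (odom X U) (b U)" unfolding wsmooth_def using * by simp
  show "supported (2*n) (b U x)" if "x \<in> odom X U" unfolding supported_def
    using *[THEN conjunct2, THEN bspec, OF that] by (intro allI)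
qed

lemma strat_sections_degD:
  assumes "b \<in> strat_sections_deg n X l"
  shows "b \<in> strat_sections n X"
    and "U \<in> objs X \<Longrightarrow> x \<in> odom X U \<Longrightarrow> b U x k \<alpha> J \<noteq> 0 \<Longrightarrow> card J = l"
  using assms by (simp_all add: strat_sections_deg_def)

lemma is_orbispace_act:
  assumes "is_orbispace d X" "U \<in> objs X" "g \<in> carrier (ogrp X U)" "x \<in> odom X U"
  shows "oact X U g x \<in> odom X U"
proof -
  have "orbispace_chart d (base X) U (chart X U)" using assms(1,2) by (simp add: is_orbispace_def)
  then have "smooth_action d (odom X U) (ogrp X U) (oact X U)"
    by (simp add: orbispace_chart_def man_sym_def)
  then have "\<forall>g\<in>carrier (ogrp X U). oact X U g ` odom X U \<subseteq> odom X U"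
    unfolding smooth_action_def by (rule conjunct1)
  then show ?thesis using assms(3,4) by blast
qed

lemma is_orbispace_emb:
  assumes "is_orbispace d X" "U \<in> objs X" "V \<in> objs X" "V \<subseteq> U" "y \<in> odom X V"
  shows "emb X V U y \<in> odom X U"
proof -
  have "\<forall>U\<in>objs X. \<forall>V\<in>objs X. V \<subseteq> U \<longrightarrow>
        chart_morphism d (chart X V) (chart X U) (emb X V U) (ghom X V U) \<and>
        open_embedding d (chart X V) (chart X U) (emb X V U)"
    using assms(1) unfolding is_orbispace_def by (elim conjE)
  then have "chart_morphism d (chart X V) (chart X U) (emb X V U) (ghom X V U)"
    using assms(2-4) by blast
  then have "emb X V U ` odom X V \<subseteq> odom X U"
    unfolding chart_morphism_def by (rule conjunct1)
  then show ?thesis using assms(5) by blast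
qed

theorem corollary4p11:
  fixes n :: nat
    and X :: "('x, 'g) orbispace"
    and conn :: "'x set \<Rightarrow> connection"
    and R r\<^sub>0 r \<Omega> :: "'x wsec"
    and D :: "'x wsec \<Rightarrow> 'x wsec"
  defines "R \<equiv> curvature n conn"
    and "r\<^sub>0 \<equiv> delta_minus_X n R"
    and "\<Omega> \<equiv> - omega_sec n + R - delta_X n r + nabla_W n conn r + square_X n r"
    and "D \<equiv> (\<lambda>b. nabla_W n conn b - delta_X n b + bracket_X n r b)"
  assumes "symplectic_orbispace n X"
    and "symplectic_connection n X conn"
    and "r \<in> strat_sections_deg n X 1"
    and "deg_F X r \<ge> deg_F X r\<^sub>0"
    and "sec_eq X r (r\<^sub>0 + delta_minus_X n (nabla_W n conn r + square_X n r))"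
  shows "is_curvature_of n X \<Omega> D \<and>
    central n X \<Omega> \<and>
    sec_eq X \<Omega> (- omega_sec n) \<and>
    flat_connection n X D"
proof -
  \<comment> \<open>Christoffel forms need not be compatible with the embeddings, so
    \<open>\<Gamma>\<close> and \<open>s\<close> are merely families of local forms, not stratified
    sections.\<close>
  define \<Gamma> where "\<Gamma> U = Gamma_form n (conn U)" for U
  define s where "s U z = \<Gamma> U z + r U z" for U z
  have orb: "is_orbispace (2*n) X" using assms(5) by (simp add: symplectic_orbispace_def)
  have W: "openin (Euclidean_space (2*n)) (odom X U)" if "U \<in> objs X" for U
    using orb that by (simp add: is_orbispace_def orbispace_chart_def man_sym_def)
  have \<Gamma>_sym: "totally_symmetric (2*n) (chris n (conn U) x)" if "U \<in> objs X" "x \<in> odom X U" for U x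
    using assms(6) that by (intro totally_symmetric_chris[OF W]) (auto simp: symplectic_connection_def)
  have \<Gamma>_smooth: "wsmooth (2*n) (odom X U) (\<Gamma> U)" if "U \<in> objs X" for U
    using assms(6) that unfolding \<Gamma>_def
    by (intro wsmooth_Gamma_form W) (auto simp: symplectic_connection_def orb_connection_def)
  have \<Gamma>_alg: "supported (2*n) (\<Gamma> U x)" "par (\<Gamma> U x) = - \<Gamma> U x" "fedosov_ge 2 (\<Gamma> U x)" for U x
    unfolding \<Gamma>_def Gamma_form_eq by (rule supported_quad_form par_quad_form fedosov_ge_quad_form)+
  have smooth: "wsmooth (2*n) (odom X U) (b U)" if "b \<in> strat_sections n X" "U \<in> objs X" for b U
    using strat_sectionsD(1)[OF that] .
  have sup: "supported (2*n) (b U x)" if "b \<in> strat_sections n X" "U \<in> objs X" "x \<in> odom X U" for b U x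
    using strat_sectionsD(2)[OF that] .
  have r: "r \<in> strat_sections n X" by (rule strat_sections_degD(1)[OF assms(7)])
  have r_par: "par (r U x) = - r U x" if "U \<in> objs X" "x \<in> odom X U" for U x
  proof (intro ext)
    fix k \<alpha> J
    have "r U x k \<alpha> J = 0 \<or> card J = 1" using strat_sections_degD(2)[OF assms(7) that] by blast
    then show "par (r U x) k \<alpha> J = (- r U x) k \<alpha> J" by (auto simp: par_def)
  qed
  have nabla: "nabla_W n conn b U x = ext_d n (b U) x + i_over_lambda (supercomm n (\<Gamma> U x) (b U x))"
    if "U \<in> objs X" "x \<in> odom X U" "supported (2*n) (b U x)" for b U x
    unfolding \<Gamma>_def using that by (intro nabla_eq \<Gamma>_sym)
  have \<Gamma>_R: "R U x = ext_d n (\<Gamma> U) x + i_over_lambda (moyal n (\<Gamma> U x) (\<Gamma> U x))"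
    if "U \<in> objs X" "x \<in> odom X U" for U x
  proof -
    \<comment> \<open>The graded commutator of an odd form with itself is twice its square, which
      absorbs the 1/2 in \<open>curvature\<close>.\<close>
    have "gcomm n (\<Gamma> U x) (\<Gamma> U x) = scl 2 (moyal n (\<Gamma> U x) (\<Gamma> U x))"
      unfolding gcomm_odd[OF \<Gamma>_alg(1,1,2)] supercomm_def \<Gamma>_alg(2) moyal_minus_left
      by (intro ext) (simp add: scl_apply)
    then show ?thesis
      unfolding R_def curvature_def \<Gamma>_def[symmetric] by (simp only: i_over_lambda_scl scl_scl) (simp add: scl_one)
  qed
  have R_sup: "supported (2*n) (R U x)" and R_deg: "fedosov_ge 2 (R U x)" if "U \<in> objs X" "x \<in> odom X U" for U x
  proof -
    show "supported (2*n) (R U x)" unfolding \<Gamma>_R[OF that]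
      using that \<Gamma>_alg by (intro supported_add supported_ext_d[OF W] supported_i_over_lambda supported_moyal)
    \<comment> \<open>The square of \<open>\<Gamma>\<close> has degree at least 4, of which i/lambda
      takes away 2.\<close>
    have "fedosov_ge 2 (i_over_lambda (moyal n (\<Gamma> U x) (\<Gamma> U x)))"
      using fedosov_ge_i_over_lambda[OF fedosov_ge_moyal[OF \<Gamma>_alg(3,3)]] by simp
    then show "fedosov_ge 2 (R U x)" unfolding \<Gamma>_R[OF that]
      using that \<Gamma>_alg by (intro fedosov_ge_add fedosov_ge_ext_d[OF W])
  qed
  have r_deg: "fedosov_ge 2 (r U x)" if "U \<in> objs X" "x \<in> odom X U" for U x
    unfolding fedosov_ge_def
  proof (intro allI impI)
    fix k \<alpha> J assume nz: "r U x k \<alpha> J \<noteq> 0"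
    \<comment> \<open>R has degree at least 2 and \<open>delta_minus\<close> adds 1. The infimum
      defining \<open>deg_F\<close> is global, so the bound is established over all charts and then
      passes to r through the assumption on degrees.\<close>
    have "3 \<le> deg_F X r\<^sub>0"
      unfolding deg_F_def
    proof (rule Inf_greatest)
      fix e assume "e \<in> {enat (size \<alpha> + 2 * k) | U x k \<alpha> J. U \<in> objs X \<and> x \<in> odom X U \<and> r\<^sub>0 U x k \<alpha> J \<noteq> 0}"
      then obtain V y l \<beta> K where e: "e = enat (size \<beta> + 2 * l)" "V \<in> objs X" "y \<in> odom X V" "r\<^sub>0 V y l \<beta> K \<noteq> 0"
        by blast
      have "fedosov_ge (2 + 1) (r\<^sub>0 V y)"
        unfolding r\<^sub>0_def delta_minus_X_def using e by (intro fedosov_ge_delta_minus R_deg)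
      then have "3 \<le> size \<beta> + 2 * l" using e(4) unfolding fedosov_ge_def by fastforce
      then show "3 \<le> e" unfolding e(1) by (simp add: numeral_eq_enat)
    qed
    also have "\<dots> \<le> deg_F X r" by (rule assms(8))
    also have "\<dots> \<le> enat (size \<alpha> + 2 * k)"
      unfolding deg_F_def using nz that by (intro Inf_lower) blast
    finally show "2 \<le> int (size \<alpha>) + 2 * int k" by (simp add: numeral_eq_enat)
  qed
  have s_smooth: "wsmooth (2*n) (odom X U) (s U)" if "U \<in> objs X" for U
    unfolding s_def[abs_def] using that by (intro wsmooth_add W \<Gamma>_smooth smooth r)
  have s_par: "par (s U x) = - s U x" and s_sup: "supported (2*n) (s U x)" and s_deg: "fedosov_ge 2 (s U x)"
    if "U \<in> objs X" "x \<in> odom X U" for U x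
  proof -
    show "par (s U x) = - s U x" unfolding s_def par_add \<Gamma>_alg r_par[OF that] by (intro ext) simp
    show "supported (2*n) (s U x)" unfolding s_def using that r by (intro supported_add \<Gamma>_alg sup)
    show "fedosov_ge 2 (s U x)" unfolding s_def using that by (intro fedosov_ge_add \<Gamma>_alg r_deg)
  qed
  have total_curvature_s: "total_curvature n (s U) x = (R U x + (nabla_W n conn r U x + square_X n r U x)) - delta n (r U x)"
    if "U \<in> objs X" "x \<in> odom X U" for U x
  proof -
    have d: "d_minus_delta n (s U) x = d_minus_delta n (\<Gamma> U) x + d_minus_delta n (r U) x"
      unfolding s_def[abs_def]
      by (rule d_minus_delta_add[OF wsmooth_wdifferentiable[OF \<Gamma>_smooth[OF that(1)]] wsmooth_wdifferentiable[OF smooth[OF r that(1)]] that(2)])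
    \<comment> \<open>Total symmetry enters here through \<open>delta_quad_form\<close>, which
      removes the delta-term of \<open>\<Gamma>\<close>.\<close>
    have dG: "d_minus_delta n (\<Gamma> U) x = ext_d n (\<Gamma> U) x"
      unfolding d_minus_delta_def using delta_quad_form[OF \<Gamma>_sym[OF that]] by (simp add: \<Gamma>_def Gamma_form_eq)
    \<comment> \<open>The mixed terms form the bracket of \<open>\<Gamma>\<close> with r, which
      completes dr to the covariant derivative of r.\<close>
    have m: "moyal n (s U x) (s U x) = moyal n (\<Gamma> U x) (\<Gamma> U x) + (supercomm n (\<Gamma> U x) (r U x) + moyal n (r U x) (r U x))"
      unfolding s_def supercomm_def r_par[OF that] moyal_add_left moyal_add_right moyal_minus_left
      by (intro ext) simp
    show ?thesis
      unfolding total_curvature_def d dG m i_over_lambda_add d_minus_delta_def[of n "r U"] \<Gamma>_R[OF that] nabla[of U x r, OF that sup[OF r that]] square_X_def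
      by (intro ext) simp
  qed
  have r_eq: "r U x = delta_minus n (R U x + (nabla_W n conn r U x + square_X n r U x))"
    if "U \<in> objs X" "x \<in> odom X U" for U x
    using assms(9) that unfolding sec_eq_def r\<^sub>0_def delta_minus_X_def by (simp add: delta_minus_add)
  have dm: "delta_minus n (total_curvature n (s U) x) = 0" if "U \<in> objs X" "x \<in> odom X U" for U x
    unfolding total_curvature_s[OF that]
  proof (rule delta_minus_total_curvature[OF sup[OF r that] _ r_eq[OF that]])
    show "supported (2*n) (R U x + (nabla_W n conn r U x + square_X n r U x))"
      unfolding nabla[of U x r, OF that sup[OF r that]] square_X_def supercomm_def using that r
      by (intro supported_add R_sup supported_ext_d[OF W] supported_i_over_lambda supported_diff supported_moyal supported_par \<Gamma>_alg sup)
    \<comment> \<open>A form of degree 1 has no component of total degree 0, so the homotopy formula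
      applies to r.\<close>
    show "r U x k {#} {} = 0" for k
      using arg_cong[OF r_par[OF that], of "\<lambda>f. f k {#} {}"] by (simp add: par_def)
  qed
  have A: "total_curvature n (s U) x = 0" if "U \<in> objs X" "x \<in> odom X U" for U x
    by (rule total_curvature_zero[OF W[OF that(1)] s_smooth[OF that(1)] s_par[OF that(1)] s_sup[OF that(1)] s_deg[OF that(1)] dm[OF that(1)] that(2)])
  have Omega: "\<Omega> U x = - omega_form n" if "U \<in> objs X" "x \<in> odom X U" for U x
  proof -
    have "\<Omega> U x = - omega_form n + total_curvature n (s U) x"
      unfolding \<Omega>_def total_curvature_s[OF that] by (intro ext) (simp add: omega_sec_def delta_X_def)
    then show ?thesis unfolding A[OF that] by simp
  qed
  have D_eq: "D b U x = total_derivative n (s U) (b U) x" if "U \<in> objs X" "x \<in> odom X U" "supported (2*n) (b U x)" for b U x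
  proof -
    have sc: "supercomm n (s U x) c = supercomm n (\<Gamma> U x) c + supercomm n (r U x) c" for c
      unfolding s_def supercomm_def moyal_add_left moyal_add_right by (intro ext) simp
    have br: "bracket_X n r b U x = i_over_lambda (supercomm n (r U x) (b U x))"
      unfolding bracket_X_def gcomm_odd[OF sup[OF r that(1,2)] that(3) r_par[OF that(1,2)]] ..
    show ?thesis
      unfolding D_def total_derivative_def d_minus_delta_def minus_apply plus_fun_apply nabla[of U x b, OF that] delta_X_def
        sc br i_over_lambda_add
      by (intro ext) simp
  qed
  have DD: "D (D b) U x = 0" if b: "b \<in> strat_sections n X" and U: "U \<in> objs X" "x \<in> odom X U" for b U x
  proof -
    have eq: "D b U z = total_derivative n (s U) (b U) z" if "z \<in> odom X U" for z
      by (rule D_eq[of U z b, OF U(1) that sup[OF b U(1) that]])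
    \<comment> \<open>Knowing the support of \<open>D b\<close> allows \<open>D_eq\<close> to be
      applied a second time, to the outer D.\<close>
    have "supported (2*n) (D b U x)"
      unfolding eq[OF U(2)] total_derivative_def supercomm_def using U sup[OF b U(1)]
      by (intro supported_add supported_d_minus_delta[OF W] supported_i_over_lambda supported_diff supported_moyal supported_par s_sup)
    then have "D (D b) U x = total_derivative n (s U) (D b U) x" by (rule D_eq[of U x "D b", OF U])
    also have "\<dots> = total_derivative n (s U) (total_derivative n (s U) (b U)) x"
    proof -
      \<comment> \<open>A derivative is involved, so the equality is used on the whole domain and
        not just at x.\<close>
      have "d_minus_delta n (D b U) x = d_minus_delta n (total_derivative n (s U) (b U)) x" by (rule d_minus_delta_cong[OF W[OF U(1)] U(2) eq])
      then show ?thesis unfolding total_derivative_def[of n "s U" "D b U"] total_derivative_def[of n "s U" "total_derivative n (s U) (b U)"] eq[OF U(2)]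
        by (simp only:)
    qed
    also have "\<dots> = i_over_lambda (moyal n (total_curvature n (s U) x) (b U x) - moyal n (b U x) (total_curvature n (s U) x))"
      by (rule total_derivative_total_derivative[OF W[OF U(1)] U(2) s_smooth[OF U(1)] s_par[OF U(1)] smooth[OF b U(1)] sup[OF b U(1)]])
    also have "\<dots> = 0"
      unfolding A[OF U] moyal_zero_left moyal_zero_right diff_self i_over_lambda_zero ..
    finally show ?thesis .
  qed
  have flat: "flat_connection n X D"
    using DD by (simp add: flat_connection_def sec_eq_def)
  have comm: "moyal n (\<Omega> U x) c = moyal n c (\<Omega> U x)" if "U \<in> objs X" "x \<in> odom X U" for U x c
    unfolding Omega[OF that] moyal_minus_left moyal_minus_right moyal_omega_form ..
  have "is_curvature_of n X \<Omega> D"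
    unfolding is_curvature_of_def sec_eq_def
  proof (intro ballI)
    fix b U x assume b: "b \<in> strat_sections n X" and U: "U \<in> objs X" "x \<in> odom X U"
    \<comment> \<open>Both sides of the curvature equation vanish: the left one by flatness, the
      right one because \<open>\<Omega>\<close> is even and commutes with every form, so its graded
      commutators are zero.\<close>
    have "gcomm n (\<Omega> U x) (b U x) = moyal n (\<Omega> U x) (b U x) - moyal n (b U x) (\<Omega> U x)"
    proof (rule gcomm_even[OF _ sup[OF b U]])
      show "supported (2*n) (\<Omega> U x)" unfolding Omega[OF U] by (intro supported_minus supported_omega_form)
      show "par (\<Omega> U x) = \<Omega> U x" unfolding Omega[OF U] par_minus par_omega_form ..
    qed
    then show "D (D b) U x = bracket_X n \<Omega> b U x"
      unfolding DD[OF b U] bracket_X_def by (simp only: comm[OF U] diff_self i_over_lambda_zero)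
  qed
  moreover have "central n X \<Omega>"
    unfolding central_def
  proof (intro conjI ballI)
    show "\<Omega> \<in> strat_sections n X"
      unfolding strat_sections_def mem_Collect_eq
    proof (intro conjI ballI allI impI)
      fix U k \<alpha> J assume U: "U \<in> objs X"
      show "smooth_on (2*n) (odom X U) (\<lambda>x. \<Omega> U x k \<alpha> J)"
        by (rule smooth_on_const[OF W[OF U]]) (simp add: Omega[OF U])
      fix x assume x: "x \<in> odom X U" and nz: "\<Omega> U x k \<alpha> J \<noteq> 0"
      have "supported (2*n) (\<Omega> U x)"
        unfolding Omega[OF U x] by (intro supported_minus supported_omega_form)
      with nz have c: "set_mset \<alpha> \<subseteq> {..<2*n} \<and> J \<subseteq> {..<2*n}"
        unfolding supported_def by blast
      show "set_mset \<alpha> \<subseteq> {..<2*n}" by (rule conjunct1[OF c])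
      show "J \<subseteq> {..<2*n}" by (rule conjunct2[OF c])
    next
      fix U g x assume U: "U \<in> objs X" and g: "g \<in> carrier (ogrp X U)" and x: "x \<in> odom X U"
      have "oact X U g x \<in> odom X U"
        by (rule is_orbispace_act[OF orb U g x])
      \<comment> \<open>Invariance of \<open>\<Omega>\<close> is reduced to that of the constant
        form omega, which is part of the symplectic structure; the argument for embeddings below is
        the same.\<close>
      then have "pullback (2*n) (oact X U g) (\<Omega> U) x = - pullback (2*n) (oact X U g) (\<lambda>_. omega_form n) x"
        by (intro pullback_cong_minus Omega[OF U])
      also have "\<dots> = \<Omega> U x"
        using assms(5) U g x by (simp only: symplectic_orbispace_def Omega[OF U x])
      finally show "pullback (2*n) (oact X U g) (\<Omega> U) x = \<Omega> U x" .
    next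
      fix U V y assume U: "U \<in> objs X" and V: "V \<in> objs X" "V \<subseteq> U" and y: "y \<in> odom X V"
      have "emb X V U y \<in> odom X U"
        by (rule is_orbispace_emb[OF orb U V y])
      then have "pullback (2*n) (emb X V U) (\<Omega> U) y = - pullback (2*n) (emb X V U) (\<lambda>_. omega_form n) y"
        by (intro pullback_cong_minus Omega[OF U])
      also have "\<dots> = \<Omega> V y"
        using assms(5) U V y by (simp only: symplectic_orbispace_def Omega[OF V(1) y])
      finally show "pullback (2*n) (emb X V U) (\<Omega> U) y = \<Omega> V y" .
    qed
  qed (simp add: sec_eq_def comm)
  moreover have "sec_eq X \<Omega> (- omega_sec n)"
    by (simp add: sec_eq_def Omega omega_sec_def fun_eq_iff)
  ultimately show ?thesis using flat by blast
qed

end
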